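(* Let $K$ be a field of characteristic $p\ge 0$ with algebraic closure $\overline{K}$, let $r\in K[t]$ be a (nonzero) polynomial of degree $n\ge 0$, and let $X=\{\alpha\in\overline{K}\mid r(\alpha)=0\}$ be its set of roots in $\overline{K}$. (i) If $X$ is an arithmetically-free subset of the additive group $(\overline{K},+)$, then every finite-dimensional Lie algebra $\mathfrak{g}$ over $K$ admitting a derivation $D$ which satisfies $r(D)=0$ is nilpotent of class $c(\mathfrak{g})\le H(n)$. (ii) If $X$ is not an arithmetically-free subset of $(\overline{K},+)$, then there exists some non-nilpotent Lie algebra over $\overline{K}$ of dimension $n+1$ admitting a derivation $D$ which satisfies $r(D)=0$.
   Context: A subset $X$ of an additive abelian group $(G,+)$ is called arithmetically-free if there are no $\alpha,\beta\in X$ such that $\alpha+k\beta\in X$ for all integers $k\ge 0$ (that is, $X$ contains no arithmetic progression $\alpha,\alpha+\beta,\alpha+2\beta,\ldots$ with $\alpha,\beta\in X$). $c(\mathfrak{g})$ denotes the nilpotency class of a nilpotent Lie algebra (or Lie ring). $H$ is the generalized Higman map: $H(n)$ is the least natural number such that every Lie ring $L$ which is graded by an abelian group $(A,+)$, i.e. $L=\bigoplus_{a\in A}L_a$ with $[L_a,L_b]\subseteq L_{a+b}$, and whose support $\{a\in A\mid L_a\neq 0\}$ is contained in an arithmetically-free subset of $A$ with at most $n$ elements, is nilpotent of class at most $H(n)$. (Such a number exists for each $n$ by a known theorem of Moens.) *)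

theory Defs
  imports
    "HOL-Algebra.Algebraic_Closure_Type"
    "HOL-Algebra.AbelCoset"
    "Jordan_Normal_Form.Missing_VectorSpace"
begin

section \<open>Lie rings and Lie algebras\<close>

text \<open>
  Lie rings are carried by the \<open>ring\<close> records of HOL-Algebra, the field \<open>mult\<close> being the Lie
  bracket; the field \<open>one\<close> plays no role. Lie algebras are carried by \<open>module\<close> records.
\<close>

locale lie_ring = abelian_group L for L (structure) +
  assumes bracket_closed: "\<lbrakk>x \<in> carrier L; y \<in> carrier L\<rbrakk> \<Longrightarrow> x \<otimes> y \<in> carrier L"
    and bracket_add_left: "\<lbrakk>x \<in> carrier L; y \<in> carrier L; z \<in> carrier L\<rbrakk>
      \<Longrightarrow> (x \<oplus> y) \<otimes> z = x \<otimes> z \<oplus> y \<otimes> z"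
    and bracket_add_right: "\<lbrakk>x \<in> carrier L; y \<in> carrier L; z \<in> carrier L\<rbrakk>
      \<Longrightarrow> z \<otimes> (x \<oplus> y) = z \<otimes> x \<oplus> z \<otimes> y"
    and bracket_self: "x \<in> carrier L \<Longrightarrow> x \<otimes> x = \<zero>"
    and jacobi: "\<lbrakk>x \<in> carrier L; y \<in> carrier L; z \<in> carrier L\<rbrakk>
      \<Longrightarrow> x \<otimes> (y \<otimes> z) \<oplus> y \<otimes> (z \<otimes> x) \<oplus> z \<otimes> (x \<otimes> y) = \<zero>"

locale lie_algebra = vectorspace K L + lie?: lie_ring L for K and L (structure) +
  assumes bracket_smult_left: "\<lbrakk>a \<in> carrier K; x \<in> carrier L; y \<in> carrier L\<rbrakk>
      \<Longrightarrow> (a \<odot> x) \<otimes> y = a \<odot> (x \<otimes> y)"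
    and bracket_smult_right: "\<lbrakk>a \<in> carrier K; x \<in> carrier L; y \<in> carrier L\<rbrakk>
      \<Longrightarrow> x \<otimes> (a \<odot> y) = a \<odot> (x \<otimes> y)"

text \<open>
  \<open>lower_central L i\<close> is the term usually written \<open>\<gamma>\<close> with index \<open>i + 1\<close>. The additive span suffices
  for Lie algebras too: scalars can be moved into the second argument of the bracket.
\<close>

primrec lower_central :: "('a, 'm) ring_scheme \<Rightarrow> nat \<Rightarrow> 'a set" where
  "lower_central L 0 = carrier L"
| "lower_central L (Suc i) =
     generate (add_monoid L) {x \<otimes>\<^bsub>L\<^esub> y | x y. x \<in> lower_central L i \<and> y \<in> carrier L}"

definition lie_nilpotent :: "('a, 'm) ring_scheme \<Rightarrow> bool" where
  "lie_nilpotent L \<longleftrightarrow> (\<exists>c. lower_central L c = {\<zero>\<^bsub>L\<^esub>})"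

definition nilpotency_class :: "('a, 'm) ring_scheme \<Rightarrow> nat" where
  "nilpotency_class L = (LEAST c. lower_central L c = {\<zero>\<^bsub>L\<^esub>})"

definition lie_derivation ::
    "('k, 'c) ring_scheme \<Rightarrow> ('k, 'a, 'm) module_scheme \<Rightarrow> ('a \<Rightarrow> 'a) \<Rightarrow> bool" where
  "lie_derivation K L D \<longleftrightarrow>
     D \<in> module_hom K L L \<and>
     (\<forall>x\<in>carrier L. \<forall>y\<in>carrier L.
        D (x \<otimes>\<^bsub>L\<^esub> y) = (D x \<otimes>\<^bsub>L\<^esub> y) \<oplus>\<^bsub>L\<^esub> (x \<otimes>\<^bsub>L\<^esub> D y))"

definition poly_annihilates ::
    "'k::comm_ring_1 poly \<Rightarrow> ('k, 'a, 'm) module_scheme \<Rightarrow> ('a \<Rightarrow> 'a) \<Rightarrow> bool" where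
  "poly_annihilates r L D \<longleftrightarrow>
     (\<forall>x\<in>carrier L. (\<Oplus>\<^bsub>L\<^esub>i\<in>{..degree r}. coeff r i \<odot>\<^bsub>L\<^esub> (D ^^ i) x) = \<zero>\<^bsub>L\<^esub>)"

section \<open>Arithmetically-free sets and the generalized Higman map\<close>

text \<open>
  Additive abelian groups are \<open>abelian_group\<close>s in the sense of HOL-Algebra, that is, \<open>ring\<close> records
  of which only \<open>carrier\<close>, \<open>zero\<close> and \<open>add\<close> matter.
\<close>

definition arith_free :: "('b, 'm) ring_scheme \<Rightarrow> 'b set \<Rightarrow> bool" where
  "arith_free G S \<longleftrightarrow>
     S \<subseteq> carrier G \<and>
     \<not> (\<exists>\<alpha>\<in>S. \<exists>\<beta>\<in>S. \<forall>k::nat. \<alpha> \<oplus>\<^bsub>G\<^esub> add_pow G k \<beta> \<in> S)"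

text \<open>The unique existence says that \<open>L\<close> is the internal direct sum of the \<open>C a\<close>.\<close>

locale graded_lie_ring = grp: abelian_group A + lie_ring L
  for A :: "('b, 'm) ring_scheme" and L :: "('a, 'n) ring_scheme" (structure) +
  fixes C :: "'b \<Rightarrow> 'a set"
  assumes component_subgroup: "a \<in> carrier A \<Longrightarrow> additive_subgroup (C a) L"
    and direct_sum: "x \<in> carrier L \<Longrightarrow>
      \<exists>!f. f \<in> (\<Pi>\<^sub>E a\<in>carrier A. C a) \<and> finite {a \<in> carrier A. f a \<noteq> \<zero>} \<and>
           x = (\<Oplus>a\<in>{a \<in> carrier A. f a \<noteq> \<zero>}. f a)"
    and bracket_component:
      "\<lbrakk>a \<in> carrier A; b \<in> carrier A; x \<in> C a; y \<in> C b\<rbrakk> \<Longrightarrow> x \<otimes> y \<in> C (a \<oplus>\<^bsub>A\<^esub> b)"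

definition grading_support ::
    "('b, 'm) ring_scheme \<Rightarrow> ('a, 'n) ring_scheme \<Rightarrow> ('b \<Rightarrow> 'a set) \<Rightarrow> 'b set" where
  "grading_support A L C = {a \<in> carrier A. C a \<noteq> {\<zero>\<^bsub>L\<^esub>}}"

text \<open>
  HOL cannot quantify over all types inside a term, so the map carries as arguments the types from
  whose elements the Lie rings and the grading groups are built. Any two infinite types give
  the same map: a non-zero iterated bracket of homogeneous elements already lives in the countable
  graded subring that they generate, graded by the countable subgroup generated by their degrees.
\<close>

definition higman :: "'a itself \<Rightarrow> 'b itself \<Rightarrow> nat \<Rightarrow> nat" where
  "higman U V n = (LEAST N.
     \<forall>(L :: 'a ring) (A :: 'b ring) C S.
       graded_lie_ring A L C \<and> arith_free A S \<and> finite S \<and> card S \<le> n \<and>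
       grading_support A L C \<subseteq> S
       \<longrightarrow> lie_nilpotent L \<and> nilpotency_class L \<le> N)"

end

theory Submission
  imports Defs "HOL-Library.Countable_Set" "HOL-Library.Function_Algebras"
begin

text \<open>
  Let \<open>L\<close> be graded with arithmetically-free support \<open>Y\<close>. If \<open>L\<close> is solvable, then it is nilpotent: modulo
  the action of \<open>[L, L]\<close> the homogeneous elements act commutatively, and \<open>card Y\<close> factors of the same
  degree annihilate every component. For solvability one chooses a homomorphism \<open>\<kappa>\<close> to a cyclic
  group of order \<open>N\<close> that is not identically zero on \<open>Y\<close>. By induction on \<open>card Y\<close> its kernel part is solvable, hence
  acts nilpotently, and up to this action Kreknin's elimination works for the degrees ordered by their
  representatives in \<open>{0..<N}\<close>: if \<open>k\<close> is the sum of \<open>p\<close> and \<open>q > k\<close> modulo \<open>N\<close>, then also \<open>p > k\<close>.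

  A derivation with \<open>r(D) = 0\<close> grades the scalar extension of \<open>\<gg>\<close> to the algebraic closure by its generalised
  eigenspaces, with support in the roots of \<open>r\<close>. If conversely \<open>\<alpha> + k\<beta>\<close> is a root for all \<open>k\<close>, then
  \<open>q\<beta> = 0\<close> for some \<open>q\<close> between \<open>1\<close> and the number of roots, and a cyclic permutation of \<open>q\<close> basis vectors
  of weights \<open>\<alpha> + k\<beta>\<close> by an element of weight \<open>\<beta>\<close> is not nilpotent.
\<close>

section \<open>Families of components in a Lie ring\<close>

text \<open>The value of \<open>higman\<close> is a \<open>LEAST\<close>, so it carries information
  only once some bound is known to exist. The analysis of graded Lie rings supplies one, and it has
  to depend on the number of degrees alone. The delicate point is the elimination: the order
  \<open>N\<close> of the cyclic group is not bounded in terms of \<open>card Y\<close>, so a step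
  may be charged only for values of \<kappa> that actually occur on \<open>Y\<close>.

  The graded argument works with families of additive subgroups indexed by degrees. Derived terms,
  kernels and their actions are then again families over the same degrees, and no decomposition of
  elements has to be carried along.

  A second obstacle comes from types. \<open>higman\<close> speaks of Lie rings and groups carried
  by two prescribed infinite types, whereas the eigenspaces live in a function space over the
  algebraic closure. What is transported is therefore a single word at a time: class at most
  \<open>c\<close> means that all left-normed words in \<open>c + 1\<close> letters vanish, and one
  such word lives in a countable graded subring. Words are also what descends from the scalar
  extension to \<gg>.\<close>

context lie_ring begin

section \<open>Consequences of bilinearity and the Jacobi identity\<close>

lemma bracket_zero_left: assumes "y \<in> carrier L" shows "\<zero> \<otimes> y = \<zero>"
proof -
  have "\<zero> \<otimes> y \<oplus> \<zero> \<otimes> y = \<zero> \<otimes> y"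
    using bracket_add_left[of \<zero> \<zero> y] assms by simp
  then show ?thesis using assms bracket_closed[of \<zero> y] by (simp add: add.l_cancel_one)
qed

lemma bracket_zero_right: assumes "y \<in> carrier L" shows "y \<otimes> \<zero> = \<zero>"
proof -
  have "y \<otimes> \<zero> \<oplus> y \<otimes> \<zero> = y \<otimes> \<zero>"
    using bracket_add_right[of \<zero> \<zero> y] assms by simp
  then show ?thesis using assms bracket_closed[of y \<zero>] by (simp add: add.l_cancel_one)
qed

lemma bracket_minus_left:
  assumes "x \<in> carrier L" "y \<in> carrier L" shows "(\<ominus> x) \<otimes> y = \<ominus> (x \<otimes> y)"
proof -
  have "x \<otimes> y \<oplus> (\<ominus> x) \<otimes> y = \<zero>"
    using bracket_add_left[of x "\<ominus> x" y] assms by (simp add: r_neg bracket_zero_left)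
  then show ?thesis using assms bracket_closed by (metis a_comm a_inv_closed minus_equality)
qed

lemma bracket_minus_right:
  assumes "x \<in> carrier L" "y \<in> carrier L" shows "x \<otimes> (\<ominus> y) = \<ominus> (x \<otimes> y)"
proof -
  have "x \<otimes> y \<oplus> x \<otimes> (\<ominus> y) = \<zero>"
    using bracket_add_right[of y "\<ominus> y" x] assms by (simp add: r_neg bracket_zero_right)
  then show ?thesis using assms bracket_closed by (metis a_comm a_inv_closed minus_equality)
qed

lemma bracket_antisym:
  assumes "x \<in> carrier L" "y \<in> carrier L" shows "x \<otimes> y = \<ominus> (y \<otimes> x)"
proof -
  have "(x \<oplus> y) \<otimes> (x \<oplus> y) = (x \<otimes> x \<oplus> x \<otimes> y) \<oplus> (y \<otimes> x \<oplus> y \<otimes> y)"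
    using assms by (simp add: bracket_add_left bracket_add_right bracket_closed a_ac)
  then have "x \<otimes> y \<oplus> y \<otimes> x = \<zero>"
    using assms bracket_self[of "x \<oplus> y"] by (simp add: bracket_self bracket_closed)
  then show ?thesis using assms bracket_closed by (metis minus_equality)
qed

text \<open>This form of the Jacobi identity suits left-normed words: right multiplication by
  \<open>z\<close> acts as a derivation.\<close>

lemma bracket_leibniz_right:
  assumes "x \<in> carrier L" "y \<in> carrier L" "z \<in> carrier L"
  shows "(x \<otimes> y) \<otimes> z = (x \<otimes> z) \<otimes> y \<oplus> x \<otimes> (y \<otimes> z)"
proof -
  have "x \<otimes> (y \<otimes> z) \<oplus> y \<otimes> (z \<otimes> x) \<oplus> z \<otimes> (x \<otimes> y) = \<zero>" using assms by (rule jacobi)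
  moreover have "y \<otimes> (z \<otimes> x) = (x \<otimes> z) \<otimes> y"
    using assms bracket_closed
    by (subst bracket_antisym, simp, simp, subst bracket_antisym[of z x]) (simp_all add: bracket_minus_left)
  moreover have "z \<otimes> (x \<otimes> y) = \<ominus> ((x \<otimes> y) \<otimes> z)" using assms bracket_closed by (intro bracket_antisym)
  ultimately have "x \<otimes> (y \<otimes> z) \<oplus> (x \<otimes> z) \<otimes> y \<oplus> \<ominus> ((x \<otimes> y) \<otimes> z) = \<zero>" by simp
  then have "x \<otimes> (y \<otimes> z) \<oplus> (x \<otimes> z) \<otimes> y = (x \<otimes> y) \<otimes> z"
    using assms bracket_closed
      minus_equality[of "x \<otimes> (y \<otimes> z) \<oplus> (x \<otimes> z) \<otimes> y" "\<ominus> ((x \<otimes> y) \<otimes> z)"] by simp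
  then show ?thesis using assms bracket_closed by (simp add: a_comm)
qed

lemma bracket_bracket_right:
  assumes "x \<in> carrier L" "y \<in> carrier L" "z \<in> carrier L"
  shows "x \<otimes> (y \<otimes> z) = (x \<otimes> y) \<otimes> z \<oplus> \<ominus> ((x \<otimes> z) \<otimes> y)"
proof -
  have c: "(x \<otimes> z) \<otimes> y \<in> carrier L" "x \<otimes> (y \<otimes> z) \<in> carrier L" using assms bracket_closed by auto
  show ?thesis
    unfolding bracket_leibniz_right[OF assms] using c by (simp add: a_ac r_neg r_neg1 r_neg2)
qed

section \<open>Additive subgroups and left-normed words\<close>

definition add_closed :: "'a set \<Rightarrow> bool" where
  "add_closed H \<longleftrightarrow> H \<subseteq> carrier L \<and> \<zero> \<in> H \<and> (\<forall>x\<in>H. \<forall>y\<in>H. x \<oplus> y \<in> H) \<and> (\<forall>x\<in>H. \<ominus> x \<in> H)"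

abbreviation gen :: "'a set \<Rightarrow> 'a set" where "gen \<equiv> generate (add_monoid L)"

lemma add_closed_gen: assumes "S \<subseteq> carrier L" shows "add_closed (gen S)"
proof -
  have "subgroup (gen S) (add_monoid L)" using add.generate_is_subgroup assms by simp
  then show ?thesis unfolding add_closed_def
    using subgroup.m_inv_closed[of "gen S" "add_monoid L"] subgroup.m_closed[of "gen S" "add_monoid L"]
      subgroup.one_closed[of "gen S" "add_monoid L"] subgroup.subset[of "gen S" "add_monoid L"]
    by (auto simp: a_inv_def)
qed

lemma gen_least: assumes "S \<subseteq> H" "add_closed H" shows "gen S \<subseteq> H"
proof
  fix x assume "x \<in> gen S"
  then show "x \<in> H"
    using assms unfolding add_closed_def by induct (auto simp flip: a_inv_def)
qed

lemma gen_incl: "S \<subseteq> gen S" by (auto intro: generate.incl)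

lemma add_closed_additive_subgroup: "additive_subgroup H L \<Longrightarrow> add_closed H"
  unfolding add_closed_def
  using additive_subgroup.a_subset additive_subgroup.zero_closed additive_subgroup.a_closed
    additive_subgroup.a_inv_closed by fastforce

lemma add_closed_preimage_left:
  assumes "add_closed H" "z \<in> carrier L" shows "add_closed {y \<in> carrier L. y \<otimes> z \<in> H}"
  using assms unfolding add_closed_def
  by (auto simp: bracket_zero_left bracket_minus_left bracket_add_left)

lemma add_closed_preimage_right:
  assumes "add_closed H" "z \<in> carrier L" shows "add_closed {y \<in> carrier L. z \<otimes> y \<in> H}"
  using assms unfolding add_closed_def
  by (auto simp: bracket_zero_right bracket_minus_right bracket_add_right)

lemma add_closed_zero: "add_closed {\<zero>}" unfolding add_closed_def by auto

text \<open>The elements whose bracket with \<open>z\<close> lies in \<open>H\<close> form an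
  additive subgroup, so only generators need to be tested.\<close>

lemma gen_bracket_left:
  assumes "add_closed H" "z \<in> carrier L" "S \<subseteq> carrier L" "\<And>y. y \<in> S \<Longrightarrow> y \<otimes> z \<in> H" "y \<in> gen S"
  shows "y \<otimes> z \<in> H"
  using gen_least[OF _ add_closed_preimage_left[OF assms(1,2)], of S] assms by auto

lemma gen_bracket_right:
  assumes "add_closed H" "z \<in> carrier L" "S \<subseteq> carrier L" "\<And>y. y \<in> S \<Longrightarrow> z \<otimes> y \<in> H" "y \<in> gen S"
  shows "z \<otimes> y \<in> H"
  using gen_least[OF _ add_closed_preimage_right[OF assms(1,2)], of S] assms by auto

text \<open>Additivity in the first argument moves the additive spans taken at each stage to the
  outside, which leaves left-normed words.\<close>

lemma lower_central_le_words:
  "lower_central L i \<subseteq> gen {foldl (\<otimes>) x xs | x xs. x \<in> carrier L \<and> set xs \<subseteq> carrier L \<and> length xs = i}"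
proof (induct i)
  case 0
  have "x \<in> {foldl (\<otimes>) x xs | x xs. x \<in> carrier L \<and> set xs \<subseteq> carrier L \<and> length xs = 0}"
    if "x \<in> carrier L" for x using that by auto
  then show ?case by (auto intro!: generate.incl)
next
  case (Suc i)
  define W where "W i = {foldl (\<otimes>) x xs | x xs. x \<in> carrier L \<and> set xs \<subseteq> carrier L \<and> length xs = i}" for i
  have "foldl (\<otimes>) x xs \<in> carrier L" if "x \<in> carrier L" "set xs \<subseteq> carrier L" for x xs
    using that by (induct xs arbitrary: x) (auto simp: bracket_closed)
  then have W: "W i \<subseteq> carrier L" for i by (auto simp: W_def)
  have "w \<otimes> y \<in> W (Suc i)" if "w \<in> W i" "y \<in> carrier L" for w y
  proof -
    obtain x xs where "w = foldl (\<otimes>) x xs" "x \<in> carrier L" "set xs \<subseteq> carrier L" "length xs = i"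
      using \<open>w \<in> W i\<close> by (auto simp: W_def)
    then have "w \<otimes> y = foldl (\<otimes>) x (xs @ [y]) \<and> x \<in> carrier L \<and> set (xs @ [y]) \<subseteq> carrier L
        \<and> length (xs @ [y]) = Suc i"
      using \<open>y \<in> carrier L\<close> by simp
    then show ?thesis unfolding W_def by blast
  qed
  then have "u \<otimes> y \<in> gen (W (Suc i))" if "u \<in> gen (W i)" "y \<in> carrier L" for u y
    using gen_bracket_left[OF add_closed_gen[OF W] that(2) W _ that(1)] that(2) gen_incl by blast
  then have "{x \<otimes> y |x y. x \<in> lower_central L i \<and> y \<in> carrier L} \<subseteq> gen (W (Suc i))"
    using Suc by (auto simp: W_def)
  then show ?case using gen_least[OF _ add_closed_gen[OF W[of "Suc i"]]] by (simp add: W_def)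
qed

text \<open>Reduces a bound on the class to single words, which can be carried to another Lie
  algebra one at a time.\<close>

lemma lower_central_zero_if_words_vanish:
  assumes "\<And>x xs. x \<in> carrier L \<Longrightarrow> set xs \<subseteq> carrier L \<Longrightarrow> length xs = i \<Longrightarrow> foldl (\<otimes>) x xs = \<zero>"
  shows "lower_central L i = {\<zero>}"
proof -
  have "gen {foldl (\<otimes>) x xs | x xs. x \<in> carrier L \<and> set xs \<subseteq> carrier L \<and> length xs = i} \<subseteq> {\<zero>}"
    using assms by (intro gen_least add_closed_zero) auto
  moreover have "\<zero> \<in> lower_central L i" by (cases i) (auto intro: generate.one[of "add_monoid L", simplified])
  ultimately show ?thesis using lower_central_le_words[of i] by blast
qed

end

section \<open>Families of additive subgroups indexed by degrees\<close>

locale lie_ring_degrees = grp: abelian_group A + lie_ring L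
  for A :: "('b, 'm) ring_scheme" and L :: "('a, 'n) ring_scheme" (structure)
begin

definition family :: "('b \<Rightarrow> 'a set) \<Rightarrow> bool" where
  "family F \<longleftrightarrow> (\<forall>a\<in>carrier A. add_closed (F a))"

definition fam_le :: "('b \<Rightarrow> 'a set) \<Rightarrow> ('b \<Rightarrow> 'a set) \<Rightarrow> bool" (infix "\<sqsubseteq>" 50) where
  "F \<sqsubseteq> G \<longleftrightarrow> (\<forall>a\<in>carrier A. F a \<subseteq> G a)"

definition star :: "('b \<Rightarrow> 'a set) \<Rightarrow> ('b \<Rightarrow> 'a set) \<Rightarrow> 'b \<Rightarrow> 'a set" (infixl "\<star>" 70) where
  "(F \<star> G) a = gen {x \<otimes> y | x y b c.
     b \<in> carrier A \<and> c \<in> carrier A \<and> b \<oplus>\<^bsub>A\<^esub> c = a \<and> x \<in> F b \<and> y \<in> G c}"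

primrec der :: "('b \<Rightarrow> 'a set) \<Rightarrow> nat \<Rightarrow> 'b \<Rightarrow> 'a set" where
  "der F 0 = F"
| "der F (Suc t) = der F t \<star> der F t"

primrec act :: "('b \<Rightarrow> 'a set) \<Rightarrow> ('b \<Rightarrow> 'a set) \<Rightarrow> nat \<Rightarrow> 'b \<Rightarrow> 'a set" where
  "act F B 0 = F"
| "act F B (Suc t) = act F B t \<star> B"

lemma family_carrier: "family F \<Longrightarrow> a \<in> carrier A \<Longrightarrow> x \<in> F a \<Longrightarrow> x \<in> carrier L"
  by (auto simp: family_def add_closed_def)

lemma family_add:
  "family F \<Longrightarrow> a \<in> carrier A \<Longrightarrow> x \<in> F a \<Longrightarrow> y \<in> F a \<Longrightarrow> x \<oplus> y \<in> F a"
  by (auto simp: family_def add_closed_def)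

lemma family_minus: "family F \<Longrightarrow> a \<in> carrier A \<Longrightarrow> x \<in> F a \<Longrightarrow> \<ominus> x \<in> F a"
  by (auto simp: family_def add_closed_def)

lemma family_zero: "family F \<Longrightarrow> a \<in> carrier A \<Longrightarrow> \<zero> \<in> F a"
  by (auto simp: family_def add_closed_def)

lemma star_generators_carrier:
  assumes "family F" "family G"
  shows "{x \<otimes> y | x y b c. b \<in> carrier A \<and> c \<in> carrier A \<and> b \<oplus>\<^bsub>A\<^esub> c = a \<and> x \<in> F b \<and> y \<in> G c}
    \<subseteq> carrier L"
  using assms family_carrier bracket_closed by blast

lemma family_star: "family F \<Longrightarrow> family G \<Longrightarrow> family (F \<star> G)"
  using star_generators_carrier add_closed_gen unfolding family_def star_def by simp

lemma family_der: "family F \<Longrightarrow> family (der F t)"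
  by (induct t) (auto intro: family_star)

lemma family_act: "family F \<Longrightarrow> family B \<Longrightarrow> family (act F B t)"
  by (induct t) (auto intro: family_star)

lemma starI:
  "\<lbrakk>b \<in> carrier A; c \<in> carrier A; x \<in> F b; y \<in> G c\<rbrakk> \<Longrightarrow> x \<otimes> y \<in> (F \<star> G) (b \<oplus>\<^bsub>A\<^esub> c)"
  unfolding star_def by (rule generate.incl) blast

lemma star_le_at:
  assumes "add_closed H"
    and "\<And>b c x y. \<lbrakk>b \<in> carrier A; c \<in> carrier A; b \<oplus>\<^bsub>A\<^esub> c = a; x \<in> F b; y \<in> G c\<rbrakk> \<Longrightarrow> x \<otimes> y \<in> H"
  shows "(F \<star> G) a \<subseteq> H"
  unfolding star_def using assms by (intro gen_least) blast+

lemma star_le: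
  assumes "family H"
    and "\<And>b c x y. \<lbrakk>b \<in> carrier A; c \<in> carrier A; x \<in> F b; y \<in> G c\<rbrakk> \<Longrightarrow> x \<otimes> y \<in> H (b \<oplus>\<^bsub>A\<^esub> c)"
  shows "F \<star> G \<sqsubseteq> H"
  unfolding fam_le_def
proof
  fix a assume "a \<in> carrier A"
  then show "(F \<star> G) a \<subseteq> H a"
    using assms by (intro star_le_at) (auto simp: family_def)
qed

lemma star_leD:
  "\<lbrakk>F \<star> G \<sqsubseteq> H; b \<in> carrier A; c \<in> carrier A; x \<in> F b; y \<in> G c\<rbrakk> \<Longrightarrow> x \<otimes> y \<in> H (b \<oplus>\<^bsub>A\<^esub> c)"
  using starI[of b c x F y G] unfolding fam_le_def by auto

lemma fam_leD: "F \<sqsubseteq> G \<Longrightarrow> a \<in> carrier A \<Longrightarrow> x \<in> F a \<Longrightarrow> x \<in> G a"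
  unfolding fam_le_def by auto

lemma fam_le_refl: "F \<sqsubseteq> F" unfolding fam_le_def by auto

lemma fam_le_trans: "F \<sqsubseteq> G \<Longrightarrow> G \<sqsubseteq> H \<Longrightarrow> F \<sqsubseteq> H" unfolding fam_le_def by blast

lemma star_mono:
  assumes "family F'" "family G'" "F \<sqsubseteq> F'" "G \<sqsubseteq> G'" shows "F \<star> G \<sqsubseteq> F' \<star> G'"
  using assms by (intro star_le family_star starI) (auto dest: fam_leD)

lemma der_mono: "family G \<Longrightarrow> F \<sqsubseteq> G \<Longrightarrow> der F t \<sqsubseteq> der G t"
  by (induct t) (auto intro: star_mono family_der)

lemma act_mono: "family G \<Longrightarrow> family B \<Longrightarrow> F \<sqsubseteq> G \<Longrightarrow> act F B t \<sqsubseteq> act G B t"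
  by (induct t) (auto intro: star_mono family_act fam_le_refl)

lemma der_add: "der F (s + t) = der (der F s) t"
  by (induct t) auto

lemma act_add: "act F B (s + t) = act (act F B s) B t"
  by (induct t) auto

text \<open>By the Leibniz rule a letter of \<open>C\<close> acting on a product acts on one of its
  two factors, and both families are stable under \<open>C\<close>.\<close>

lemma star_ideal:
  assumes F: "family F" "F \<star> C \<sqsubseteq> F" and G: "family G" "G \<star> C \<sqsubseteq> G" and C: "family C"
  shows "(F \<star> G) \<star> C \<sqsubseteq> F \<star> G"
proof (rule star_le)
  show FG: "family (F \<star> G)" using F G by (intro family_star)
  fix a c u z
  assume a: "a \<in> carrier A" and c: "c \<in> carrier A" and u: "u \<in> (F \<star> G) a" and z: "z \<in> C c"
  have zL: "z \<in> carrier L" using C c z family_carrier by blast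
  show "u \<otimes> z \<in> (F \<star> G) (a \<oplus>\<^bsub>A\<^esub> c)"
  proof (rule gen_bracket_left[OF _ zL star_generators_carrier[OF F(1) G(1)] _ u[unfolded star_def]])
    show "add_closed ((F \<star> G) (a \<oplus>\<^bsub>A\<^esub> c))" using FG a c by (auto simp: family_def)
    fix v assume "v \<in> {x \<otimes> y |x y b c. b \<in> carrier A \<and> c \<in> carrier A \<and> b \<oplus>\<^bsub>A\<^esub> c = a \<and> x \<in> F b \<and> y \<in> G c}"
    then obtain x y b e where v: "v = x \<otimes> y" "b \<in> carrier A" "e \<in> carrier A" "b \<oplus>\<^bsub>A\<^esub> e = a" "x \<in> F b" "y \<in> G e"
      by blast
    have xy: "x \<in> carrier L" "y \<in> carrier L" using v F G family_carrier by blast+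
    have 1: "(x \<otimes> z) \<otimes> y \<in> (F \<star> G) ((b \<oplus>\<^bsub>A\<^esub> c) \<oplus>\<^bsub>A\<^esub> e)"
      using v c z star_leD[OF F(2)] by (intro starI) auto
    have 2: "x \<otimes> (y \<otimes> z) \<in> (F \<star> G) (b \<oplus>\<^bsub>A\<^esub> (e \<oplus>\<^bsub>A\<^esub> c))"
      using v c z star_leD[OF G(2)] by (intro starI) auto
    have eq: "(b \<oplus>\<^bsub>A\<^esub> c) \<oplus>\<^bsub>A\<^esub> e = a \<oplus>\<^bsub>A\<^esub> c" "b \<oplus>\<^bsub>A\<^esub> (e \<oplus>\<^bsub>A\<^esub> c) = a \<oplus>\<^bsub>A\<^esub> c"
      using v c by (auto simp: grp.a_ac)
    show "v \<otimes> z \<in> (F \<star> G) (a \<oplus>\<^bsub>A\<^esub> c)"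
      unfolding v(1) bracket_leibniz_right[OF xy zL]
      using 1 2 a c FG unfolding eq by (intro family_add) auto
  qed
qed

lemma der_ideal: "family C \<Longrightarrow> C \<star> C \<sqsubseteq> C \<Longrightarrow> der C t \<star> C \<sqsubseteq> der C t"
  by (induct t) (auto intro: star_ideal family_der)

lemma der_le: 
  assumes "family C" "C \<star> C \<sqsubseteq> C" shows "der C t \<sqsubseteq> C"
proof (induct t)
  case (Suc t)
  then show ?case
    using star_mono[of C C "der C t" "der C t"] assms fam_le_trans by auto
qed (auto simp: fam_le_refl)

lemma der_Suc_le:
  assumes "family C" "C \<star> C \<sqsubseteq> C" shows "der C (Suc t) \<sqsubseteq> der C t"
  using star_mono[of "der C t" C "der C t" "der C t"] assms der_ideal[OF assms] der_le[OF assms]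
    family_der fam_le_refl fam_le_trans by fastforce

lemma der_antimono:
  assumes "family C" "C \<star> C \<sqsubseteq> C" "s \<le> t" shows "der C t \<sqsubseteq> der C s"
  using assms(3)
proof (induct t rule: dec_induct)
  case (step t)
  then show ?case using der_Suc_le[OF assms(1,2), of t] fam_le_trans by blast
qed (auto simp: fam_le_refl)

section \<open>Words whose letters carry degrees\<close>

definition wd :: "'a \<Rightarrow> ('b \<times> 'a) list \<Rightarrow> 'a" where
  "wd x ws = foldl (\<lambda>x p. x \<otimes> snd p) x ws"

text \<open>Degrees are recorded in the letters because an element does not determine its degree:
  zero lies in every component, and the components of a family may overlap.\<close>

definition wdeg :: "'b \<Rightarrow> ('b \<times> 'a) list \<Rightarrow> 'b" where
  "wdeg a ws = foldl (\<lambda>a p. a \<oplus>\<^bsub>A\<^esub> fst p) a ws"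

definition word_in :: "('b \<Rightarrow> 'a set) \<Rightarrow> ('b \<times> 'a) list \<Rightarrow> bool" where
  "word_in B ws \<longleftrightarrow> (\<forall>p\<in>set ws. fst p \<in> carrier A \<and> snd p \<in> B (fst p))"

lemma wd_simps [simp]:
  "wd x [] = x" "wd x (p # ws) = wd (x \<otimes> snd p) ws" "wd x (us @ ws) = wd (wd x us) ws"
  by (auto simp: wd_def)

lemma wdeg_simps [simp]:
  "wdeg a [] = a" "wdeg a (p # ws) = wdeg (a \<oplus>\<^bsub>A\<^esub> fst p) ws" "wdeg a (us @ ws) = wdeg (wdeg a us) ws"
  by (auto simp: wdeg_def)

lemma word_in_simps [simp]:
  "word_in B []"
  "word_in B (p # ws) \<longleftrightarrow> fst p \<in> carrier A \<and> snd p \<in> B (fst p) \<and> word_in B ws"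
  "word_in B (us @ ws) \<longleftrightarrow> word_in B us \<and> word_in B ws"
  by (auto simp: word_in_def)

lemma wdeg_carrier: "a \<in> carrier A \<Longrightarrow> word_in B ws \<Longrightarrow> wdeg a ws \<in> carrier A"
  by (induct ws arbitrary: a) auto

lemma wdeg_add:
  "a \<in> carrier A \<Longrightarrow> d \<in> carrier A \<Longrightarrow> word_in B ws \<Longrightarrow>
    wdeg (a \<oplus>\<^bsub>A\<^esub> d) ws = wdeg a ws \<oplus>\<^bsub>A\<^esub> d"
proof (induct ws arbitrary: a)
  case (Cons p ws)
  have "a \<oplus>\<^bsub>A\<^esub> d \<oplus>\<^bsub>A\<^esub> fst p = a \<oplus>\<^bsub>A\<^esub> fst p \<oplus>\<^bsub>A\<^esub> d"
    using Cons by (simp add: grp.a_ac)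
  then show ?case using Cons by simp
qed simp

lemma wd_in:
  "\<lbrakk>F \<star> B \<sqsubseteq> F; a \<in> carrier A; x \<in> F a; word_in B ws\<rbrakk> \<Longrightarrow> wd x ws \<in> F (wdeg a ws)"
proof (induct ws arbitrary: a x)
  case (Cons p ws)
  then show ?case using star_leD[OF Cons.prems(1), of a "fst p" x "snd p"] by simp
qed simp

lemma wd_carrier:
  "\<lbrakk>family B; x \<in> carrier L; word_in B ws\<rbrakk> \<Longrightarrow> wd x ws \<in> carrier L"
proof (induct ws arbitrary: x)
  case (Cons p ws)
  have "snd p \<in> carrier L" using Cons.prems family_carrier by auto
  then show ?case using Cons bracket_closed by simp
qed simp

lemma wd_add:
  "\<lbrakk>family B; x \<in> carrier L; y \<in> carrier L; word_in B ws\<rbrakk> \<Longrightarrow> wd (x \<oplus> y) ws = wd x ws \<oplus> wd y ws"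
proof (induct ws arbitrary: x y)
  case (Cons p ws)
  have "snd p \<in> carrier L" using Cons.prems family_carrier by auto
  then show ?case using Cons by (simp add: bracket_add_left bracket_closed)
qed simp

lemma wd_zero: "\<lbrakk>family B; word_in B ws\<rbrakk> \<Longrightarrow> wd \<zero> ws = \<zero>"
proof (induct ws)
  case (Cons p ws)
  have "snd p \<in> carrier L" using Cons.prems family_carrier by auto
  then show ?case using Cons by (simp add: bracket_zero_left)
qed simp

lemma wd_minus:
  "\<lbrakk>family B; x \<in> carrier L; word_in B ws\<rbrakk> \<Longrightarrow> wd (\<ominus> x) ws = \<ominus> wd x ws"
proof (induct ws arbitrary: x)
  case (Cons p ws)
  have "snd p \<in> carrier L" using Cons.prems family_carrier by auto
  then show ?case using Cons by (simp add: bracket_minus_left bracket_closed)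
qed simp

lemma act_Suc_left: "act F B (Suc t) = act (F \<star> B) B t"
  using act_add[of F B 1 t] by simp

text \<open>The elements whose continuation by a fixed word lands in \<open>H\<close> form an
  additive subgroup, so testing products is enough. \<open>F\<close> varies in the induction because
  letters are absorbed into it from the left.\<close>

lemma act_le_if_words:
  assumes "family H" "family B" "family F"
    and "\<And>a t ws. \<lbrakk>a \<in> carrier A; t \<in> F a; length ws = l; word_in B ws\<rbrakk> \<Longrightarrow> wd t ws \<in> H (wdeg a ws)"
  shows "act F B l \<sqsubseteq> H"
  using assms(3,4)
proof (induct l arbitrary: F)
  case 0
  then show ?case using 0(2)[of _ _ "[]"] by (auto simp: fam_le_def)
next
  case (Suc l)
  show ?case unfolding act_Suc_left
  proof (rule Suc.hyps)
    show "family (F \<star> B)" using Suc.prems assms family_star by blast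
    fix a y ws
    assume a: "a \<in> carrier A" and y: "y \<in> (F \<star> B) a" and ws: "length ws = l" "word_in B ws"
    have Ha: "add_closed (H (wdeg a ws))" using assms(1) a ws wdeg_carrier by (auto simp: family_def)
    have "add_closed {y \<in> carrier L. wd y ws \<in> H (wdeg a ws)}"
      using Ha ws assms(2) by (auto simp: add_closed_def wd_add wd_zero wd_minus)
    moreover have "x \<otimes> z \<in> {y \<in> carrier L. wd y ws \<in> H (wdeg a ws)}"
      if "b \<in> carrier A" "c \<in> carrier A" "b \<oplus>\<^bsub>A\<^esub> c = a" "x \<in> F b" "z \<in> B c" for b c x z
      using Suc.prems(2)[of b x "(c, z) # ws"] that ws family_carrier[OF Suc.prems(1)]
        family_carrier[OF assms(2)] bracket_closed by auto
    ultimately have "(F \<star> B) a \<subseteq> {y \<in> carrier L. wd y ws \<in> H (wdeg a ws)}"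
      by (intro star_le_at)
    then show "wd y ws \<in> H (wdeg a ws)" using y by auto
  qed
qed

text \<open>Moving \<open>b\<close> to the left past a letter \<open>p\<close> costs the term in
  which \<open>p\<close> and \<open>b\<close> are bracketed with each other, an element of
  \<open>T \<star> (B \<star> B)\<close>. This family is stable under \<open>B\<close>, so the later
  letters of \<open>us\<close> keep the error inside it.\<close>

lemma wd_commute:
  assumes T: "family T" "T \<star> B \<sqsubseteq> T" and B: "family B" and T': "(T \<star> (B \<star> B)) \<star> B \<sqsubseteq> T \<star> (B \<star> B)"
    and a: "a \<in> carrier A" "t \<in> T a" and d: "d \<in> carrier A" "b \<in> B d" and us: "word_in B us"
  shows "\<exists>e \<in> (T \<star> (B \<star> B)) (wdeg a us \<oplus>\<^bsub>A\<^esub> d). wd t us \<otimes> b = wd (t \<otimes> b) us \<oplus> e"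
  using us
proof (induct us rule: rev_induct)
  case Nil
  have "\<zero> \<in> (T \<star> (B \<star> B)) (wdeg a [] \<oplus>\<^bsub>A\<^esub> d)"
    using a d T B by (intro family_zero) (auto intro: family_star)
  moreover have "t \<otimes> b \<in> carrier L" using a d T(1) B family_carrier bracket_closed by blast
  ultimately show ?case by force
next
  case (snoc p us)
  let ?T' = "T \<star> (B \<star> B)"
  have fT': "family ?T'" using T B by (intro family_star)
  obtain e where e: "e \<in> ?T' (wdeg a us \<oplus>\<^bsub>A\<^esub> d)" "wd t us \<otimes> b = wd (t \<otimes> b) us \<oplus> e"
    using snoc by auto
  have p: "fst p \<in> carrier A" "snd p \<in> B (fst p)" and us: "word_in B us" using snoc by auto
  have wa: "wdeg a us \<in> carrier A" using a us wdeg_carrier by blast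
  have wT: "wd t us \<in> T (wdeg a us)" using T a us wd_in by blast
  have c: "snd p \<in> carrier L" "b \<in> carrier L" "wd t us \<in> carrier L" "t \<in> carrier L" "e \<in> carrier L"
    using p d wT a wa family_carrier[OF B] family_carrier[OF T(1)]
      family_carrier[OF fT' grp.a_closed[OF wa d(1)] e(1)] by auto
  have c2: "wd (t \<otimes> b) us \<in> carrier L" using c us B wd_carrier bracket_closed by blast
  have "(wd t us \<otimes> snd p) \<otimes> b = (wd t us \<otimes> b) \<otimes> snd p \<oplus> wd t us \<otimes> (snd p \<otimes> b)"
    using c by (intro bracket_leibniz_right)
  also have "\<dots> = wd (t \<otimes> b) us \<otimes> snd p \<oplus> (e \<otimes> snd p \<oplus> wd t us \<otimes> (snd p \<otimes> b))"
    unfolding e(2) using c c2 by (simp add: bracket_add_left bracket_closed a_assoc)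
  finally have eq: "(wd t us \<otimes> snd p) \<otimes> b = wd (t \<otimes> b) us \<otimes> snd p \<oplus> (e \<otimes> snd p \<oplus> wd t us \<otimes> (snd p \<otimes> b))" .
  have deg: "wdeg a us \<oplus>\<^bsub>A\<^esub> d \<oplus>\<^bsub>A\<^esub> fst p = wdeg a us \<oplus>\<^bsub>A\<^esub> fst p \<oplus>\<^bsub>A\<^esub> d"
    "wdeg a us \<oplus>\<^bsub>A\<^esub> (fst p \<oplus>\<^bsub>A\<^esub> d) = wdeg a us \<oplus>\<^bsub>A\<^esub> fst p \<oplus>\<^bsub>A\<^esub> d"
    using wa p d by (auto simp: grp.a_ac)
  have "e \<otimes> snd p \<in> ?T' (wdeg a us \<oplus>\<^bsub>A\<^esub> d \<oplus>\<^bsub>A\<^esub> fst p)"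
    using e p wa d by (intro star_leD[OF T']) auto
  moreover have "wd t us \<otimes> (snd p \<otimes> b) \<in> ?T' (wdeg a us \<oplus>\<^bsub>A\<^esub> (fst p \<oplus>\<^bsub>A\<^esub> d))"
    using wT wa p d by (intro starI) auto
  ultimately have "e \<otimes> snd p \<oplus> wd t us \<otimes> (snd p \<otimes> b) \<in> ?T' (wdeg a us \<oplus>\<^bsub>A\<^esub> fst p \<oplus>\<^bsub>A\<^esub> d)"
    unfolding deg using wa p d fT' by (intro family_add) auto
  then show ?case using eq by auto
qed

section \<open>Arithmetically-free supports and nilpotent actions\<close>

definition arith_graded :: "('b \<Rightarrow> 'a set) \<Rightarrow> 'b set \<Rightarrow> bool" where
  "arith_graded C Y \<longleftrightarrow> family C \<and> C \<star> C \<sqsubseteq> C \<and> finite Y \<and> arith_free A Y \<and>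
     (\<forall>a\<in>carrier A - Y. C a = {\<zero>})"

text \<open>If the first \<open>card Y + 1\<close> terms stay in \<open>Y\<close>, two of them
  coincide by the pigeonhole principle. The string is then eventually periodic and stays in
  \<open>Y\<close> forever; in particular its term \<alpha> of index zero lies in \<open>Y\<close>,
  which contradicts arithmetic freeness.\<close>

lemma string_leaves:
  assumes Y: "arith_free A Y" "finite Y" and a: "\<alpha> \<in> carrier A" "\<beta> \<in> Y"
  shows "\<exists>k\<le>card Y. \<alpha> \<oplus>\<^bsub>A\<^esub> add_pow A k \<beta> \<notin> Y"
proof (rule ccontr)
  assume neg: "\<not> ?thesis"
  let ?f = "\<lambda>k::nat. \<alpha> \<oplus>\<^bsub>A\<^esub> add_pow A k \<beta>"
  have b: "\<beta> \<in> carrier A" using Y a by (auto simp: arith_free_def)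
  have step: "?f (Suc k) = ?f k \<oplus>\<^bsub>A\<^esub> \<beta>" for k
    using a b by (simp add: add_pow_def grp.add.nat_pow_Suc grp.a_assoc[symmetric] flip: add_pow_def)
  have sub: "?f ` {..card Y} \<subseteq> Y" using neg by auto
  have "\<not> inj_on ?f {..card Y}"
  proof
    assume "inj_on ?f {..card Y}"
    then have "card {..card Y} \<le> card Y" using sub Y by (intro card_inj_on_le) auto
    then show False by simp
  qed
  then obtain i j where ij: "i < j" "j \<le> card Y" "?f i = ?f j"
    unfolding inj_on_def by (metis atMost_iff nat_neq_iff)
  have all: "?f k \<in> Y" for k
  proof (induct k rule: less_induct)
    case (less k)
    show ?case
    proof (cases "k \<le> card Y")
      case True
      then show ?thesis using sub by auto
    next
      case False
      \<comment> \<open>A term beyond index \<open>card Y\<close> equals the one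
        \<open>j - i\<close> places earlier, which is in \<open>Y\<close> by induction.\<close>
      then have k: "k = (k - j) + j" "i + (k - j) < k" using ij by auto
      have "?f (m + i) = ?f (m + j)" for m
      proof (induct m)
        case (Suc m)
        then show ?case using step[of "m + i"] step[of "m + j"] by simp
      qed (use ij in simp)
      then have "?f k = ?f (i + (k - j))" using k by (metis add.commute)
      then show ?thesis using less k by simp
    qed
  qed
  then have "\<alpha> \<in> Y" using all[of 0] a by (simp add: add_pow_def)
  then show False using all a(2) Y(1) unfolding arith_free_def by blast
qed

text \<open>The degrees of the initial subwords run through the string that starts at \<alpha>, so
  one of them falls outside \<open>Y\<close> and the word is zero from there on. If \<beta> itself
  is outside \<open>Y\<close>, already the first letter is zero.\<close>

lemma wd_string_zero:
  assumes C: "arith_graded C Y" and a: "\<alpha> \<in> carrier A" "t \<in> C \<alpha>" and b: "\<beta> \<in> carrier A"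
    and us: "word_in C us" "\<forall>p\<in>set us. fst p = \<beta>" "card Y \<le> length us" "us \<noteq> []"
  shows "wd t us = \<zero>"
proof (cases "\<beta> \<in> Y")
  case False
  then have "C \<beta> = {\<zero>}" using C b by (auto simp: arith_graded_def)
  moreover obtain p ps where p: "us = p # ps" using us by (cases us) auto
  ultimately have "snd p = \<zero>" using us by auto
  moreover have "t \<in> carrier L" using C a family_carrier by (auto simp: arith_graded_def)
  ultimately show ?thesis
    using p us C by (simp add: bracket_zero_right wd_zero[of C] arith_graded_def)
next
  case True
  then obtain k where k: "k \<le> card Y" "\<alpha> \<oplus>\<^bsub>A\<^esub> add_pow A k \<beta> \<notin> Y"
    using string_leaves C a by (fastforce simp: arith_graded_def)
  have deg: "\<forall>p\<in>set vs. fst p = \<beta> \<Longrightarrow> wdeg \<alpha> vs = \<alpha> \<oplus>\<^bsub>A\<^esub> add_pow A (length vs) \<beta>" for vs :: "('b \<times> 'a) list"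
  proof (induct vs rule: rev_induct)
    case (snoc p vs)
    then show ?case using a b
      by (simp add: add_pow_def grp.add.nat_pow_Suc grp.a_assoc flip: add_pow_def)
  qed (use a in \<open>simp add: add_pow_def\<close>)
  have usplit: "us = take k us @ drop k us" by simp
  have w: "word_in C (take k us)" "word_in C (drop k us)"
    using us(1) word_in_simps(3)[of C "take k us" "drop k us"] by simp_all
  have sub: "\<forall>p\<in>set (take k us). fst p = \<beta>" using us(2) by (meson in_set_takeD)
  have "wdeg \<alpha> (take k us) = \<alpha> \<oplus>\<^bsub>A\<^esub> add_pow A k \<beta>"
    using deg[OF sub] k us by simp
  moreover have "wd t (take k us) \<in> C (wdeg \<alpha> (take k us))"
    using C a w by (intro wd_in) (auto simp: arith_graded_def)
  ultimately have "wd t (take k us) = \<zero>"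
    using C k a b by (auto simp: arith_graded_def)
  then show ?thesis
    using w C wd_zero[of C "drop k us"] wd_simps(3)[of t "take k us" "drop k us"] by (simp add: arith_graded_def)
qed

text \<open>\<open>us\<close> is the block of letters of degree \<beta> collected so far directly
  behind \<open>t\<close>. A further letter of degree \<beta> lengthens the block; any other letter
  is moved past the block into \<open>t\<close>, and the error stays in
  \<open>T \<star> (B \<star> B)\<close> under the remaining letters. In the end the block has more
  than \<open>card Y\<close> letters and kills the word.\<close>

lemma word_absorbed:
  assumes C: "arith_graded C Y" and B: "family B" "B \<sqsubseteq> C"
    and T: "family T" "T \<sqsubseteq> C" "T \<star> B \<sqsubseteq> T" and T': "(T \<star> (B \<star> B)) \<star> B \<sqsubseteq> T \<star> (B \<star> B)"
    and a: "a \<in> carrier A" "t \<in> T a" and \<beta>: "\<beta> \<in> carrier A"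
    and us: "word_in B us" "\<forall>p\<in>set us. fst p = \<beta>" and ws: "word_in B ws"
    and count: "card Y < length us + count_list (map fst ws) \<beta>"
  shows "wd (wd t us) ws \<in> (T \<star> (B \<star> B)) (wdeg (wdeg a us) ws)"
  using a us ws count
proof (induct ws arbitrary: a t us)
  case Nil
  have fT': "family (T \<star> (B \<star> B))" using T B by (intro family_star)
  have "word_in C us" using Nil B(2) by (auto simp: word_in_def fam_le_def)
  then have "wd t us = \<zero>"
    using Nil \<beta> fam_leD[OF T(2)] by (intro wd_string_zero[OF C, where \<alpha> = a and \<beta> = \<beta>]) auto
  then show ?case using fT' Nil wdeg_carrier by (auto intro!: family_zero)
next
  case (Cons p ws)
  let ?T' = "T \<star> (B \<star> B)"
  have fT': "family ?T'" using T B by (intro family_star)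
  have p: "fst p \<in> carrier A" "snd p \<in> B (fst p)" and ws: "word_in B ws" using Cons by auto
  show ?case
  proof (cases "fst p = \<beta>")
    case True
    then show ?thesis using Cons.hyps[of a t "us @ [p]"] Cons.prems by auto
  next
    case False
    obtain e where e: "e \<in> ?T' (wdeg a us \<oplus>\<^bsub>A\<^esub> fst p)" "wd t us \<otimes> snd p = wd (t \<otimes> snd p) us \<oplus> e"
      using wd_commute[OF T(1,3) B(1) T' Cons.prems(1,2) p Cons.prems(3)] by blast
    have deg: "wdeg (a \<oplus>\<^bsub>A\<^esub> fst p) us = wdeg a us \<oplus>\<^bsub>A\<^esub> fst p"
      using wdeg_add Cons.prems p by blast
    have wa: "wdeg a us \<oplus>\<^bsub>A\<^esub> fst p \<in> carrier A" using Cons.prems p wdeg_carrier by auto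
    have tp: "t \<otimes> snd p \<in> T (a \<oplus>\<^bsub>A\<^esub> fst p)"
      using Cons.prems p by (intro star_leD[OF T(3)]) auto
    have "wd (wd (t \<otimes> snd p) us) ws \<in> ?T' (wdeg (wdeg (a \<oplus>\<^bsub>A\<^esub> fst p) us) ws)"
      using Cons.prems p tp False by (intro Cons.hyps) auto
    moreover have "wd e ws \<in> ?T' (wdeg (wdeg a us \<oplus>\<^bsub>A\<^esub> fst p) ws)"
      using e wa ws by (intro wd_in[OF T'])
    moreover have "e \<in> carrier L" using family_carrier[OF fT' wa e(1)] .
    moreover have "wd (t \<otimes> snd p) us \<in> carrier L"
      using Cons.prems p family_carrier[OF T(1) _ tp] by (intro wd_carrier[OF B(1)]) auto
    ultimately show ?thesis
      using ws B wa fT' wdeg_carrier[OF wa ws] by (simp add: e(2) deg wd_add[of B] family_add)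
  qed
qed

text \<open>Among \<open>n * n + 1\<close> letters with at most \<open>n\<close> degrees, one degree
  occurs more than \<open>card Y\<close> times. A letter of degree outside \<open>Y\<close> is
  zero.\<close>

lemma act_le_act_derived:
  assumes C: "arith_graded C Y" and B: "family B" "B \<sqsubseteq> C"
    and T: "family T" "T \<sqsubseteq> C" "T \<star> B \<sqsubseteq> T" and T': "(T \<star> (B \<star> B)) \<star> B \<sqsubseteq> T \<star> (B \<star> B)"
    and n: "card Y \<le> n"
  shows "act T B (n * n + 1) \<sqsubseteq> T \<star> (B \<star> B)"
proof (rule act_le_if_words)
  show fT': "family (T \<star> (B \<star> B))" using T B by (intro family_star)
  fix a t ws
  assume a: "a \<in> carrier A" "t \<in> T a" and ws: "length ws = n * n + 1" "word_in B ws"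
  show "wd t ws \<in> (T \<star> (B \<star> B)) (wdeg a ws)"
  proof (cases "set (map fst ws) \<subseteq> Y")
    case True
    have "\<exists>\<beta>\<in>Y. card Y < count_list (map fst ws) \<beta>"
    proof (rule ccontr)
      assume "\<not> ?thesis"
      then have "\<And>\<beta>. \<beta> \<in> Y \<Longrightarrow> count_list (map fst ws) \<beta> \<le> n" using n by (meson leI le_trans)
      then have "sum (count_list (map fst ws)) Y \<le> card Y * n" 
        using sum_bounded_above[of Y "count_list (map fst ws)" n] by simp
      moreover have "sum (count_list (map fst ws)) Y = length ws"
        using sum_count_set[OF True] C by (auto simp: arith_graded_def)
      moreover have "card Y * n \<le> n * n" using n by simp
      ultimately show False using ws by simp
    qed
    then obtain \<beta> where \<beta>: "\<beta> \<in> Y" "card Y < count_list (map fst ws) \<beta>" by blast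
    have "\<beta> \<in> carrier A" using \<beta> C by (auto simp: arith_graded_def arith_free_def)
    then show ?thesis
      using word_absorbed[OF C B T T' a, of \<beta> "[]" ws] ws \<beta> by auto
  next
    case False
    then obtain p where p: "p \<in> set ws" "fst p \<notin> Y" by auto
    then obtain us vs where us: "ws = us @ p # vs" using split_list by metis
    have w: "word_in B us" "word_in B vs" "fst p \<in> carrier A" "snd p \<in> B (fst p)" using us ws by auto
    then have "snd p \<in> C (fst p)" using fam_leD[OF B(2)] by blast
    then have "snd p = \<zero>" using C p w by (auto simp: arith_graded_def)
    moreover have "wd t us \<in> carrier L"
      using a w B family_carrier[OF T(1)] by (intro wd_carrier[of B]) auto
    ultimately have "wd t ws = \<zero>" using us w B by (simp add: bracket_zero_right wd_zero[of B])
    then show ?thesis using fT' a ws wdeg_carrier by (auto intro!: family_zero)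
  qed
qed (use B T in auto)

definition zero_fam :: "('b \<Rightarrow> 'a set) \<Rightarrow> bool" where
  "zero_fam F \<longleftrightarrow> (\<forall>a\<in>carrier A. F a \<subseteq> {\<zero>})"

lemma zero_fam_star: 
  assumes "family F" "zero_fam B" shows "zero_fam (F \<star> B)"
  unfolding zero_fam_def
proof
  fix a assume "a \<in> carrier A"
  show "(F \<star> B) a \<subseteq> {\<zero>}"
    using assms family_carrier[OF assms(1)]
    by (intro star_le_at add_closed_zero) (force simp: zero_fam_def bracket_zero_right)
qed

lemma zero_fam_le: "F \<sqsubseteq> G \<Longrightarrow> zero_fam G \<Longrightarrow> zero_fam F"
  unfolding zero_fam_def fam_le_def by blast

lemma der_Suc_left: "der B (Suc s) = der (B \<star> B) s"
  using der_add[of B 1 s] by simp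

text \<open>Modulo the action of \<open>[B, B]\<close> the components of \<open>B\<close> act commutatively, so that in a long word
  the letters of one degree can be collected into a progression that leaves \<open>Y\<close>.\<close>

lemma solvable_acts_nilpotently:
  assumes C: "arith_graded C Y" "card Y \<le> n"
    and B: "family B" "B \<sqsubseteq> C" "B \<star> B \<sqsubseteq> B" and "zero_fam (der B s)"
  shows "zero_fam (act C B ((n * n + 1) ^ s))"
  using B assms(6)
proof (induct s arbitrary: B)
  case 0
  then show ?case using C zero_fam_star[of C B] by (auto simp: arith_graded_def)
next
  case (Suc s)
  let ?B' = "B \<star> B" and ?l = "n * n + 1"
  have C': "family C" "C \<star> C \<sqsubseteq> C" using C by (auto simp: arith_graded_def)
  have fB': "family ?B'" using Suc by (intro family_star)
  have B'B: "?B' \<sqsubseteq> B" using Suc by simp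
  have B'C: "?B' \<sqsubseteq> C" using B'B Suc.prems(2) fam_le_trans by blast
  have B'ideal: "?B' \<star> B \<sqsubseteq> ?B'" using Suc by (intro star_ideal)
  have B'B': "?B' \<star> ?B' \<sqsubseteq> ?B'"
    using star_mono[of ?B' B ?B' ?B'] B'B B'ideal fB' Suc.prems fam_le_refl fam_le_trans by blast
  have IH: "zero_fam (act C ?B' (?l ^ s))"
    using Suc.hyps[OF fB' B'C B'B'] Suc.prems(4) by (simp only: der_Suc_left)
  have CB: "C \<star> B \<sqsubseteq> C" using star_mono[of C C C B] C' Suc.prems fam_le_refl fam_le_trans by blast
  have ideal: "act C ?B' j \<star> B \<sqsubseteq> act C ?B' j" for j
    using C' Suc.prems fB' B'ideal CB by (induct j) (auto intro!: star_ideal family_act)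
  have fam: "family (act C ?B' j)" for j using C' fB' by (intro family_act)
  have le: "act C ?B' j \<sqsubseteq> C" for j
  proof (induct j)
    case (Suc j)
    then show ?case using star_mono[of C C "act C ?B' j" ?B'] C' B'C fam_le_trans by auto
  qed (simp add: fam_le_refl)
  \<comment> \<open>Each block of \<open>?l\<close> letters from \<open>B\<close> is traded for one
    letter from \<open>B \<star> B\<close>, whose derived length is smaller by one. Iterating over
    the derived length produces the power in the bound.\<close>
  have "act C B (?l * j) \<sqsubseteq> act C ?B' j" for j
  proof (induct j)
    case (Suc j)
    have "act C B (?l * Suc j) = act (act C B (?l * j)) B ?l"
      using act_add[of C B "?l * j" ?l] by (simp add: add.commute)
    then have 1: "act C B (?l * Suc j) = act (act C B (?l * j)) B ?l" .
    have 2: "act (act C B (?l * j)) B ?l \<sqsubseteq> act (act C ?B' j) B ?l"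
      using Suc.hyps Suc.prems \<open>family B\<close> fam by (intro act_mono)
    have 3: "act (act C ?B' j) B ?l \<sqsubseteq> act C ?B' j \<star> ?B'"
      using ideal[of j] ideal[of "Suc j"] fam le \<open>family B\<close> \<open>B \<sqsubseteq> C\<close> C(2)
      by (intro act_le_act_derived[OF C(1)]) auto
    show ?case using fam_le_trans[OF 2 3] 1 by simp
  qed (simp add: fam_le_refl)
  from this[of "?l ^ s"] IH show ?case using zero_fam_le by (metis power_Suc)
qed

section \<open>Kreknin's elimination\<close>

definition partial_character :: "'b set \<Rightarrow> nat \<Rightarrow> ('b \<Rightarrow> nat) \<Rightarrow> bool" where
  "partial_character Y N \<kappa> \<longleftrightarrow> (\<forall>x\<in>Y. \<kappa> x < N) \<and>
     (\<forall>b\<in>Y. \<forall>c\<in>Y. b \<oplus>\<^bsub>A\<^esub> c \<in> Y \<longrightarrow> \<kappa> (b \<oplus>\<^bsub>A\<^esub> c) = (\<kappa> b + \<kappa> c) mod N)"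

inductive subring_on :: "('b \<Rightarrow> 'a set) \<Rightarrow> ('b \<Rightarrow> bool) \<Rightarrow> 'b \<Rightarrow> 'a \<Rightarrow> bool" for F P where
  zero: "b \<in> carrier A \<Longrightarrow> subring_on F P b \<zero>"
| base: "\<lbrakk>b \<in> carrier A; P b; x \<in> F b\<rbrakk> \<Longrightarrow> subring_on F P b x"
| add: "\<lbrakk>subring_on F P b x; subring_on F P b y\<rbrakk> \<Longrightarrow> subring_on F P b (x \<oplus> y)"
| minus: "subring_on F P b x \<Longrightarrow> subring_on F P b (\<ominus> x)"
| bracket: "\<lbrakk>subring_on F P b x; subring_on F P c y\<rbrakk> \<Longrightarrow> subring_on F P (b \<oplus>\<^bsub>A\<^esub> c) (x \<otimes> y)"

lemma subring_on_le:
  assumes "family C" "C \<star> C \<sqsubseteq> C" "F \<sqsubseteq> C" "subring_on F P b x"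
  shows "b \<in> carrier A \<and> x \<in> C b"
  using assms(4)
  by induct (use assms in \<open>auto intro: family_zero family_add family_minus star_leD dest: fam_leD\<close>)

lemma subring_on_add_closed:
  assumes "family C" "C \<star> C \<sqsubseteq> C" "F \<sqsubseteq> C" "a \<in> carrier A"
  shows "add_closed {x. subring_on F P a x}"
  unfolding add_closed_def
  using family_carrier[OF assms(1,4)] subring_on_le[OF assms(1-3), of P a] assms(4)
  by (blast intro: subring_on.zero subring_on.add subring_on.minus)

lemma subring_on_subset:
  assumes "subring_on F P a x" "\<And>b y. b \<in> carrier A \<Longrightarrow> P b \<Longrightarrow> y \<in> F b \<Longrightarrow> subring_on G Q b y"
  shows "subring_on G Q a x"
  using assms(1) by induct (auto intro: assms(2) subring_on.intros)

lemma subring_on_empty: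
  assumes "subring_on F (\<lambda>b. False) a x" shows "x = \<zero>"
  using assms by induct (auto simp: bracket_zero_left)

text \<open>A letter of \<kappa>-value zero shifts the degree of a generator without changing its
  value, so it sends generators to generators or to zero; products follow by the Leibniz rule. This
  is what allows kernel letters to be appended to elements already eliminated.\<close>

lemma subring_on_normalised:
  assumes C: "arith_graded C Y" and \<kappa>: "partial_character Y N \<kappa>"
    and x: "subring_on (der C s) (\<lambda>b. b \<in> Y \<and> k < \<kappa> b) b x"
    and i: "i \<in> Y" "\<kappa> i = 0" "z \<in> C i"
  shows "subring_on (der C s) (\<lambda>b. b \<in> Y \<and> k < \<kappa> b) (b \<oplus>\<^bsub>A\<^esub> i) (x \<otimes> z)"
proof -
  have C': "family C" "C \<star> C \<sqsubseteq> C" "Y \<subseteq> carrier A" using C by (auto simp: arith_graded_def arith_free_def)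
  note le = subring_on_le[OF C'(1,2) der_le[OF C'(1,2)]]
  have iA: "i \<in> carrier A" "z \<in> carrier L" using i C' family_carrier by blast+
  have carr: "b \<in> carrier A" "x \<in> carrier L" if "subring_on (der C s) P b x" for P b x
    using le[OF that] family_carrier[OF C'(1)] by blast+
  show ?thesis
    using x
  proof induct
    case (zero b)
    then show ?case using iA subring_on.zero by (simp add: bracket_zero_left)
  next
    case (base b x)
    have xz: "x \<otimes> z \<in> der C s (b \<oplus>\<^bsub>A\<^esub> i)"
      using base i iA by (intro star_leD[OF der_ideal[OF C'(1,2)]]) auto
    have bi: "b \<oplus>\<^bsub>A\<^esub> i \<in> carrier A" using base iA by simp
    show ?case
    \<comment> \<open>The map \<kappa> is additive only for sums that stay in \<open>Y\<close>; a
      sum outside \<open>Y\<close> belongs to a zero component.\<close>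
    proof (cases "b \<oplus>\<^bsub>A\<^esub> i \<in> Y")
      case True
      then have "\<kappa> (b \<oplus>\<^bsub>A\<^esub> i) = \<kappa> b" using \<kappa> base i by (simp add: partial_character_def)
      then show ?thesis using True xz bi base by (intro subring_on.base) auto
    next
      case False
      then have "x \<otimes> z = \<zero>"
        using xz bi C fam_leD[OF der_le[OF C'(1,2)] bi xz] by (auto simp: arith_graded_def)
      then show ?thesis using bi subring_on.zero by simp
    qed
  next
    case (add b x y)
    then show ?case using subring_on.add carr iA by (simp add: bracket_add_left)
  next
    case (minus b x)
    then show ?case using subring_on.minus carr iA by (simp add: bracket_minus_left)
  next
    case (bracket b x c y)
    have xy: "x \<in> carrier L" "y \<in> carrier L" "b \<in> carrier A" "c \<in> carrier A" using carr[OF bracket(1)] carr[OF bracket(3)] by simp_all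
    have eq: "b \<oplus>\<^bsub>A\<^esub> i \<oplus>\<^bsub>A\<^esub> c = b \<oplus>\<^bsub>A\<^esub> c \<oplus>\<^bsub>A\<^esub> i" "b \<oplus>\<^bsub>A\<^esub> (c \<oplus>\<^bsub>A\<^esub> i) = b \<oplus>\<^bsub>A\<^esub> c \<oplus>\<^bsub>A\<^esub> i"
      using xy iA by (auto simp: grp.a_ac)
    show ?case
      unfolding bracket_leibniz_right[OF xy(1,2) iA(2)]
      using subring_on.bracket[OF bracket(2,3)] subring_on.bracket[OF bracket(1,4)] unfolding eq
      by (rule subring_on.add)
  qed
qed

text \<open>By the Jacobi identity \<open>z \<otimes> (x \<otimes> y)\<close> is a difference of
  left-normed words, and the inner brackets of \<open>z\<close> with \<open>x\<close> and
  \<open>y\<close> remain in \<open>G\<close>. The right factor can thus be taken to be a single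
  generator, everything else being absorbed by the left one.\<close>

lemma bracket_subring_on:
  assumes C: "family C" "C \<star> C \<sqsubseteq> C" and G: "family G" "G \<star> C \<sqsubseteq> G" and F: "family F" "F \<sqsubseteq> C"
    and y: "subring_on F P j y" and z: "i \<in> carrier A" "z \<in> G i"
  shows "z \<otimes> y \<in> (G \<star> (\<lambda>b. if P b then F b else {\<zero>})) (i \<oplus>\<^bsub>A\<^esub> j)"
proof -
  define FP where "FP = (\<lambda>b. if P b then F b else {\<zero>})"
  have FP: "family FP" "FP \<sqsubseteq> C"
    using F family_zero[OF C(1)] add_closed_zero by (auto simp: family_def FP_def fam_le_def)
  have H: "family (G \<star> FP)" using G FP family_star by blast
  note le = subring_on_le[OF C F(2)]
  have carr: "b \<in> carrier A" "x \<in> carrier L" if "subring_on F P b x" for b x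
    using le[OF that] family_carrier[OF C(1)] by blast+
  have "z \<otimes> y \<in> (G \<star> FP) (i \<oplus>\<^bsub>A\<^esub> j)"
    using y z
  proof (induct arbitrary: i z)
    case (zero b)
    then show ?case using H family_carrier[OF G(1)] family_zero[OF H] by (simp add: bracket_zero_right)
  next
    case (base b x)
    then show ?case by (intro starI) (auto simp: FP_def)
  next
    case (add b x y)
    then show ?case using carr family_carrier[OF G(1)] family_add[OF H] by (simp add: bracket_add_right)
  next
    case (minus b x)
    then show ?case using carr family_carrier[OF G(1)] family_minus[OF H] by (simp add: bracket_minus_right)
  next
    case (bracket b x c y)
    have c: "x \<in> carrier L" "y \<in> carrier L" "b \<in> carrier A" "c \<in> carrier A" "z \<in> carrier L"
      using carr[OF bracket(1)] carr[OF bracket(3)] family_carrier[OF G(1) bracket.prems] by simp_all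
    have zx: "z \<otimes> x \<in> G (i \<oplus>\<^bsub>A\<^esub> b)" "z \<otimes> y \<in> G (i \<oplus>\<^bsub>A\<^esub> c)"
      using star_leD[OF G(2) bracket.prems(1) c(3) bracket.prems(2)] le[OF bracket(1)]
        star_leD[OF G(2) bracket.prems(1) c(4) bracket.prems(2)] le[OF bracket(3)] by simp_all
    have "z \<otimes> x \<otimes> y \<in> (G \<star> FP) (i \<oplus>\<^bsub>A\<^esub> b \<oplus>\<^bsub>A\<^esub> c)" "z \<otimes> y \<otimes> x \<in> (G \<star> FP) (i \<oplus>\<^bsub>A\<^esub> c \<oplus>\<^bsub>A\<^esub> b)"
      using bracket zx c by auto
    moreover have "i \<oplus>\<^bsub>A\<^esub> b \<oplus>\<^bsub>A\<^esub> c = i \<oplus>\<^bsub>A\<^esub> (b \<oplus>\<^bsub>A\<^esub> c)" "i \<oplus>\<^bsub>A\<^esub> c \<oplus>\<^bsub>A\<^esub> b = i \<oplus>\<^bsub>A\<^esub> (b \<oplus>\<^bsub>A\<^esub> c)"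
      using bracket c by (auto simp: grp.a_ac)
    ultimately show ?case
      using bracket c family_add[OF H] family_minus[OF H] by (simp add: bracket_bracket_right)
  qed
  then show ?thesis unfolding FP_def .
qed

text \<open>The other components are replaced by zero instead of being removed, so that the kernel
  is a family over the same degrees.\<close>

definition char_kernel :: "('b \<Rightarrow> 'a set) \<Rightarrow> 'b set \<Rightarrow> ('b \<Rightarrow> nat) \<Rightarrow> 'b \<Rightarrow> 'a set" where
  "char_kernel C Y \<kappa> b = (if b \<in> Y \<and> \<kappa> b = 0 then C b else {\<zero>})"

text \<open>The invariant of the elimination: after \<open>d\<close> derived steps everything of
  nonzero value is built from generators of value at least \<open>k\<close>. It is stated for all
  \<open>s\<close> because it is applied again inside deeper derived terms.\<close>

definition derived_in_subring :: "('b \<Rightarrow> 'a set) \<Rightarrow> 'b set \<Rightarrow> ('b \<Rightarrow> nat) \<Rightarrow> nat \<Rightarrow> nat \<Rightarrow> bool" where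
  "derived_in_subring C Y \<kappa> k d \<longleftrightarrow> (\<forall>s. \<forall>a\<in>Y. \<kappa> a \<noteq> 0 \<longrightarrow>
     (\<forall>x\<in>der C (d + s) a. subring_on (der C s) (\<lambda>b. b \<in> Y \<and> k \<le> \<kappa> b) a x))"

text \<open>Without a carry, \<open>q \<le> p + q = k\<close> forces \<open>p = 0\<close>. With a
  carry, \<open>p + q = k + N\<close>, and as each summand is below \<open>N\<close>, the other one
  exceeds \<open>k\<close>.\<close>

lemma mod_sum_cases:
  fixes k N p q :: nat
  assumes "(p + q) mod N = k" "k \<le> q" "p < N" "q < N"
  shows "q = k \<and> p = 0 \<or> k < p \<and> k < q"
proof (cases "p + q < N")
  case False
  then have "(p + q) mod N = p + q - N" using assms by (simp add: le_mod_geq)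
  then show ?thesis using assms False by linarith
qed (use assms in auto)

text \<open>Each round writes the element as a sum of brackets. If both factors have value above
  \<open>k\<close>, the bracket is in the subring; otherwise, apart from zero brackets, one factor
  has value \<open>0\<close> and the other value \<open>k\<close>, and the induction hypothesis for
  the latter gains one more kernel letter. A round takes \<open>d + 1\<close> derived steps: one to
  obtain a bracket, and \<open>d\<close> to apply the invariant to its right factor.\<close>

lemma kreknin_component:
  assumes C: "arith_graded C Y" and \<kappa>: "partial_character Y N \<kappa>"
    and claim: "derived_in_subring C Y \<kappa> k d" and k: "k \<noteq> 0" and a: "a \<in> Y" "\<kappa> a = k"
  shows "der C (s + (d + 1) * r) a \<subseteq>
    gen ({x. subring_on (der C s) (\<lambda>b. b \<in> Y \<and> k < \<kappa> b) a x} \<union> act C (char_kernel C Y \<kappa>) r a)"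
  using a
proof (induct r arbitrary: a)
  case 0
  have C': "family C" "C \<star> C \<sqsubseteq> C" "Y \<subseteq> carrier A" using C by (auto simp: arith_graded_def arith_free_def)
  then show ?case using fam_leD[OF der_le[OF C'(1,2)], of a] 0
    by (auto intro!: generate.incl)
next
  case (Suc r)
  have C': "family C" "C \<star> C \<sqsubseteq> C" "Y \<subseteq> carrier A" using C by (auto simp: arith_graded_def arith_free_def)
  let ?E = "char_kernel C Y \<kappa>" and ?S = "subring_on (der C s) (\<lambda>b. b \<in> Y \<and> k < \<kappa> b)"
  define s' where "s' = s + (d + 1) * r"
  define R where "R r a = gen ({x. ?S a x} \<union> act C ?E r a)" for r a
  have fE: "family ?E" using C' add_closed_zero by (auto simp: family_def char_kernel_def)
  note dle = der_le[OF C'(1,2)] and fd = family_der[OF C'(1)]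
  have Rsub: "{x. ?S b x} \<union> act C ?E r b \<subseteq> carrier L" if "b \<in> carrier A" for r b
    using that subring_on_le[OF C'(1,2) dle] family_carrier[OF C'(1)]
      family_carrier[OF family_act[OF C'(1) fE]] by blast
  have Rcl: "add_closed (R r b)" if "b \<in> carrier A" for r b
    unfolding R_def using Rsub[OF that] by (rule add_closed_gen)
  have SR: "x \<in> R r b" if "?S b x" for r b x
    unfolding R_def using that by (intro generate.incl) auto
  have anti: "x \<in> der C t b" if "x \<in> der C t' b" "t \<le> t'" "b \<in> carrier A" for x t t' b
    using that fam_leD[OF der_antimono[OF C'(1,2)]] by blast
  have nY: "x = \<zero>" if "x \<in> der C t b" "b \<notin> Y" "b \<in> carrier A" for x t b
    using that fam_leD[OF dle] C by (fastforce simp: arith_graded_def)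
  \<comment> \<open>The factor \<open>y\<close> of value \<open>k\<close> is split by the induction
    hypothesis: its part in the subring is stable under the kernel letter \<open>z\<close>, and its
    other part becomes a word with one more kernel letter.\<close>
  have H1: "y \<otimes> z \<in> R (Suc r) (c \<oplus>\<^bsub>A\<^esub> i)"
    if "c \<in> Y" "\<kappa> c = k" "i \<in> Y" "\<kappa> i = 0" "y \<in> der C s' c" "z \<in> C i" for c i y z
  proof -
    have ci: "c \<in> carrier A" "i \<in> carrier A" "c \<oplus>\<^bsub>A\<^esub> i \<in> carrier A" using that C' by auto
    have yR: "y \<in> gen ({x. ?S c x} \<union> act C ?E r c)" using Suc.hyps[of c] that by (auto simp: s'_def)
    have zL: "z \<in> carrier L" using that ci family_carrier[OF C'(1)] by blast
    have zE: "z \<in> ?E i" using that by (simp add: char_kernel_def)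
    show ?thesis
    proof (rule gen_bracket_left[OF Rcl[OF ci(3)] zL Rsub[OF ci(1)] _ yR])
      fix v assume "v \<in> {x. ?S c x} \<union> act C ?E r c"
      then show "v \<otimes> z \<in> R (Suc r) (c \<oplus>\<^bsub>A\<^esub> i)"
      proof
        assume "v \<in> {x. ?S c x}"
        then show ?thesis using subring_on_normalised[OF C \<kappa>, of s k c v i z] that SR by blast
      next
        assume "v \<in> act C ?E r c"
        then have "v \<otimes> z \<in> act C ?E (Suc r) (c \<oplus>\<^bsub>A\<^esub> i)" using ci zE by (auto intro: starI)
        then show ?thesis unfolding R_def by (intro generate.incl) auto
      qed
    qed
  qed
  have H2: "z \<otimes> y \<in> R (Suc r) (i \<oplus>\<^bsub>A\<^esub> c)"
    if "c \<in> Y" "\<kappa> c = k" "i \<in> Y" "\<kappa> i = 0" "y \<in> der C s' c" "z \<in> C i" for c i y z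
  proof -
    have ci: "c \<in> carrier A" "i \<in> carrier A" "c \<oplus>\<^bsub>A\<^esub> i \<in> carrier A" using that C' by auto
    have "y \<in> carrier L" "z \<in> carrier L" using that ci family_carrier[OF C'(1)] family_carrier[OF fd] by blast+
    then have "z \<otimes> y = \<ominus> (y \<otimes> z)" by (intro bracket_antisym)
    moreover have "i \<oplus>\<^bsub>A\<^esub> c = c \<oplus>\<^bsub>A\<^esub> i" using ci by (simp add: grp.a_comm)
    ultimately show ?thesis using H1[OF that] Rcl[OF ci(3)] by (auto simp: add_closed_def)
  qed
  let ?D = "der C (d + s')"
  have aA: "a \<in> carrier A" using Suc.prems C' by auto
  have zR: "\<zero> \<in> R (Suc r) a" using Rcl[OF aA] by (auto simp: add_closed_def)
  have "(?D \<star> ?D) a \<subseteq> R (Suc r) a"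
  proof (rule star_le_at[OF Rcl[OF aA]])
    fix b c x y
    assume b: "b \<in> carrier A" and c: "c \<in> carrier A" and bc: "b \<oplus>\<^bsub>A\<^esub> c = a" and x: "x \<in> ?D b" and y: "y \<in> ?D c"
    have xy: "x \<in> carrier L" "y \<in> carrier L" using b c x y family_carrier[OF fd] by blast+
    have xs: "x \<in> der C s' b" "y \<in> der C s' c" using anti x y b c by auto
    have xC: "x \<in> C b" "y \<in> C c" using fam_leD[OF dle] b c x y by blast+
    consider "b \<notin> Y" | "c \<notin> Y" | "b \<in> Y" "c \<in> Y" "\<kappa> b = 0" | "b \<in> Y" "c \<in> Y" "\<kappa> c = 0"
      | "b \<in> Y" "c \<in> Y" "\<kappa> b \<noteq> 0" "\<kappa> c \<noteq> 0" by blast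
    then show "x \<otimes> y \<in> R (Suc r) a"
    proof cases
      case 1
      then show ?thesis using nY[OF x] b xy zR by (simp add: bracket_zero_left)
    next
      case 2
      then show ?thesis using nY[OF y] c xy zR by (simp add: bracket_zero_right)
    next
      case 3
      then have "\<kappa> c = k" using \<kappa> Suc.prems bc by (auto simp: partial_character_def)
      then show ?thesis using H2[of c b y x] 3 xs xC bc by simp
    next
      case 4
      then have "\<kappa> b = k" using \<kappa> Suc.prems bc by (auto simp: partial_character_def)
      then show ?thesis using H1[of b c x y] 4 xs xC bc by simp
    next
      case 5
      let ?P = "\<lambda>b. b \<in> Y \<and> k \<le> \<kappa> b"
      have "subring_on (der C s') ?P c y" using claim 5 y by (auto simp: derived_in_subring_def)
      \<comment> \<open>Replacing the right factor by single generators of value at least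
        \<open>k\<close> brings every bracket into the situation of
        \<open>mod_sum_cases\<close>.\<close>
      then have "x \<otimes> y \<in> (?D \<star> (\<lambda>b. if ?P b then der C s' b else {\<zero>})) (b \<oplus>\<^bsub>A\<^esub> c)"
        using bracket_subring_on[OF C'(1,2) fd der_ideal[OF C'(1,2)] fd dle _ b x] by blast
      moreover have "(?D \<star> (\<lambda>b. if ?P b then der C s' b else {\<zero>})) a \<subseteq> R (Suc r) a"
      proof (rule star_le_at[OF Rcl[OF aA]])
        fix b' c' x' y'
        assume b': "b' \<in> carrier A" and c': "c' \<in> carrier A" and bc': "b' \<oplus>\<^bsub>A\<^esub> c' = a" and x': "x' \<in> ?D b'"
          and y': "y' \<in> (if ?P c' then der C s' c' else {\<zero>})"
        have x'L: "x' \<in> carrier L" using b' x' family_carrier[OF fd] by blast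
        show "x' \<otimes> y' \<in> R (Suc r) a"
        proof (cases "?P c' \<and> b' \<in> Y")
          case False
          then have "x' = \<zero> \<or> y' = \<zero>" using nY[OF x'] b' y' by (auto split: if_splits)
          moreover have "y' \<in> carrier L" using y' c' family_carrier[OF fd] by (auto split: if_splits)
          ultimately show ?thesis using x'L zR bracket_zero_left bracket_zero_right by metis
        next
          case True
          then have y'': "y' \<in> der C s' c'" using y' by simp
          have "(\<kappa> b' + \<kappa> c') mod N = k" "\<kappa> b' < N" "\<kappa> c' < N"
            using True \<kappa> Suc.prems bc' by (auto simp: partial_character_def)
          then have "\<kappa> c' = k \<and> \<kappa> b' = 0 \<or> k < \<kappa> b' \<and> k < \<kappa> c'"
            using True by (intro mod_sum_cases) auto
          then consider "\<kappa> c' = k" "\<kappa> b' = 0" | "k < \<kappa> b'" "k < \<kappa> c'"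
            by metis
          then show ?thesis
          proof cases
            case 1
            then show ?thesis using H2[of c' b' y' x'] True y'' bc' fam_leD[OF dle b' x'] by simp
          next
            case 2
            have "x' \<in> der C s b'" "y' \<in> der C s c'"
              using anti[OF x' _ b', of s] anti[OF y'' _ c', of s] by (auto simp: s'_def)
            then have "?S b' x'" "?S c' y'" using 2 True b' c' by (auto intro: subring_on.base)
            then have "?S a (x' \<otimes> y')" using subring_on.bracket bc' by blast
            then show ?thesis by (rule SR)
          qed
        qed
      qed
      ultimately show ?thesis using bc by auto
    qed
  qed
  moreover have "der C (s + (d + 1) * Suc r) = ?D \<star> ?D"
    using der.simps(2)[of C "d + s'"] by (simp add: s'_def algebra_simps)
  ultimately show ?case unfolding R_def by simp
qed

lemma derived_in_subring_mono:
  assumes "family C" "C \<star> C \<sqsubseteq> C" "Y \<subseteq> carrier A" "derived_in_subring C Y \<kappa> k d" "d \<le> d'"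
  shows "derived_in_subring C Y \<kappa> k d'"
  unfolding derived_in_subring_def
proof (intro allI ballI impI)
  fix s a x assume a: "a \<in> Y" "\<kappa> a \<noteq> 0" and x: "x \<in> der C (d' + s) a"
  have "x \<in> der C (d + s) a"
    using fam_leD[OF der_antimono[OF assms(1,2), of "d + s" "d' + s"], of a x] assms a x by auto
  then show "subring_on (der C s) (\<lambda>b. b \<in> Y \<and> k \<le> \<kappa> b) a x"
    using assms(4) a by (auto simp: derived_in_subring_def)
qed

text \<open>The invariant leads in \<open>d\<close> steps to generators of value at least
  \<open>k\<close> in a deeper derived term. Those of value exactly \<open>k\<close> are then
  eliminated by \<open>m\<close> rounds of \<open>d + 1\<close> steps, since words with
  \<open>m\<close> kernel letters vanish.\<close>

lemma derived_in_subring_step: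
  assumes C: "arith_graded C Y" and \<kappa>: "partial_character Y N \<kappa>"
    and claim: "derived_in_subring C Y \<kappa> k d" and k: "k \<noteq> 0"
    and m: "zero_fam (act C (char_kernel C Y \<kappa>) m)"
  shows "derived_in_subring C Y \<kappa> (Suc k) (d + (d + 1) * m)"
  unfolding derived_in_subring_def
proof (intro allI ballI impI)
  have C': "family C" "C \<star> C \<sqsubseteq> C" "Y \<subseteq> carrier A" using C by (auto simp: arith_graded_def arith_free_def)
  fix s a x assume a: "a \<in> Y" "\<kappa> a \<noteq> 0" and x: "x \<in> der C (d + (d + 1) * m + s) a"
  let ?Q = "\<lambda>b. b \<in> Y \<and> Suc k \<le> \<kappa> b"
  have "subring_on (der C (s + (d + 1) * m)) (\<lambda>b. b \<in> Y \<and> k \<le> \<kappa> b) a x"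
    using claim a x by (auto simp: derived_in_subring_def add.assoc add.commute add.left_commute)
  then show "subring_on (der C s) ?Q a x"
  proof (rule subring_on_subset)
    fix b y
    assume b: "b \<in> carrier A" "b \<in> Y \<and> k \<le> \<kappa> b" and y: "y \<in> der C (s + (d + 1) * m) b"
    show "subring_on (der C s) ?Q b y"
    proof (cases "\<kappa> b = k")
      case True
      have "y \<in> gen ({x. subring_on (der C s) ?Q b x} \<union> act C (char_kernel C Y \<kappa>) m b)"
        using kreknin_component[OF C \<kappa> claim k, of b s m] b True y by (auto simp: Suc_le_eq)
      moreover have "gen ({x. subring_on (der C s) ?Q b x} \<union> act C (char_kernel C Y \<kappa>) m b)
        \<subseteq> {x. subring_on (der C s) ?Q b x}"
      proof (rule gen_least)
        show "add_closed {x. subring_on (der C s) ?Q b x}"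
          using b by (intro subring_on_add_closed[OF C'(1,2) der_le[OF C'(1,2)]])
        have "act C (char_kernel C Y \<kappa>) m b \<subseteq> {\<zero>}" using m b by (auto simp: zero_fam_def)
        then show "{x. subring_on (der C s) ?Q b x} \<union> act C (char_kernel C Y \<kappa>) m b
            \<subseteq> {x. subring_on (der C s) ?Q b x}"
          using subring_on.zero[OF b(1), of "der C s" ?Q] by blast
      qed
      ultimately show ?thesis by blast
    next
      case False
      have "y \<in> der C s b" using fam_leD[OF der_antimono[OF C'(1,2), of s] b(1) y] by simp
      then show ?thesis using b False by (intro subring_on.base) auto
    qed
  qed
qed

text \<open>A step multiplies \<open>d + 1\<close> by \<open>m + 1\<close>, whereas a value not
  taken on \<open>Y\<close> costs nothing. The exponent therefore counts degrees, and
  \<open>N\<close> does not enter.\<close>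

lemma derived_in_subring_iterate:
  assumes C: "arith_graded C Y" and \<kappa>: "partial_character Y N \<kappa>"
    and m: "zero_fam (act C (char_kernel C Y \<kappa>) m)" and k: "1 \<le> k"
  shows "derived_in_subring C Y \<kappa> k ((m + 1) ^ card {a \<in> Y. \<kappa> a < k} - 1)"
  using k
proof (induct k rule: dec_induct)
  case base
  have C': "family C" "C \<star> C \<sqsubseteq> C" "Y \<subseteq> carrier A" using C by (auto simp: arith_graded_def arith_free_def)
  have "derived_in_subring C Y \<kappa> 1 0"
    unfolding derived_in_subring_def using C' by (auto intro!: subring_on.base)
  then show ?case using derived_in_subring_mono[OF C'] by blast
next
  case (step k)
  have C': "family C" "C \<star> C \<sqsubseteq> C" "Y \<subseteq> carrier A" "finite Y" using C by (auto simp: arith_graded_def arith_free_def)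
  let ?d = "(m + 1) ^ card {a \<in> Y. \<kappa> a < k} - 1"
  have d: "?d + 1 = (m + 1) ^ card {a \<in> Y. \<kappa> a < k}" by simp
  have sub: "{a \<in> Y. \<kappa> a < k} \<subseteq> {a \<in> Y. \<kappa> a < Suc k}" by auto
  show ?case
  proof (cases "\<exists>a\<in>Y. \<kappa> a = k")
    case True
    then have "{a \<in> Y. \<kappa> a < k} \<subset> {a \<in> Y. \<kappa> a < Suc k}" by force
    then have "Suc (card {a \<in> Y. \<kappa> a < k}) \<le> card {a \<in> Y. \<kappa> a < Suc k}"
      using C' by (simp add: Suc_le_eq psubset_card_mono)
    then have "(m + 1) ^ Suc (card {a \<in> Y. \<kappa> a < k}) \<le> (m + 1) ^ card {a \<in> Y. \<kappa> a < Suc k}"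
      by (intro power_increasing) auto
    moreover have "?d + (?d + 1) * m + 1 = (m + 1) ^ Suc (card {a \<in> Y. \<kappa> a < k})"
      using d by (simp add: algebra_simps)
    ultimately have "?d + (?d + 1) * m \<le> (m + 1) ^ card {a \<in> Y. \<kappa> a < Suc k} - 1" by linarith
    then show ?thesis
      using derived_in_subring_step[OF C \<kappa> step(3) _ m] step(1) derived_in_subring_mono[OF C'(1-3)] by simp
  next
    case False
    then have eq: "(b \<in> Y \<and> k \<le> \<kappa> b) = (b \<in> Y \<and> Suc k \<le> \<kappa> b)" "(b \<in> Y \<and> \<kappa> b < k) = (b \<in> Y \<and> \<kappa> b < Suc k)" for b
      by (auto simp: le_less Suc_le_eq less_Suc_eq)
    show ?thesis using step(3) unfolding derived_in_subring_def eq .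
  qed
qed

text \<open>When \<open>k\<close> has reached \<open>N\<close>, no generator is left, so every
  component of nonzero value has become zero.\<close>

lemma derived_le_char_kernel:
  assumes C: "arith_graded C Y" and \<kappa>: "partial_character Y N \<kappa>"
    and m: "zero_fam (act C (char_kernel C Y \<kappa>) m)" and n: "card Y \<le> n"
  shows "der C ((m + 1) ^ n) \<sqsubseteq> char_kernel C Y \<kappa>"
  unfolding fam_le_def
proof
  fix a assume a: "a \<in> carrier A"
  have C': "family C" "C \<star> C \<sqsubseteq> C" "Y \<subseteq> carrier A" "finite Y" using C by (auto simp: arith_graded_def arith_free_def)
  note dC = fam_leD[OF der_le[OF C'(1,2)]]
  consider "a \<notin> Y" | "a \<in> Y" "\<kappa> a = 0" | "a \<in> Y" "\<kappa> a \<noteq> 0" by blast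
  then show "der C ((m + 1) ^ n) a \<subseteq> char_kernel C Y \<kappa> a"
  proof cases
    case 1
    then show ?thesis using dC a C by (fastforce simp: arith_graded_def char_kernel_def)
  next
    case 2
    then show ?thesis using dC a by (auto simp: char_kernel_def)
  next
    case 3
    let ?c = "card {a \<in> Y. \<kappa> a < max 1 N}"
    have "?c \<le> n" using n C' card_mono[of Y "{a \<in> Y. \<kappa> a < max 1 N}"] by auto
    then have "(m + 1) ^ ?c - 1 \<le> (m + 1) ^ n" by (meson diff_le_self le_trans le_add2 power_increasing)
    then have "derived_in_subring C Y \<kappa> (max 1 N) ((m + 1) ^ n)"
      using derived_in_subring_iterate[OF C \<kappa> m, of "max 1 N"] derived_in_subring_mono[OF C'(1-3)] by auto
    moreover have eq: "(b \<in> Y \<and> max 1 N \<le> \<kappa> b) = False" for b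
      using \<kappa> by (auto simp: partial_character_def)
    ultimately have "\<forall>x\<in>der C ((m + 1) ^ n + 0) a. subring_on (der C 0) (\<lambda>b. False) a x"
      using 3 unfolding derived_in_subring_def eq by blast
    then have "\<forall>x\<in>der C ((m + 1) ^ n) a. x = \<zero>" using subring_on_empty by auto
    then show ?thesis using 3 by (auto simp: char_kernel_def)
  qed
qed

end

section \<open>Nilpotency of Lie rings with arithmetically-free gradings\<close>

lemma (in comm_group) subgroup_line:
  assumes "subgroup H G" "y \<in> carrier G"
  shows "subgroup {h \<otimes> y [^] (k::int) | h k. h \<in> H} G"
proof (rule subgroupI)
  have H: "\<And>h. h \<in> H \<Longrightarrow> h \<in> carrier G" using subgroup.mem_carrier[OF assms(1)] .
  show "{h \<otimes> y [^] (k::int) | h k. h \<in> H} \<subseteq> carrier G" using assms H by auto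
  show "{h \<otimes> y [^] (k::int) | h k. h \<in> H} \<noteq> {}" using subgroup.one_closed[OF assms(1)] by auto
  fix a assume "a \<in> {h \<otimes> y [^] (k::int) | h k. h \<in> H}"
  then obtain h and k :: int where a: "a = h \<otimes> y [^] k" "h \<in> H" by blast
  have "inv a = inv h \<otimes> y [^] (- k)" using a H assms by (simp add: inv_mult int_pow_neg)
  then show "inv a \<in> {h \<otimes> y [^] (k::int) | h k. h \<in> H}" using a subgroup.m_inv_closed[OF assms(1)] by blast
  fix b assume "b \<in> {h \<otimes> y [^] (k::int) | h k. h \<in> H}"
  then obtain h' and k' :: int where b: "b = h' \<otimes> y [^] k'" "h' \<in> H" by blast
  have "a \<otimes> b = (h \<otimes> h') \<otimes> y [^] (k + k')" using a b H assms by (simp add: int_pow_mult m_ac)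
  then show "a \<otimes> b \<in> {h \<otimes> y [^] (k::int) | h k. h \<in> H}"
    using a b subgroup.m_closed[OF assms(1)] by blast
qed

text \<open>Enlarge \<open>H\<close> by the cyclic groups of the elements of \<open>Y\<close> one
  after the other, and stop just before all of \<open>Y\<close> is covered. Modulo the subgroup
  reached, \<open>Y\<close> lies in the cyclic group generated by the next element \<open>y\<close>,
  which is nontrivial there.\<close>

lemma (in comm_group) finite_subset_of_line:
  assumes "finite Y" "Y \<subseteq> carrier G" "subgroup H G" "\<not> Y \<subseteq> H"
  shows "\<exists>H' y. subgroup H' G \<and> H \<subseteq> H' \<and> y \<in> Y \<and> y \<notin> H' \<and> (\<forall>x\<in>Y. \<exists>h\<in>H'. \<exists>k::int. x = h \<otimes> y [^] k)"
  using assms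
proof (induct Y arbitrary: H)
  case (insert x Y)
  have x: "x \<in> carrier G" using insert by auto
  let ?L = "{h \<otimes> x [^] (k::int) | h k. h \<in> H}"
  have L: "subgroup ?L G" using subgroup_line insert x by blast
  have one: "\<one> \<in> H" using insert subgroup.one_closed by auto
  have HL: "H \<subseteq> ?L"
  proof
    fix h assume "h \<in> H"
    then have "h = h \<otimes> x [^] (0::int)" using subgroup.mem_carrier[OF insert(5)] by simp
    then show "h \<in> ?L" using \<open>h \<in> H\<close> by blast
  qed
  have xL: "x \<in> ?L"
  proof -
    have "x = \<one> \<otimes> x [^] (1::int)" using x by (simp add: int_pow_1)
    then show ?thesis using one by blast
  qed
  show ?case
  proof (cases "Y \<subseteq> ?L")
    case True
    have "x \<notin> H"
    proof
      assume xH: "x \<in> H"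
      have "?L \<subseteq> H" using subgroup_int_pow_closed[OF insert(5) xH] subgroup.m_closed[OF insert(5)] by blast
      then show False using True insert xH by blast
    qed
    moreover have "\<forall>z\<in>insert x Y. \<exists>h\<in>H. \<exists>k::int. z = h \<otimes> x [^] k" using True xL by blast
    ultimately show ?thesis using insert(5) by blast
  next
    case False
    then obtain H' y where H': "subgroup H' G" "?L \<subseteq> H'" "y \<in> Y" "y \<notin> H'" 
      "\<forall>z\<in>Y. \<exists>h\<in>H'. \<exists>k::int. z = h \<otimes> y [^] k" 
      using insert.hyps(3)[OF _ L False] insert.prems by auto
    have "x = x \<otimes> y [^] (0::int)" using x by simp
    then have "\<forall>z\<in>insert x Y. \<exists>h\<in>H'. \<exists>k::int. z = h \<otimes> y [^] k" using H' xL by blast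
    then show ?thesis using H' HL by blast
  qed
qed simp

text \<open>\<open>N\<close> is the order of \<open>y\<close> modulo \<open>H\<close>, which exceeds
  \<open>1\<close> because \<open>y\<close> is outside \<open>H\<close>. If that order is infinite,
  every modulus is admissible and \<open>2\<close> is taken.\<close>

lemma (in group) int_pow_subgroup_modulus:
  assumes H: "subgroup H G" and y: "y \<in> carrier G" "y \<notin> H"
  shows "\<exists>N\<ge>2. \<forall>k::int. y [^] k \<in> H \<longrightarrow> int N dvd k"
proof (cases "\<forall>k::int. y [^] k \<in> H \<longrightarrow> k = 0")
  case True
  then show ?thesis by (intro exI[of _ 2]) auto
next
  case False
  then obtain k :: int where k: "y [^] k \<in> H" "k \<noteq> 0" by blast
  have neg: "y [^] (- j) \<in> H" if "y [^] j \<in> H" for j :: int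
    using that subgroup.m_inv_closed[OF H that] y by (simp add: int_pow_neg)
  have "\<exists>q>0. y [^] int q \<in> H"
    using k neg[of k] by (intro exI[of _ "nat \<bar>k\<bar>"]) (auto simp: abs_if)
  define q where "q = (LEAST q. 0 < q \<and> y [^] int q \<in> H)"
  have q: "0 < q" "y [^] int q \<in> H" unfolding q_def using \<open>\<exists>q>0. y [^] int q \<in> H\<close> LeastI_ex by (metis (mono_tags, lifting))+
  have least: "\<not> (0 < r \<and> y [^] int r \<in> H)" if "r < q" for r
    using that not_less_Least unfolding q_def by blast
  have "q \<noteq> 1" using q y by (auto simp: int_pow_1)
  then have "2 \<le> q" using q by simp
  moreover have "int q dvd j" if j: "y [^] j \<in> H" for j :: int
  proof -
    have "y [^] (int q * - (j div int q)) = (y [^] int q) [^] (- (j div int q))"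
      using y by (simp add: int_pow_pow)
    then have "y [^] (int q * - (j div int q)) \<in> H" using subgroup_int_pow_closed[OF H q(2)] by metis
    then have "y [^] j \<otimes> y [^] (int q * - (j div int q)) \<in> H" using subgroup.m_closed[OF H j] by blast
    then have "y [^] (j + int q * - (j div int q)) \<in> H" using y by (simp only: int_pow_mult)
    moreover have "j + int q * - (j div int q) = j mod int q" by (simp add: minus_mult_div_eq_mod)
    ultimately have "y [^] int (nat (j mod int q)) \<in> H" using q by simp
    moreover have "nat (j mod int q) < q" using q by (simp add: nat_less_iff)
    ultimately have "nat (j mod int q) = 0" using least neq0_conv by metis
    moreover have "0 \<le> j mod int q" using q by simp
    ultimately have "j mod int q = 0" by linarith
    then show ?thesis by (simp only: mod_eq_0_iff_dvd)
  qed
  ultimately show ?thesis by blast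
qed

text \<open>Modulo \<open>H\<close> the elements of \<open>Y\<close> are powers of \<open>y\<close>
  whose exponents are unique up to multiples of \<open>N\<close>; \<kappa> is the exponent reduced
  modulo \<open>N\<close>. At \<open>y\<close> the exponent is congruent to \<open>1\<close>, hence
  nonzero since \<open>2 \<le> N\<close>.\<close>

lemma (in comm_group) partial_character_exists:
  assumes "finite Y" "Y \<subseteq> carrier G" "y0 \<in> Y" "y0 \<noteq> \<one>"
  shows "\<exists>(N::nat) \<kappa>. (\<forall>x\<in>Y. \<kappa> x < N) \<and> (\<exists>y\<in>Y. \<kappa> y \<noteq> 0) \<and>
    (\<forall>b\<in>Y. \<forall>c\<in>Y. b \<otimes> c \<in> Y \<longrightarrow> \<kappa> (b \<otimes> c) = (\<kappa> b + \<kappa> c) mod N)"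
proof -
  have "\<not> Y \<subseteq> {\<one>}" using assms by auto
  then obtain H y where H: "subgroup H G" "y \<in> Y" "y \<notin> H" "\<forall>x\<in>Y. \<exists>h\<in>H. \<exists>k::int. x = h \<otimes> y [^] k"
    using finite_subset_of_line[OF assms(1,2) triv_subgroup] by blast
  have y: "y \<in> carrier G" using H assms by auto
  obtain N where N: "2 \<le> N" "\<And>k::int. y [^] k \<in> H \<Longrightarrow> int N dvd k"
    using int_pow_subgroup_modulus[OF H(1) y H(3)] by blast
  obtain h k where hk: "\<And>x. x \<in> Y \<Longrightarrow> h x \<in> H \<and> x = h x \<otimes> y [^] (k x :: int)"
    using H(4) by metis
  have hc: "h x \<in> carrier G" if "x \<in> Y" for x using hk[OF that] subgroup.mem_carrier[OF H(1)] by blast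
  have unique: "int N dvd j - i"
    if "u \<in> H" "v \<in> H" "u \<otimes> y [^] j = v \<otimes> y [^] i" for u v and i j :: int
  proof -
    have uv: "u \<in> carrier G" "v \<in> carrier G" using that subgroup.mem_carrier[OF H(1)] by auto
    have "y [^] (j - i) = inv u \<otimes> (u \<otimes> y [^] j) \<otimes> y [^] (- i)"
      using uv y by (simp add: m_assoc[symmetric] int_pow_mult[symmetric])
    also have "\<dots> = inv u \<otimes> v"
      unfolding that(3) using uv y by (simp add: m_assoc int_pow_mult[symmetric])
    finally have "y [^] (j - i) \<in> H"
      using that subgroup.m_closed[OF H(1)] subgroup.m_inv_closed[OF H(1)] by simp
    then show ?thesis by (rule N(2))
  qed
  define \<kappa> where "\<kappa> x = nat (k x mod int N)" for x
  have \<kappa>: "int (\<kappa> x) = k x mod int N" for x using N by (simp add: \<kappa>_def)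
  have "\<kappa> x < N" for x using N by (simp add: \<kappa>_def nat_less_iff)
  moreover have "\<kappa> y \<noteq> 0"
  proof
    assume "\<kappa> y = 0"
    then have "int N dvd k y" using \<kappa>[of y] by auto
    moreover have "int N dvd k y - 1"
      using H(2) y hk[OF H(2)] subgroup.one_closed[OF H(1)] by (intro unique[of "h y" \<one>]) (auto simp: int_pow_1)
    ultimately have "int N dvd k y - (k y - 1)" by (rule dvd_diff)
    then show False using N by simp
  qed
  moreover have "\<kappa> (b \<otimes> c) = (\<kappa> b + \<kappa> c) mod N" if bc: "b \<in> Y" "c \<in> Y" "b \<otimes> c \<in> Y" for b c
  proof -
    have "h (b \<otimes> c) \<otimes> y [^] k (b \<otimes> c) = b \<otimes> c" using hk[OF bc(3)] by simp
    also have "\<dots> = (h b \<otimes> y [^] k b) \<otimes> (h c \<otimes> y [^] k c)" using hk bc by simp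
    also have "\<dots> = (h b \<otimes> h c) \<otimes> y [^] (k b + k c)"
      using hc bc y by (simp add: m_ac int_pow_mult)
    finally have "h (b \<otimes> c) \<otimes> y [^] k (b \<otimes> c) = (h b \<otimes> h c) \<otimes> y [^] (k b + k c)" .
    moreover have "h (b \<otimes> c) \<in> H" "h b \<otimes> h c \<in> H" using hk bc subgroup.m_closed[OF H(1)] by blast+
    ultimately have "int N dvd k (b \<otimes> c) - (k b + k c)" by (intro unique)
    then have "k (b \<otimes> c) mod int N = (k b + k c) mod int N" by (simp add: mod_eq_dvd_iff)
    then have "int (\<kappa> (b \<otimes> c)) = int ((\<kappa> b + \<kappa> c) mod N)" by (simp add: \<kappa> zmod_int mod_simps)
    then show ?thesis by simp
  qed
  ultimately show ?thesis using H(2) by blast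
qed

text \<open>For \<open>Suc n\<close> degrees the kernel has at most \<open>n\<close>, so its derived
  length is at most \<open>solvability_bound n\<close>. It acts nilpotently with exponent
  \<open>m\<close>, the inner power; the derived series enters the kernel after
  \<open>(m + 1) ^ Suc n\<close> steps and is zero \<open>solvability_bound n\<close> steps
  later.\<close>

primrec solvability_bound :: "nat \<Rightarrow> nat" where
  "solvability_bound 0 = 0"
| "solvability_bound (Suc n) =
     ((Suc n * Suc n + 1) ^ solvability_bound n + 1) ^ Suc n + solvability_bound n"

section \<open>Solvability and the bound on the class\<close>

context lie_ring_degrees begin

text \<open>A string that starts at zero with step zero is constant. Consequently every degree in
  \<open>Y\<close> is nonzero, as the existence of a character requires.\<close>

lemma arith_free_nonzero: "arith_free A Y \<Longrightarrow> \<zero>\<^bsub>A\<^esub> \<notin> Y"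
proof
  assume Y: "arith_free A Y" "\<zero>\<^bsub>A\<^esub> \<in> Y"
  have "\<zero>\<^bsub>A\<^esub> \<oplus>\<^bsub>A\<^esub> add_pow A k \<zero>\<^bsub>A\<^esub> = \<zero>\<^bsub>A\<^esub>" for k :: nat
    by (simp add: grp.add.nat_pow_one)
  then show False using Y unfolding arith_free_def by metis
qed

lemma arith_free_subset: "arith_free A Y \<Longrightarrow> Z \<subseteq> Y \<Longrightarrow> arith_free A Z"
  unfolding arith_free_def by blast

lemma char_kernel_arith_graded:
  assumes C: "arith_graded C Y" and \<kappa>: "partial_character Y N \<kappa>"
  shows "arith_graded (char_kernel C Y \<kappa>) {b \<in> Y. \<kappa> b = 0}" and "char_kernel C Y \<kappa> \<sqsubseteq> C"
proof -
  have C': "family C" "C \<star> C \<sqsubseteq> C" "Y \<subseteq> carrier A" "finite Y" "arith_free A Y"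
    using C by (auto simp: arith_graded_def arith_free_def)
  have fam: "family (char_kernel C Y \<kappa>)"
    using C' add_closed_zero by (auto simp: family_def char_kernel_def)
  show le: "char_kernel C Y \<kappa> \<sqsubseteq> C"
    using family_zero[OF C'(1)] by (auto simp: fam_le_def char_kernel_def)
  have "char_kernel C Y \<kappa> \<star> char_kernel C Y \<kappa> \<sqsubseteq> char_kernel C Y \<kappa>"
  proof (rule star_le[OF fam])
    fix b c x y
    assume bc: "b \<in> carrier A" "c \<in> carrier A" and x: "x \<in> char_kernel C Y \<kappa> b" and y: "y \<in> char_kernel C Y \<kappa> c"
    have xy: "x \<in> carrier L" "y \<in> carrier L" using family_carrier[OF fam] bc x y by auto
    have xyC: "x \<otimes> y \<in> C (b \<oplus>\<^bsub>A\<^esub> c)"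
      using fam_leD[OF le] bc x y by (intro star_leD[OF C'(2)]) auto
    show "x \<otimes> y \<in> char_kernel C Y \<kappa> (b \<oplus>\<^bsub>A\<^esub> c)"
    proof (cases "b \<in> Y \<and> \<kappa> b = 0 \<and> c \<in> Y \<and> \<kappa> c = 0")
      case True
      show ?thesis
      proof (cases "b \<oplus>\<^bsub>A\<^esub> c \<in> Y")
        case in_Y: True
        then have "\<kappa> (b \<oplus>\<^bsub>A\<^esub> c) = 0" using \<kappa> True by (auto simp: partial_character_def)
        then show ?thesis using in_Y xyC by (simp add: char_kernel_def)
      next
        case False
        then have "x \<otimes> y = \<zero>" using C xyC bc by (auto simp: arith_graded_def)
        then show ?thesis using family_zero[OF fam] bc by simp
      qed
    next
      case False
      then have "x = \<zero> \<or> y = \<zero>" using x y by (auto simp: char_kernel_def split: if_splits)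
      then have "x \<otimes> y = \<zero>" using xy bracket_zero_left bracket_zero_right by auto
      then show ?thesis using family_zero[OF fam] bc by simp
    qed
  qed
  then show "arith_graded (char_kernel C Y \<kappa>) {b \<in> Y. \<kappa> b = 0}"
    unfolding arith_graded_def using fam C'(4) arith_free_subset[OF C'(5)]
    by (auto simp: char_kernel_def)
qed

lemma arith_graded_solvable:
  assumes "arith_graded C Y" "card Y \<le> n"
  shows "zero_fam (der C (solvability_bound n))"
  using assms
proof (induct n arbitrary: C Y)
  case 0
  then show ?case by (auto simp: arith_graded_def zero_fam_def)
next
  case (Suc n)
  have C: "family C" "C \<star> C \<sqsubseteq> C" "Y \<subseteq> carrier A" "finite Y" "arith_free A Y"
    using Suc by (auto simp: arith_graded_def arith_free_def)
  show ?case
  proof (cases "Y = {}")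
    case True
    then have "zero_fam C" using Suc by (auto simp: arith_graded_def zero_fam_def)
    then show ?thesis using zero_fam_le[OF der_le[OF C(1,2)]] by blast
  next
    case False
    then obtain y0 where "y0 \<in> Y" by blast
    moreover have "y0 \<noteq> \<zero>\<^bsub>A\<^esub>" using calculation arith_free_nonzero C by blast
    ultimately have "\<exists>N \<kappa>. partial_character Y N \<kappa> \<and> (\<exists>y\<in>Y. \<kappa> y \<noteq> 0)"
      using comm_group.partial_character_exists[OF grp.a_comm_group, of Y y0] C
      by (simp add: partial_character_def) metis
    then obtain N \<kappa> y where \<kappa>: "partial_character Y N \<kappa>" and y: "y \<in> Y" "\<kappa> y \<noteq> 0" by blast
    let ?K = "char_kernel C Y \<kappa>" and ?s = "solvability_bound n"
    let ?m = "(Suc n * Suc n + 1) ^ ?s"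
    note K = char_kernel_arith_graded[OF Suc.prems(1) \<kappa>]
    have K': "family ?K" "?K \<star> ?K \<sqsubseteq> ?K" using K(1) by (auto simp: arith_graded_def)
    \<comment> \<open>A value of \<kappa> different from zero on \<open>Y\<close> makes the support
      of the kernel strictly smaller.\<close>
    have "y \<in> Y - {b \<in> Y. \<kappa> b = 0}" using y by simp
    then have "{b \<in> Y. \<kappa> b = 0} \<subset> Y" by blast
    from psubset_card_mono[OF C(4) this] Suc.prems(2) have "card {b \<in> Y. \<kappa> b = 0} \<le> n" by linarith
    then have zK: "zero_fam (der ?K ?s)" using Suc.hyps K(1) by blast
    then have "zero_fam (act C ?K ?m)"
      using solvable_acts_nilpotently[OF Suc.prems K'(1) K(2) K'(2)] by blast
    then have "der C ((?m + 1) ^ Suc n) \<sqsubseteq> ?K"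
      using derived_le_char_kernel[OF Suc.prems(1) \<kappa> _ Suc.prems(2)] by blast
    then have "der C ((?m + 1) ^ Suc n + ?s) \<sqsubseteq> der ?K ?s"
      unfolding der_add using K' by (intro der_mono)
    then show ?thesis using zK zero_fam_le by simp
  qed
qed

lemma arith_graded_act_zero:
  assumes "arith_graded C Y" "card Y \<le> n"
  shows "zero_fam (act C C ((n * n + 1) ^ solvability_bound n))"
  using assms arith_graded_solvable[OF assms]
  by (intro solvable_acts_nilpotently[OF assms]) (auto simp: arith_graded_def fam_le_refl)

text \<open>Additivity in both arguments reduces the brackets to homogeneous ones.\<close>

lemma lower_central_le_act:
  assumes C: "family C" and L: "carrier L = gen (\<Union>a\<in>carrier A. C a)"
  shows "lower_central L i \<subseteq> gen (\<Union>a\<in>carrier A. act C C i a)"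
proof (induct i)
  case 0
  then show ?case using L by simp
next
  case (Suc i)
  let ?U = "\<lambda>i. \<Union>a\<in>carrier A. act C C i a"
  have sub: "?U i \<subseteq> carrier L" for i using family_carrier[OF family_act[OF C C]] by blast
  note cl = add_closed_gen[OF sub]
  have "x \<otimes> y \<in> gen (?U (Suc i))" if x: "x \<in> gen (?U i)" and y: "y \<in> carrier L" for x y
  proof (rule gen_bracket_left[OF cl y sub _ x])
    fix u assume u: "u \<in> ?U i"
    then obtain a where a: "a \<in> carrier A" "u \<in> act C C i a" by blast
    have uL: "u \<in> carrier L" using u sub by blast
    have y': "y \<in> gen (?U 0)" using y L by simp
    show "u \<otimes> y \<in> gen (?U (Suc i))"
    proof (rule gen_bracket_right[OF cl uL sub _ y'])
      fix v assume "v \<in> ?U 0"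
      then obtain b where b: "b \<in> carrier A" "v \<in> C b" by auto
      have "u \<otimes> v \<in> act C C (Suc i) (a \<oplus>\<^bsub>A\<^esub> b)" using a b by (auto intro: starI)
      then show "u \<otimes> v \<in> gen (?U (Suc i))" using a b by (intro generate.incl) blast
    qed
  qed
  then have "{x \<otimes> y |x y. x \<in> lower_central L i \<and> y \<in> carrier L} \<subseteq> gen (?U (Suc i))"
    using Suc by blast
  then show ?case using gen_least[OF _ cl[of "Suc i"]] by simp
qed

lemma lower_central_bounds:
  shows "add_closed (lower_central L i)" "lower_central L (Suc i) \<subseteq> lower_central L i"
proof -
  have cl: "add_closed (lower_central L i)" for i
  proof (induct i)
    case (Suc i)
    then show ?case using bracket_closed by (auto simp: add_closed_def intro!: add_closed_gen[unfolded add_closed_def])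
  qed (auto simp: add_closed_def)
  then show "add_closed (lower_central L i)" .
  show "lower_central L (Suc i) \<subseteq> lower_central L i"
  proof (induct i)
    case 0
    then show ?case using cl[of "Suc 0"] by (auto simp: add_closed_def)
  next
    case (Suc i)
    have "{x \<otimes> y |x y. x \<in> lower_central L (Suc i) \<and> y \<in> carrier L} \<subseteq>
      lower_central L (Suc i)" using Suc by (auto intro!: generate.incl)
    then show ?case using gen_least[OF _ cl[of "Suc i"]] by auto
  qed
qed

end

lemma (in graded_lie_ring) lower_central_zero:
  assumes "arith_free A S" "finite S" "card S \<le> n" "grading_support A L C \<subseteq> S"
  shows "lower_central L ((n * n + 1) ^ solvability_bound n) = {\<zero>}"
proof -
  interpret D: lie_ring_degrees A L ..
  have fam: "D.family C"
    using component_subgroup add_closed_additive_subgroup by (auto simp: D.family_def)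
  have "D.fam_le (D.star C C) C"
    using bracket_component by (intro D.star_le fam)
  then have "D.arith_graded C S"
    unfolding D.arith_graded_def using fam assms by (auto simp: grading_support_def)
  then have z: "D.zero_fam (D.act C C ((n * n + 1) ^ solvability_bound n))"
    using assms by (intro D.arith_graded_act_zero)
  have sub: "(\<Union>a\<in>carrier A. C a) \<subseteq> carrier L" using D.family_carrier[OF fam] by blast
  have "carrier L \<subseteq> gen (\<Union>a\<in>carrier A. C a)"
  proof
    fix x assume x: "x \<in> carrier L"
    obtain f where f: "f \<in> (\<Pi>\<^sub>E a\<in>carrier A. C a)" "x = (\<Oplus>a\<in>{a \<in> carrier A. f a \<noteq> \<zero>}. f a)"
      using ex1_implies_ex[OF direct_sum[OF x]] by blast
    have cl: "add_closed (gen (\<Union>a\<in>carrier A. C a))" using add_closed_gen[OF sub] .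
    have "(\<Oplus>a\<in>T. f a) \<in> gen (\<Union>a\<in>carrier A. C a)" if "T \<subseteq> carrier A" for T
      using that
    proof (induct T rule: infinite_finite_induct)
      case (insert a T)
      have "f \<in> T \<rightarrow> carrier L" "f a \<in> carrier L" using insert f sub by auto
      then have "(\<Oplus>a\<in>insert a T. f a) = f a \<oplus> (\<Oplus>a\<in>T. f a)" using insert by simp
      moreover have "f a \<in> gen (\<Union>a\<in>carrier A. C a)" using insert f by (intro generate.incl) auto
      ultimately show ?case using insert cl by (auto simp: add_closed_def)
    qed (use cl in \<open>auto simp: add_closed_def finsum_infinite\<close>)
    then show "x \<in> gen (\<Union>a\<in>carrier A. C a)" using f(2) by auto
  qed
  then have "carrier L = gen (\<Union>a\<in>carrier A. C a)" using add_closed_gen[OF sub] by (auto simp: add_closed_def)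
  then have le: "lower_central L ((n * n + 1) ^ solvability_bound n) \<subseteq>
      gen (\<Union>a\<in>carrier A. D.act C C ((n * n + 1) ^ solvability_bound n) a)"
    by (rule D.lower_central_le_act[OF fam])
  have "(\<Union>a\<in>carrier A. D.act C C ((n * n + 1) ^ solvability_bound n) a) \<subseteq> {\<zero>}"
    using z by (auto simp: D.zero_fam_def)
  from gen_least[OF this add_closed_zero] le
  show ?thesis using D.lower_central_bounds(1) by (auto simp: add_closed_def)
qed

text \<open>The explicit bound shows that the set minimised in \<open>higman\<close> is nonempty, so
  the minimum has the defining property. As the lower central series decreases, it vanishes at index
  \<open>higman\<close> and not only at the class itself.\<close>

lemma higman_bound:
  fixes L :: "'a ring" and A :: "'b ring"
  assumes "graded_lie_ring A L C" "arith_free A S" "finite S" "card S \<le> n" "grading_support A L C \<subseteq> S"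
  shows "lower_central L (higman TYPE('a) TYPE('b) n) = {\<zero>\<^bsub>L\<^esub>}"
proof -
  define P where "P N \<longleftrightarrow> (\<forall>(L :: 'a ring) (A :: 'b ring) C S.
       graded_lie_ring A L C \<and> arith_free A S \<and> finite S \<and> card S \<le> n \<and>
       grading_support A L C \<subseteq> S \<longrightarrow> lie_nilpotent L \<and> nilpotency_class L \<le> N)" for N
  have "P ((n * n + 1) ^ solvability_bound n)"
    unfolding P_def
  proof (intro allI impI, elim conjE)
    fix L :: "'a ring" and A :: "'b ring" and C S
    assume "graded_lie_ring A L C" "arith_free A S" "finite S" "card S \<le> n" "grading_support A L C \<subseteq> S"
    then have "lower_central L ((n * n + 1) ^ solvability_bound n) = {\<zero>\<^bsub>L\<^esub>}"
      by (rule graded_lie_ring.lower_central_zero)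
    then show "lie_nilpotent L \<and> nilpotency_class L \<le> (n * n + 1) ^ solvability_bound n"
      unfolding lie_nilpotent_def nilpotency_class_def by (intro conjI exI Least_le)
  qed
  then have "P (LEAST N. P N)" by (rule LeastI)
  then have "P (higman TYPE('a) TYPE('b) n)" unfolding higman_def P_def .
  then have *: "lie_nilpotent L \<and> nilpotency_class L \<le> higman TYPE('a) TYPE('b) n"
    using assms unfolding P_def by metis
  interpret graded_lie_ring A L C by fact
  interpret D: lie_ring_degrees A L ..
  obtain c where "lower_central L c = {\<zero>\<^bsub>L\<^esub>}" using * unfolding lie_nilpotent_def by blast
  then have z: "lower_central L (nilpotency_class L) = {\<zero>\<^bsub>L\<^esub>}"
    unfolding nilpotency_class_def by (rule LeastI)
  have "lower_central L m \<subseteq> lower_central L (nilpotency_class L)" if "nilpotency_class L \<le> m" for m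
    using that
  proof (induct m rule: dec_induct)
    case (step m)
    then show ?case using D.lower_central_bounds(2)[of m] by order
  qed simp
  then have "lower_central L (higman TYPE('a) TYPE('b) n) \<subseteq> {\<zero>\<^bsub>L\<^esub>}" using * z by blast
  moreover have "\<zero>\<^bsub>L\<^esub> \<in> lower_central L (higman TYPE('a) TYPE('b) n)"
    using D.lower_central_bounds(1) unfolding add_closed_def by blast
  ultimately show ?thesis by blast
qed

section \<open>Graded Lie rings on arbitrary types\<close>

text \<open>One sequence of binary operations covers subtraction, bracket and all projections at
  once; a unary operation ignores its second argument.\<close>

lemma countable_closure:
  fixes ops :: "nat \<Rightarrow> 'v \<Rightarrow> 'v \<Rightarrow> 'v"
  assumes "countable B" "B \<subseteq> G" "\<And>i x y. x \<in> G \<Longrightarrow> y \<in> G \<Longrightarrow> ops i x y \<in> G"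
  obtains M where "countable M" "B \<subseteq> M" "M \<subseteq> G" "\<And>i x y. x \<in> M \<Longrightarrow> y \<in> M \<Longrightarrow> ops i x y \<in> M"
proof -
  define step where "step N = N \<union> (\<Union>i. (\<lambda>(x, y). ops i x y) ` (N \<times> N))" for N
  define M where "M n = (step ^^ n) B" for n
  have M_Suc: "M (Suc n) = step (M n)" for n by (simp add: M_def)
  have mono: "M m \<subseteq> M n" if "m \<le> n" for m n
    using that by (induct n rule: dec_induct) (auto simp: M_Suc step_def)
  have count: "countable (M n)" for n
    by (induct n) (use assms in \<open>auto simp: M_def step_def\<close>)
  have "step N \<subseteq> G" if "N \<subseteq> G" for N using that assms(3) by (auto simp: step_def subset_iff)
  then have sub: "M n \<subseteq> G" for n
    by (induct n) (use assms in \<open>auto simp: M_def\<close>)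
  have closed: "ops i x y \<in> (\<Union>n. M n)" if xy: "x \<in> (\<Union>n. M n)" "y \<in> (\<Union>n. M n)" for i x y
  proof -
    obtain m n where "x \<in> M m" "y \<in> M n" using xy by auto
    then have "x \<in> M (max m n)" "y \<in> M (max m n)" using mono[of m "max m n"] mono[of n "max m n"] by auto
    then have "ops i x y \<in> M (Suc (max m n))" unfolding M_Suc step_def by force
    then show ?thesis by blast
  qed
  have "B = M 0" by (simp add: M_def)
  then have "B \<subseteq> (\<Union>n. M n)" by blast
  then show ?thesis
    by (intro that[of "\<Union>n. M n"]) (use count sub closed in auto)
qed

lemma countable_embedding:
  assumes "countable M" "infinite (UNIV :: 'l set)"
  obtains h :: "'v \<Rightarrow> 'l" where "inj_on h M"
proof -
  obtain f :: "nat \<Rightarrow> 'l" where "inj f" using infinite_countable_subset assms(2) by blast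
  then have "inj_on (f \<circ> to_nat_on M) M"
    using assms(1) by (intro comp_inj_on) (auto intro: inj_on_subset)
  then show ?thesis by (rule that)
qed

text \<open>Type-class counterpart of a graded Lie ring on a subset of a type, with degrees in the
  additive group of a ring. This is the shape in which eigenspaces arise.\<close>

locale graded_bracket =
  fixes br :: "'v::ab_group_add \<Rightarrow> 'v \<Rightarrow> 'v" and G :: "'v set"
    and E :: "'c::comm_ring_1 \<Rightarrow> 'v set" and S :: "'c set"
  assumes G_zero: "0 \<in> G" and G_diff: "x \<in> G \<Longrightarrow> y \<in> G \<Longrightarrow> x - y \<in> G"
    and br_closed: "x \<in> G \<Longrightarrow> y \<in> G \<Longrightarrow> br x y \<in> G"
    and br_add_left: "x \<in> G \<Longrightarrow> y \<in> G \<Longrightarrow> z \<in> G \<Longrightarrow> br (x + y) z = br x z + br y z"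
    and br_add_right: "x \<in> G \<Longrightarrow> y \<in> G \<Longrightarrow> z \<in> G \<Longrightarrow> br z (x + y) = br z x + br z y"
    and br_self: "x \<in> G \<Longrightarrow> br x x = 0"
    and br_jacobi: "x \<in> G \<Longrightarrow> y \<in> G \<Longrightarrow> z \<in> G \<Longrightarrow> br x (br y z) + br y (br z x) + br z (br x y) = 0"
    and E_sub: "E a \<subseteq> G" and E_zero: "0 \<in> E a"
    and E_diff: "x \<in> E a \<Longrightarrow> y \<in> E a \<Longrightarrow> x - y \<in> E a"
    and E_br: "x \<in> E a \<Longrightarrow> y \<in> E b \<Longrightarrow> br x y \<in> E (a + b)"
    and E_trivial: "a \<notin> S \<Longrightarrow> E a = {0}"
    and S_finite: "finite S"
    and decomp: "x \<in> G \<Longrightarrow> \<exists>f. (\<forall>a\<in>S. f a \<in> E a) \<and> x = (\<Sum>a\<in>S. f a)"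
    and indep: "(\<And>a. a \<in> S \<Longrightarrow> f a \<in> E a) \<Longrightarrow> (\<Sum>a\<in>S. f a) = 0 \<Longrightarrow> a \<in> S \<Longrightarrow> f a = 0"
    and S_arith_free: "\<alpha> \<in> S \<Longrightarrow> \<beta> \<in> S \<Longrightarrow> \<exists>k::nat. \<alpha> + of_nat k * \<beta> \<notin> S"
begin

text \<open>The chosen decomposition depends on \<open>x\<close> alone and not on \<open>a\<close>,
  so the projections of \<open>x\<close> add up to \<open>x\<close>.\<close>

definition proj :: "'c \<Rightarrow> 'v \<Rightarrow> 'v" where
  "proj a x = (SOME f. (\<forall>a\<in>S. f a \<in> E a) \<and> x = (\<Sum>a\<in>S. f a)) a"

lemma proj:
  assumes "x \<in> G" shows "a \<in> S \<Longrightarrow> proj a x \<in> E a" "x = (\<Sum>a\<in>S. proj a x)"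
  using someI_ex[OF decomp[OF assms]] unfolding proj_def by auto

text \<open>The elements of a word and their homogeneous components generate a countable graded subring,
  and this subring can be copied onto a subset of any infinite type.\<close>

lemma word_vanishes:
  assumes inf: "infinite (UNIV :: 'l set)" "infinite (UNIV :: 'b set)" and n: "card S \<le> n"
    and x: "x0 \<in> G" and xs: "set xs \<subseteq> G" "length xs = higman TYPE('l) TYPE('b) n"
  shows "foldl br x0 xs = 0"
proof -
  \<comment> \<open>Subtraction together with zero yields the additive group; from index
    \<open>2\<close> on come the projections, enumerated through \<open>S\<close>. The test for
    empty \<open>S\<close> is there because \<open>from_nat_into\<close> needs a nonempty
    set.\<close>
  define ops where "ops i = (if i = 0 then (-) else if i = 1 then br else
    (\<lambda>x y. if S = {} then x else proj (from_nat_into S (i - 2)) x))" for i :: nat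
  have projG: "proj a x \<in> G" if "x \<in> G" "a \<in> S" for a x using proj(1)[OF that] E_sub by blast
  have "ops i x y \<in> G" if "x \<in> G" "y \<in> G" for i x y
    using that G_diff br_closed projG from_nat_into[of S] by (auto simp: ops_def)
  moreover have "countable (insert 0 (insert x0 (set xs)))" "insert 0 (insert x0 (set xs)) \<subseteq> G"
    using G_zero x xs by (auto intro: countable_finite)
  ultimately obtain M where M: "countable M" "insert 0 (insert x0 (set xs)) \<subseteq> M" "M \<subseteq> G"
    "\<And>i x y. x \<in> M \<Longrightarrow> y \<in> M \<Longrightarrow> ops i x y \<in> M"
    using countable_closure[of "insert 0 (insert x0 (set xs))" G ops] by metis
  have M0: "0 \<in> M" using M by auto
  have Md: "x - y \<in> M" if "x \<in> M" "y \<in> M" for x y using M(4)[OF that, of 0] by (simp add: ops_def)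
  have Mm: "- x \<in> M" if "x \<in> M" for x using Md[OF M0 that] by simp
  have Ma: "x + y \<in> M" if "x \<in> M" "y \<in> M" for x y using Md[OF that(1) Mm[OF that(2)]] by simp
  have Mb: "br x y \<in> M" if "x \<in> M" "y \<in> M" for x y using M(4)[OF that, of 1] by (simp add: ops_def)
  have Mp: "proj a x \<in> M" if a: "x \<in> M" "a \<in> S" for a x
  proof -
    obtain i where "a = from_nat_into S i"
      using a(2) from_nat_into_surj[of S a] countable_finite[OF S_finite] by metis
    then show ?thesis using M(4)[OF a(1) a(1), of "i + 2"] a(2) by (auto simp: ops_def split: if_splits)
  qed
  have MG: "x \<in> G" if "x \<in> M" for x using M that by blast
  \<comment> \<open>The degrees have to be copied as well, so \<open>S\<close> is enclosed in a
    countable subgroup of the grading group.\<close>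
  obtain D :: "'c set" where D: "countable D" "insert 0 S \<subseteq> D" "\<And>x y. x \<in> D \<Longrightarrow> y \<in> D \<Longrightarrow> x - y \<in> D"
    using countable_closure[of "insert 0 S" UNIV "\<lambda>_. (-)"] countable_finite[OF S_finite] by (metis countable_insert subset_UNIV UNIV_I)
  have D0: "0 \<in> D" and SD: "S \<subseteq> D" using D by auto
  have Dm: "- x \<in> D" if "x \<in> D" for x using D(3)[OF D0 that] by simp
  have Da: "x + y \<in> D" if "x \<in> D" "y \<in> D" for x y using D(3)[OF that(1) Dm[OF that(2)]] by simp
  obtain h :: "'v \<Rightarrow> 'l" where h: "inj_on h M" using countable_embedding[OF M(1) inf(1)] .
  obtain k :: "'c \<Rightarrow> 'b" where k: "inj_on k D" using countable_embedding[OF D(1) inf(2)] .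
  define g where "g = the_inv_into M h"
  define j where "j = the_inv_into D k"
  have gh [simp]: "g (h x) = x" if "x \<in> M" for x using the_inv_into_f_f[OF h that] by (simp add: g_def)
  have jk [simp]: "j (k x) = x" if "x \<in> D" for x using the_inv_into_f_f[OF k that] by (simp add: j_def)
  have h_eq [simp]: "h x = h y \<longleftrightarrow> x = y" if "x \<in> M" "y \<in> M" for x y using inj_onD[OF h] that by blast
  have k_eq [simp]: "k x = k y \<longleftrightarrow> x = y" if "x \<in> D" "y \<in> D" for x y using inj_onD[OF k] that by blast
  define L :: "'l ring" where "L = \<lparr>carrier = h ` M, monoid.mult = (\<lambda>x y. h (br (g x) (g y))), one = h 0,
    ring.zero = h 0, add = (\<lambda>x y. h (g x + g y))\<rparr>"
  define A :: "'b ring" where "A = \<lparr>carrier = k ` D, monoid.mult = (\<lambda>x y. x), one = k 0,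
    ring.zero = k 0, add = (\<lambda>x y. k (j x + j y))\<rparr>"
  define C where "C b = h ` (M \<inter> E (j b))" for b
  have L [simp]: "carrier L = h ` M" "\<zero>\<^bsub>L\<^esub> = h 0" "x \<otimes>\<^bsub>L\<^esub> y = h (br (g x) (g y))" "x \<oplus>\<^bsub>L\<^esub> y = h (g x + g y)" for x y
    by (auto simp: L_def)
  have A [simp]: "carrier A = k ` D" "\<zero>\<^bsub>A\<^esub> = k 0" "x \<oplus>\<^bsub>A\<^esub> y = k (j x + j y)" for x y
    by (auto simp: A_def)
  have Di: "\<exists>y\<in>D. x + y = 0" if "x \<in> D" for x by (rule bexI[of _ "- x"]) (use Dm[OF that] in auto)
  have Mi: "\<exists>y\<in>M. x + y = 0" if "x \<in> M" for x by (rule bexI[of _ "- x"]) (use Mm[OF that] in auto)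
  interpret A: abelian_group A
    by (rule abelian_groupI) (use D0 Da Di in \<open>auto simp: add_ac\<close>)
  interpret L: abelian_group L
    by (rule abelian_groupI) (use M0 Ma Mi in \<open>auto simp: add_ac\<close>)
  interpret L: lie_ring L
    by unfold_locales
      (use MG Ma Mb M0 br_add_left br_add_right br_self br_jacobi in \<open>auto\<close>)
  have neg: "\<ominus>\<^bsub>L\<^esub> h x = h (- x)" if "x \<in> M" for x
    using that Mm M0 by (intro L.minus_equality) auto
  have finsum: "F \<in> T \<rightarrow> h ` M \<Longrightarrow> (\<Oplus>\<^bsub>L\<^esub>a\<in>T. F a) = h (\<Sum>a\<in>T. g (F a)) \<and> (\<Sum>a\<in>T. g (F a)) \<in> M"
    if "finite T" for T and F :: "'b \<Rightarrow> 'l"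
    using that
  proof (induct T)
    case (insert a T)
    then have Fa: "F a \<in> h ` M" and FT: "F \<in> T \<rightarrow> h ` M" by auto
    then have "(\<Oplus>\<^bsub>L\<^esub>a\<in>insert a T. F a) = F a \<oplus>\<^bsub>L\<^esub> (\<Oplus>\<^bsub>L\<^esub>a\<in>T. F a)"
      using insert by (intro L.finsum_insert) auto
    then show ?case using insert Fa FT Ma by auto
  qed (use M0 in auto)
  have kS: "j ` (k ` S) = S" "k ` S \<subseteq> k ` D" "inj_on k S" using SD inj_on_subset[OF k] by (force simp: image_image)+
  have graded: "graded_lie_ring A L C"
  proof (intro graded_lie_ring.intro graded_lie_ring_axioms.intro)
    show "abelian_group A" "lie_ring L" by (fact A.abelian_group_axioms L.lie_ring_axioms)+
  next
    fix b assume "b \<in> carrier A"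
    show "additive_subgroup (C b) L"
    proof
      show "C b \<subseteq> carrier (add_monoid L)" by (auto simp: C_def)
      show "\<one>\<^bsub>add_monoid L\<^esub> \<in> C b" using M0 E_zero by (auto simp: C_def)
      fix x assume "x \<in> C b"
      then obtain u where u: "x = h u" "u \<in> M" "u \<in> E (j b)" by (auto simp: C_def)
      have Em: "- v \<in> E (j b)" if "v \<in> E (j b)" for v using E_diff[OF E_zero that] by simp
      show "inv\<^bsub>add_monoid L\<^esub> x \<in> C b"
        using neg[OF u(2)] u Mm Em by (auto simp: C_def a_inv_def)
      fix y assume "y \<in> C b"
      then obtain v where v: "y = h v" "v \<in> M" "v \<in> E (j b)" by (auto simp: C_def)
      have "u + v \<in> E (j b)" using E_diff[OF u(3) Em[OF v(3)]] by simp
      then show "x \<otimes>\<^bsub>add_monoid L\<^esub> y \<in> C b" using u v Ma by (auto simp: C_def)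
    qed
  next
    fix a b x y
    assume ab: "a \<in> carrier A" "b \<in> carrier A" "x \<in> C a" "y \<in> C b"
    then obtain u v where "x = h u" "u \<in> M" "u \<in> E (j a)" "y = h v" "v \<in> M" "v \<in> E (j b)"
      by (auto simp: C_def)
    then show "x \<otimes>\<^bsub>L\<^esub> y \<in> C (a \<oplus>\<^bsub>A\<^esub> b)"
      using ab E_br Mb Da by (auto simp: C_def)
  next
    fix x assume "x \<in> carrier L"
    then obtain u where u: "x = h u" "u \<in> M" by auto
    define f where "f = (\<lambda>b\<in>carrier A. h (if j b \<in> S then proj (j b) u else 0))"
    \<comment> \<open>Any admissible family is supported on the image of \<open>S\<close>, so its
      sum pulls back to a sum over \<open>S\<close>. Both existence and uniqueness of the
      decomposition rest on this.\<close>
    have total: "(\<Oplus>\<^bsub>L\<^esub>b\<in>{b \<in> carrier A. f b \<noteq> \<zero>\<^bsub>L\<^esub>}. f b) = h (\<Sum>a\<in>S. g (f (k a)))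
        \<and> finite {b \<in> carrier A. f b \<noteq> \<zero>\<^bsub>L\<^esub>} \<and> (\<forall>a\<in>S. g (f (k a)) \<in> M \<inter> E a) \<and> (\<Sum>a\<in>S. g (f (k a))) \<in> M"
      if f: "f \<in> (\<Pi>\<^sub>E b\<in>carrier A. C b)" for f
    proof -
      let ?T = "{b \<in> carrier A. f b \<noteq> \<zero>\<^bsub>L\<^esub>}"
      have TS: "?T \<subseteq> k ` S"
      proof
        fix b assume b: "b \<in> ?T"
        then have "f b \<in> C b" using f by auto
        then have "j b \<in> S" using b E_trivial[of "j b"] by (cases "j b \<in> S") (auto simp: C_def)
        moreover have "k (j b) = b" using b by auto
        ultimately show "b \<in> k ` S" by force
      qed
      then have fin: "finite ?T" using S_finite finite_subset by blast
      have fC: "f b \<in> h ` (M \<inter> E (j b))" if "b \<in> k ` D" for b using f that by (auto simp: C_def)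
      then have fM: "f \<in> k ` D \<rightarrow> h ` M" by blast
      have "(\<Oplus>\<^bsub>L\<^esub>b\<in>?T. f b) = h (\<Sum>b\<in>?T. g (f b)) \<and> (\<Sum>b\<in>?T. g (f b)) \<in> M"
        using fM by (intro finsum[OF fin]) auto
      moreover have "(\<Sum>b\<in>?T. g (f b)) = (\<Sum>b\<in>k ` S. g (f b))"
        using TS S_finite kS(2) M0 by (intro sum.mono_neutral_left) auto
      moreover have "\<dots> = (\<Sum>a\<in>S. g (f (k a)))" using kS by (simp add: sum.reindex)
      moreover have "g (f (k a)) \<in> M \<inter> E a" if "a \<in> S" for a
      proof -
        have aD: "a \<in> D" using that SD by blast
        then have "f (k a) \<in> h ` (M \<inter> E a)" using fC[of "k a"] by simp
        then show ?thesis by auto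
      qed
      ultimately show ?thesis using fin by simp
    qed
    have fE: "f \<in> (\<Pi>\<^sub>E b\<in>carrier A. C b)"
      using proj(1)[OF MG[OF u(2)]] Mp[OF u(2)] M0 E_zero by (auto simp: f_def C_def)
    have "(\<Sum>a\<in>S. g (f (k a))) = (\<Sum>a\<in>S. proj a u)"
      using SD Mp[OF u(2)] by (intro sum.cong) (auto simp: f_def)
    then have fsum: "(\<Sum>a\<in>S. g (f (k a))) = u" using proj(2)[OF MG[OF u(2)]] by simp
    show "\<exists>!f. f \<in> (\<Pi>\<^sub>E a\<in>carrier A. C a) \<and> finite {a \<in> carrier A. f a \<noteq> \<zero>\<^bsub>L\<^esub>} \<and>
           x = (\<Oplus>\<^bsub>L\<^esub>a\<in>{a \<in> carrier A. f a \<noteq> \<zero>\<^bsub>L\<^esub>}. f a)"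
    proof (rule ex1I[of _ f])
      show "f \<in> (\<Pi>\<^sub>E a\<in>carrier A. C a) \<and> finite {a \<in> carrier A. f a \<noteq> \<zero>\<^bsub>L\<^esub>} \<and>
           x = (\<Oplus>\<^bsub>L\<^esub>a\<in>{a \<in> carrier A. f a \<noteq> \<zero>\<^bsub>L\<^esub>}. f a)"
        using total[OF fE] fsum fE u by simp
      fix f' assume f': "f' \<in> (\<Pi>\<^sub>E a\<in>carrier A. C a) \<and> finite {a \<in> carrier A. f' a \<noteq> \<zero>\<^bsub>L\<^esub>} \<and>
           x = (\<Oplus>\<^bsub>L\<^esub>a\<in>{a \<in> carrier A. f' a \<noteq> \<zero>\<^bsub>L\<^esub>}. f' a)"
      then have f'E: "f' \<in> (\<Pi>\<^sub>E b\<in>carrier A. C b)" by blast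
      have "h (\<Sum>a\<in>S. g (f' (k a))) = h u" using total[OF f'E] f' u by simp
      then have f'sum: "(\<Sum>a\<in>S. g (f' (k a))) = u" using total[OF f'E] u(2) by simp
      have diff0: "(\<Sum>a\<in>S. g (f' (k a)) - g (f (k a))) = 0" using f'sum fsum by (simp add: sum_subtractf)
      have eqg: "g (f' (k a)) - g (f (k a)) = 0" if "a \<in> S" for a
        by (rule indep[OF _ diff0 that]) (use total[OF f'E] total[OF fE] E_diff in blast)
      show "f' = f"
      proof (rule PiE_ext[OF f'E fE])
        fix b assume b: "b \<in> carrier A"
        then obtain c where c: "b = k c" "c \<in> D" by auto
        obtain v v' where v: "f b = h v" "v \<in> M \<inter> E c" "f' b = h v'" "v' \<in> M \<inter> E c"
          using PiE_mem[OF fE b] PiE_mem[OF f'E b] c by (auto simp: C_def)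
        show "f' b = f b"
        proof (cases "c \<in> S")
          case True
          then show ?thesis using eqg[of c] v c by auto
        next
          case False
          then show ?thesis using v E_trivial[of c] by auto
        qed
      qed
    qed
  qed
  have pow: "add_pow A m (k b) = k (of_nat m * b) \<and> of_nat m * b \<in> D" if "b \<in> D" for m :: nat and b
    by (induct m) (use that D0 Da in \<open>auto simp: add_pow_def nat_pow_def algebra_simps\<close>)
  have "arith_free A (k ` S)"
    unfolding arith_free_def
  proof (intro conjI notI)
    show "k ` S \<subseteq> carrier A" using SD by auto
    assume "\<exists>\<alpha>\<in>k ` S. \<exists>\<beta>\<in>k ` S. \<forall>m::nat. \<alpha> \<oplus>\<^bsub>A\<^esub> add_pow A m \<beta> \<in> k ` S"
    then obtain a b where ab: "a \<in> S" "b \<in> S" "\<And>m::nat. k a \<oplus>\<^bsub>A\<^esub> add_pow A m (k b) \<in> k ` S" by auto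
    then have D': "a \<in> D" "b \<in> D" using SD by auto
    obtain m :: nat where m: "a + of_nat m * b \<notin> S" using S_arith_free ab by blast
    have "k (a + of_nat m * b) \<in> k ` S" using ab(3)[of m] pow[OF D'(2), of m] D' by simp
    then show False using m pow[OF D'(2), of m] D' Da SD by (auto simp: image_iff)
  qed
  moreover have "grading_support A L C \<subseteq> k ` S"
  proof
    fix b assume b: "b \<in> grading_support A L C"
    then obtain c where c: "b = k c" "c \<in> D" by (auto simp: grading_support_def)
    have "c \<in> S"
    proof (rule ccontr)
      assume "c \<notin> S"
      then have "C b = {h 0}" using c E_trivial[of c] M0 by (auto simp: C_def)
      then show False using b by (simp add: grading_support_def)
    qed
    then show "b \<in> k ` S" using c by simp
  qed
  moreover have "card (k ` S) \<le> n" using n kS(3) by (simp add: card_image)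
  ultimately have zero: "lower_central L (length xs) = {h 0}"
    using higman_bound[OF graded] S_finite xs(2) by simp
  \<comment> \<open>The copy of a word lies in the lower central term indexed by its length, which
    is zero; injectivity of \<open>h\<close> carries this back to the original word.\<close>
  have "set ys \<subseteq> M \<Longrightarrow> foldl br x0 ys \<in> M \<and> h (foldl br x0 ys) \<in> lower_central L (length ys)" for ys
  proof (induct ys rule: rev_induct)
    case Nil
    then show ?case using M by auto
  next
    case (snoc y ys)
    then have IH: "foldl br x0 ys \<in> M" "h (foldl br x0 ys) \<in> lower_central L (length ys)" "y \<in> M" by auto
    have "h (foldl br x0 ys) \<otimes>\<^bsub>L\<^esub> h y \<in> lower_central L (length (ys @ [y]))"
      using IH by (auto simp del: L(3) intro!: generate.incl)
    then show ?case using IH Mb by simp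
  qed
  from this[of xs] zero M(2) M0 show ?thesis by auto
qed

end

section \<open>Generalised eigenspaces of a derivation\<close>

text \<open>All laws are relative to \<open>G\<close>, because the scalar extension will be a subset
  of a function space.\<close>

locale derivation_space = vector_space sc
  for sc :: "'F::field \<Rightarrow> 'v::ab_group_add \<Rightarrow> 'v" (infixr "\<cdot>" 75) +
  fixes G :: "'v set" and \<delta> :: "'v \<Rightarrow> 'v" and br :: "'v \<Rightarrow> 'v \<Rightarrow> 'v"
  assumes G_zero: "0 \<in> G" and G_add: "x \<in> G \<Longrightarrow> y \<in> G \<Longrightarrow> x + y \<in> G"
    and G_scale: "x \<in> G \<Longrightarrow> c \<cdot> x \<in> G"
    and \<delta>_closed: "x \<in> G \<Longrightarrow> \<delta> x \<in> G"
    and \<delta>_add: "x \<in> G \<Longrightarrow> y \<in> G \<Longrightarrow> \<delta> (x + y) = \<delta> x + \<delta> y"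
    and \<delta>_scale: "x \<in> G \<Longrightarrow> \<delta> (c \<cdot> x) = c \<cdot> \<delta> x"
    and br_closed: "x \<in> G \<Longrightarrow> y \<in> G \<Longrightarrow> br x y \<in> G"
    and br_add_left: "x \<in> G \<Longrightarrow> y \<in> G \<Longrightarrow> z \<in> G \<Longrightarrow> br (x + y) z = br x z + br y z"
    and br_add_right: "x \<in> G \<Longrightarrow> y \<in> G \<Longrightarrow> z \<in> G \<Longrightarrow> br z (x + y) = br z x + br z y"
    and br_scale_left: "x \<in> G \<Longrightarrow> y \<in> G \<Longrightarrow> br (c \<cdot> x) y = c \<cdot> br x y"
    and br_scale_right: "x \<in> G \<Longrightarrow> y \<in> G \<Longrightarrow> br x (c \<cdot> y) = c \<cdot> br x y"
    and br_self: "x \<in> G \<Longrightarrow> br x x = 0"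
    and br_jacobi: "x \<in> G \<Longrightarrow> y \<in> G \<Longrightarrow> z \<in> G \<Longrightarrow> br x (br y z) + br y (br z x) + br z (br x y) = 0"
    and \<delta>_br: "x \<in> G \<Longrightarrow> y \<in> G \<Longrightarrow> \<delta> (br x y) = br (\<delta> x) y + br x (\<delta> y)"
begin

definition T :: "'F \<Rightarrow> 'v \<Rightarrow> 'v" where "T a x = \<delta> x - a \<cdot> x"

definition E :: "'F \<Rightarrow> 'v set" where "E a = {x \<in> G. \<exists>e. (T a ^^ e) x = 0}"

definition poly_act :: "'F poly \<Rightarrow> 'v \<Rightarrow> 'v" where
  "poly_act p x = (\<Sum>i\<le>degree p. coeff p i \<cdot> (\<delta> ^^ i) x)"

lemma G_minus: "x \<in> G \<Longrightarrow> - x \<in> G"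
  using G_scale[of x "- 1"] by simp

lemma G_diff: "x \<in> G \<Longrightarrow> y \<in> G \<Longrightarrow> x - y \<in> G"
  using G_add[of x "- y"] G_minus by simp

lemma G_sum: "(\<And>a. a \<in> S \<Longrightarrow> f a \<in> G) \<Longrightarrow> sum f S \<in> G"
  by (induct S rule: infinite_finite_induct) (auto simp: G_zero G_add)

lemma \<delta>_zero: "\<delta> 0 = 0"
  using \<delta>_scale[OF G_zero, of 0] by simp

lemma \<delta>_diff: "x \<in> G \<Longrightarrow> y \<in> G \<Longrightarrow> \<delta> (x - y) = \<delta> x - \<delta> y"
  using \<delta>_add[of "x - y" y] G_diff by simp

lemma T_closed: "x \<in> G \<Longrightarrow> T a x \<in> G"
  by (simp add: T_def G_diff G_scale \<delta>_closed)

lemma T_zero: "T a 0 = 0" by (simp add: T_def \<delta>_zero)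

lemma T_add: "x \<in> G \<Longrightarrow> y \<in> G \<Longrightarrow> T a (x + y) = T a x + T a y"
  by (simp add: T_def \<delta>_add scale_right_distrib algebra_simps)

lemma T_diff: "x \<in> G \<Longrightarrow> y \<in> G \<Longrightarrow> T a (x - y) = T a x - T a y"
  by (simp add: T_def \<delta>_diff scale_right_diff_distrib algebra_simps)

lemma T_scale: "x \<in> G \<Longrightarrow> T a (c \<cdot> x) = c \<cdot> T a x"
  by (simp add: T_def \<delta>_scale scale_right_diff_distrib mult.commute)

lemma T_sum: "(\<And>b. b \<in> S \<Longrightarrow> f b \<in> G) \<Longrightarrow> T a (sum f S) = (\<Sum>b\<in>S. T a (f b))"
  by (induct S rule: infinite_finite_induct) (auto simp: T_zero T_add G_sum)

lemma T_commute: "x \<in> G \<Longrightarrow> T a (T b x) = T b (T a x)"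
  by (simp add: T_def \<delta>_diff \<delta>_closed G_scale \<delta>_scale scale_right_diff_distrib algebra_simps)

lemma T_shift: "T b x = T a x + (a - b) \<cdot> x"
  by (simp add: T_def scale_left_diff_distrib)

lemma Tpow_closed: "x \<in> G \<Longrightarrow> (T a ^^ e) x \<in> G"
  by (induct e) (auto simp: T_closed)

lemma Tpow_zero: "(T a ^^ e) 0 = 0"
  by (induct e) (auto simp: T_zero)

lemma Tpow_diff: "x \<in> G \<Longrightarrow> y \<in> G \<Longrightarrow> (T a ^^ e) (x - y) = (T a ^^ e) x - (T a ^^ e) y"
  by (induct e) (auto simp: T_diff Tpow_closed)

lemma Tpow_scale: "x \<in> G \<Longrightarrow> (T a ^^ e) (c \<cdot> x) = c \<cdot> (T a ^^ e) x"
  by (induct e) (auto simp: T_scale Tpow_closed)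

lemma Tpow_sum: "(\<And>b. b \<in> S \<Longrightarrow> f b \<in> G) \<Longrightarrow> (T a ^^ e) (sum f S) = (\<Sum>b\<in>S. (T a ^^ e) (f b))"
  by (induct e) (auto simp: T_sum Tpow_closed)

lemma Tpow_commute: "x \<in> G \<Longrightarrow> (T a ^^ e) (T b x) = T b ((T a ^^ e) x)"
  by (induct e) (auto simp: T_commute[of _ a b] Tpow_closed)

lemma Tpow_mono: "(T a ^^ e) x = 0 \<Longrightarrow> e \<le> e' \<Longrightarrow> (T a ^^ e') x = 0"
  using funpow_add[of "e' - e" e "T a"] by (simp add: Tpow_zero)

lemma E_zero: "0 \<in> E a"
  using G_zero by (auto simp: E_def intro: exI[of _ 0])

lemma E_diff: assumes "x \<in> E a" "y \<in> E a" shows "x - y \<in> E a"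
proof -
  obtain e e' where e: "(T a ^^ e) x = 0" "(T a ^^ e') y = 0" and G: "x \<in> G" "y \<in> G"
    using assms by (auto simp: E_def)
  then have "(T a ^^ max e e') (x - y) = 0"
    using Tpow_mono[OF e(1)] Tpow_mono[OF e(2)] by (simp add: Tpow_diff)
  then show ?thesis using G G_diff by (auto simp: E_def)
qed

lemma E_scale: "x \<in> E a \<Longrightarrow> c \<cdot> x \<in> E a"
  by (auto simp: E_def G_scale Tpow_scale)

lemma E_T: "x \<in> E a \<Longrightarrow> T b x \<in> E a"
  unfolding E_def mem_Collect_eq using T_closed Tpow_commute T_zero by metis

lemma E_T_iff: "x \<in> G \<Longrightarrow> T a x \<in> E a \<Longrightarrow> x \<in> E a"
  unfolding E_def mem_Collect_eq by (metis funpow_simps_right(2) comp_apply)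

lemma Tpow_E: "x \<in> E a \<Longrightarrow> (T b ^^ e) x \<in> E a"
  by (induct e) (auto simp: E_T)

text \<open>On \<open>E a\<close> the operator \<open>T b\<close> is the nonzero scalar
  \<open>a - b\<close> plus a nilpotent map. In the induction, \<open>T b w = T a u\<close> gives
  \<open>T b (u - w) = (a - b) \<cdot> u\<close>, so a multiple of \<open>u - w\<close> is the
  preimage.\<close>

lemma T_surj_E:
  assumes "a \<noteq> b" "u \<in> E a" shows "\<exists>w\<in>E a. T b w = u"
proof -
  have "\<exists>w\<in>E a. T b w = u" if "u \<in> G" "(T a ^^ e) u = 0" for e u
    using that
  proof (induct e arbitrary: u)
    case 0
    then show ?case using E_zero T_zero by auto
  next
    case (Suc e)
    then obtain w where w: "w \<in> E a" "T b w = T a u"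
      using T_closed by (metis funpow_simps_right(2) comp_apply)
    have u: "u \<in> E a" using Suc by (auto simp: E_def simp del: funpow.simps)
    define c where "c = inverse (a - b)"
    have "T b (c \<cdot> (u - w)) = c \<cdot> (T b u - T b w)"
      using u w(1) by (simp add: T_scale T_diff G_diff E_def)
    also have "T b u - T b w = (a - b) \<cdot> u" using T_shift[of b u a] w by simp
    finally have "T b (c \<cdot> (u - w)) = u" using assms(1) by (simp add: c_def)
    then show ?case using E_scale[OF E_diff[OF u w(1)]] by blast
  qed
  then show ?thesis using assms by (auto simp: E_def)
qed

lemma T_inj_E:
  assumes "a \<noteq> b" "w \<in> E a" "T b w = 0" shows "w = 0"
proof -
  have "w = 0" if "w \<in> G" "(T a ^^ e) w = 0" "T b w = 0" for e w
    using that
  proof (induct e arbitrary: w)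
    case (Suc e)
    have "T a w = 0"
    proof (rule Suc.hyps)
      show "T a w \<in> G" using Suc T_closed by blast
      show "(T a ^^ e) (T a w) = 0" using Suc.prems(2) by (simp add: funpow_swap1)
      show "T b (T a w) = 0" using Suc T_commute T_zero by metis
    qed
    then have "(a - b) \<cdot> w = 0" using T_shift[of b w a] Suc.prems by simp
    then show ?case using assms(1) by simp
  qed simp
  then show ?thesis using assms by (auto simp: E_def)
qed

lemma Tpow_inj_E:
  assumes "a \<noteq> b" "w \<in> E a" "(T b ^^ e) w = 0" shows "w = 0"
  using assms(2,3)
proof (induct e arbitrary: w)
  case (Suc e)
  then have "T b w = 0" using E_T by (simp add: funpow_swap1)
  then show ?case using T_inj_E[OF assms(1)] Suc by blast
qed simp

text \<open>A power of \<open>T b\<close> removes the summand of \<open>E b\<close> and is injective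
  on the other eigenspaces.\<close>

lemma E_independent:
  assumes "finite S" "\<And>a. a \<in> S \<Longrightarrow> f a \<in> E a" "(\<Sum>a\<in>S. f a) = 0" "a \<in> S"
  shows "f a = 0"
  using assms
proof (induct S arbitrary: f a)
  case (insert b S)
  have fG: "f c \<in> G" if "c \<in> insert b S" for c using insert.prems(1)[OF that] by (simp add: E_def)
  obtain e where e: "(T b ^^ e) (f b) = 0" using insert.prems(1)[of b] by (auto simp: E_def)
  have "(T b ^^ e) (\<Sum>a\<in>insert b S. f a) = (\<Sum>a\<in>insert b S. (T b ^^ e) (f a))"
    using fG by (intro Tpow_sum)
  then have s0: "(\<Sum>a\<in>S. (T b ^^ e) (f a)) = 0"
    using insert e by (simp add: Tpow_zero)
  have *: "f c = 0" if c: "c \<in> S" for c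
  proof -
    have "(T b ^^ e) (f c) = 0"
      using insert.prems(1) by (intro insert.hyps(3)[OF _ s0 c]) (auto intro: Tpow_E)
    moreover have "c \<noteq> b" using c insert by auto
    ultimately show ?thesis using Tpow_inj_E insert.prems(1) c by blast
  qed
  then have "f b = 0" using insert by simp
  then show ?case using * insert.prems by auto
qed simp

text \<open>Primary decomposition one factor at a time. The parts of \<open>T a x\<close> with
  eigenvalue different from \<open>a\<close> are lifted through \<open>T a\<close>; what remains of
  \<open>x\<close> is mapped into \<open>E a\<close> and so lies in \<open>E a\<close>. A repeated
  factor \<open>a\<close> is covered, since the \<open>a\<close>-part of \<open>T a x\<close> is
  simply left to the remainder.\<close>

lemma E_decomposition:
  assumes "x \<in> G" "foldr T as x = 0"
  shows "\<exists>f. (\<forall>a\<in>set as. f a \<in> E a) \<and> x = (\<Sum>a\<in>set as. f a)"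
  using assms
proof (induct as arbitrary: x rule: rev_induct)
  case (snoc a as)
  obtain f where f: "\<forall>c\<in>set as. f c \<in> E c" "T a x = (\<Sum>c\<in>set as. f c)"
    using snoc.hyps[of "T a x"] snoc.prems T_closed by auto
  have "\<exists>w. \<forall>c\<in>set as - {a}. w c \<in> E c \<and> T a (w c) = f c"
    using f(1) T_surj_E[of _ a] by (intro bchoice) blast
  then obtain w where w: "\<And>c. c \<in> set as - {a} \<Longrightarrow> w c \<in> E c \<and> T a (w c) = f c" by blast
  have wG: "w c \<in> G" if "c \<in> set as - {a}" for c using w[OF that] by (simp add: E_def)
  define z where "z = x - (\<Sum>c\<in>set as - {a}. w c)"
  have zG: "z \<in> G" unfolding z_def using snoc.prems wG by (intro G_diff G_sum)
  have "T a z = T a x - T a (\<Sum>c\<in>set as - {a}. w c)"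
    unfolding z_def using snoc.prems by (intro T_diff G_sum wG)
  then have "T a z = T a x - (\<Sum>c\<in>set as - {a}. T a (w c))" by (simp only: T_sum[OF wG])
  also have "\<dots> = (\<Sum>c\<in>set as. f c) - (\<Sum>c\<in>set as - {a}. f c)"
    using w f(2) by (auto intro!: sum.cong)
  also have "\<dots> = (if a \<in> set as then f a else 0)"
    by (auto simp: sum.remove[of "set as" a])
  finally have "T a z \<in> E a" using f(1) E_zero by simp
  then have zE: "z \<in> E a" using zG E_T_iff by blast
  have "(\<Sum>c\<in>insert a (set as). (w(a := z)) c) = z + (\<Sum>c\<in>insert a (set as) - {a}. (w(a := z)) c)"
    by (subst sum.remove[of _ a]) auto
  also have "(\<Sum>c\<in>insert a (set as) - {a}. (w(a := z)) c) = (\<Sum>c\<in>set as - {a}. w c)"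
    by (rule sum.cong) auto
  finally have "x = (\<Sum>c\<in>insert a (set as). (w(a := z)) c)" by (simp add: z_def)
  moreover have "\<forall>c\<in>insert a (set as). (w(a := z)) c \<in> E c" using w zE by auto
  ultimately show ?case by (metis list.set(2) rotate1.simps(2) set_rotate1)
qed (auto simp: E_zero)

section \<open>Polynomials in the derivation\<close>

lemma poly_act_sum:
  assumes "degree p \<le> n" shows "poly_act p x = (\<Sum>i\<le>n. coeff p i \<cdot> (\<delta> ^^ i) x)"
  unfolding poly_act_def using assms
  by (intro sum.mono_neutral_left) (auto simp: coeff_eq_0)

lemma \<delta>_sum: "(\<And>b. b \<in> S \<Longrightarrow> f b \<in> G) \<Longrightarrow> \<delta> (sum f S) = (\<Sum>b\<in>S. \<delta> (f b))"
  by (induct S rule: infinite_finite_induct) (auto simp: \<delta>_zero \<delta>_add G_sum)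

lemma \<delta>pow_closed: "x \<in> G \<Longrightarrow> (\<delta> ^^ i) x \<in> G"
  by (induct i) (auto simp: \<delta>_closed)

lemma poly_act_linear_factor:
  assumes "x \<in> G" shows "poly_act ([:- a, 1:] * p) x = T a (poly_act p x)"
proof -
  let ?n = "degree p"
  have eq: "[:- a, 1:] * p = pCons 0 p - smult a p" by simp
  have "degree ([:- a, 1:] * p) \<le> Suc ?n"
    using degree_mult_le[of "[:- a, 1:]" p] by simp
  then have "poly_act ([:- a, 1:] * p) x = (\<Sum>i\<le>Suc ?n. coeff ([:- a, 1:] * p) i \<cdot> (\<delta> ^^ i) x)"
    by (rule poly_act_sum)
  also have "\<dots> = (\<Sum>i\<le>Suc ?n. coeff (pCons 0 p) i \<cdot> (\<delta> ^^ i) x) - (\<Sum>i\<le>Suc ?n. (a * coeff p i) \<cdot> (\<delta> ^^ i) x)"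
    unfolding eq by (simp only: coeff_diff coeff_smult scale_left_diff_distrib sum_subtractf)
  also have "(\<Sum>i\<le>Suc ?n. coeff (pCons 0 p) i \<cdot> (\<delta> ^^ i) x) = (\<Sum>i\<le>?n. coeff p i \<cdot> \<delta> ((\<delta> ^^ i) x))"
    by (subst sum.atMost_Suc_shift) simp
  also have "\<dots> = \<delta> (poly_act p x)"
    unfolding poly_act_def using assms by (simp add: \<delta>_sum G_scale \<delta>pow_closed \<delta>_scale)
  also have "(\<Sum>i\<le>Suc ?n. (a * coeff p i) \<cdot> (\<delta> ^^ i) x) = a \<cdot> poly_act p x"
    using poly_act_sum[of p "Suc ?n" x] by (simp only: scale_sum_right scale_scale le_SucI order_refl)
  finally show ?thesis by (simp add: T_def)
qed

lemma poly_act_prod: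
  assumes "x \<in> G" shows "poly_act (\<Prod>a\<leftarrow>as. [:- a, 1:]) x = foldr T as x"
  using assms by (induct as) (simp add: poly_act_def, simp add: poly_act_linear_factor del: mult_pCons_left)

lemma poly_act_smult: "poly_act (smult c p) x = c \<cdot> poly_act p x"
  using poly_act_sum[of "smult c p" "degree p" x] by (simp add: poly_act_def scale_sum_right degree_smult_le)

lemma \<delta>pow_add: "x \<in> G \<Longrightarrow> y \<in> G \<Longrightarrow> (\<delta> ^^ i) (x + y) = (\<delta> ^^ i) x + (\<delta> ^^ i) y"
  by (induct i) (auto simp: \<delta>_add \<delta>pow_closed)

lemma \<delta>pow_scale: "x \<in> G \<Longrightarrow> (\<delta> ^^ i) (c \<cdot> x) = c \<cdot> (\<delta> ^^ i) x"
  by (induct i) (auto simp: \<delta>_scale \<delta>pow_closed)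

lemma poly_act_add: "x \<in> G \<Longrightarrow> y \<in> G \<Longrightarrow> poly_act p (x + y) = poly_act p x + poly_act p y"
  by (simp add: poly_act_def \<delta>pow_add scale_right_distrib sum.distrib)

lemma poly_act_scale: "x \<in> G \<Longrightarrow> poly_act p (c \<cdot> x) = c \<cdot> poly_act p x"
  by (simp add: poly_act_def \<delta>pow_scale scale_sum_right mult.commute)

text \<open>The Leibniz rule expresses \<open>T (a + b)\<close> of a bracket through
  \<open>T a\<close> on the left factor and \<open>T b\<close> on the right one. Each summand lowers
  one of the two exponents, so the induction is on their sum.\<close>

lemma E_bracket:
  assumes "x \<in> E a" "y \<in> E b" shows "br x y \<in> E (a + b)"
proof -
  obtain e e' where e: "(T a ^^ e) x = 0" "(T b ^^ e') y = 0" and G: "x \<in> G" "y \<in> G"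
    using assms by (auto simp: E_def)
  have z: "br 0 v = 0" "br v 0 = 0" if "v \<in> G" for v
    using that br_scale_left[OF that that, of 0] br_scale_right[OF that that, of 0] by auto
  have "br x y \<in> E (a + b)" if "x \<in> G" "y \<in> G" "(T a ^^ e) x = 0" "(T b ^^ e') y = 0" "e + e' = k" for k e e' x y
    using that
  proof (induct k arbitrary: e e' x y)
    case 0
    then show ?case using z E_zero by auto
  next
    case (Suc k)
    have "br (T a x) y = br (\<delta> x) y - a \<cdot> br x y"
      using br_add_left[of "T a x" "a \<cdot> x" y] Suc.prems
      by (simp add: T_def G_scale G_diff \<delta>_closed br_scale_left)
    moreover have "br x (T b y) = br x (\<delta> y) - b \<cdot> br x y"
      using br_add_right[of "T b y" "b \<cdot> y" x] Suc.prems
      by (simp add: T_def G_scale G_diff \<delta>_closed br_scale_right)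
    ultimately have T: "T (a + b) (br x y) = br (T a x) y + br x (T b y)"
      using Suc.prems by (simp add: T_def \<delta>_br scale_left_distrib)
    consider "e = 0" | "e' = 0" | e1 e2 where "e = Suc e1" "e' = Suc e2" by (cases e; cases e') auto
    then show ?case
    proof cases
      case 3
      have "br (T a x) y \<in> E (a + b)" "br x (T b y) \<in> E (a + b)"
        using Suc.prems 3 T_closed
        by (auto intro!: Suc.hyps[of "T a x" y e1 e'] Suc.hyps[of x "T b y" e e2] simp del: funpow.simps simp: funpow_simps_right)
      then have "T (a + b) (br x y) \<in> E (a + b)"
        using E_diff[OF _ E_diff[OF E_zero]] T by fastforce
      then show ?thesis using E_T_iff br_closed Suc.prems by blast
    qed (use Suc.prems z E_zero in auto)
  qed
  then show ?thesis using e G by blast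
qed

text \<open>An element of \<open>E a\<close> with \<open>a\<close> outside \<open>S\<close> also
  decomposes over \<open>S\<close>; subtracting it from that decomposition contradicts independence
  over \<open>insert a S\<close> unless the element is zero.\<close>

lemma graded_bracket_eigenspaces:
  assumes S: "finite S" "set as = S" "\<And>x. x \<in> G \<Longrightarrow> foldr T as x = 0"
    and free: "\<And>\<alpha> \<beta>. \<alpha> \<in> S \<Longrightarrow> \<beta> \<in> S \<Longrightarrow> \<exists>k::nat. \<alpha> + of_nat k * \<beta> \<notin> S"
  shows "graded_bracket br G E S"
proof
  have decomp: "\<exists>f. (\<forall>a\<in>S. f a \<in> E a) \<and> x = (\<Sum>a\<in>S. f a)" if "x \<in> G" for x
    using E_decomposition[OF that S(3)[OF that]] S(2) by blast
  then show "x \<in> G \<Longrightarrow> \<exists>f. (\<forall>a\<in>S. f a \<in> E a) \<and> x = (\<Sum>a\<in>S. f a)" for x .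
  show "E a = {0}" if a: "a \<notin> S" for a
  proof -
    have "x = 0" if x: "x \<in> E a" for x
    proof -
      obtain f where f: "\<forall>a\<in>S. f a \<in> E a" "x = (\<Sum>a\<in>S. f a)" using decomp x by (auto simp: E_def)
      have "(\<Sum>c\<in>insert a S. (f(a := - x)) c) = - x + (\<Sum>c\<in>S. (f(a := - x)) c)" using S a by simp
      also have "(\<Sum>c\<in>S. (f(a := - x)) c) = x" using f a by (auto intro: sum.cong)
      finally have "(f(a := - x)) a = 0"
        using E_diff[OF E_zero x] f S
        by (intro E_independent[of "insert a S" "f(a := - x)"]) auto
      then show ?thesis by simp
    qed
    then show ?thesis using E_zero by blast
  qed
qed (use G_zero G_diff br_closed br_add_left br_add_right br_self br_jacobi E_zero E_diff E_bracket
      E_independent S free in \<open>auto simp: E_def\<close>)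

end

lemma roots_product:
  fixes p :: "'a::alg_closed_field poly"
  assumes "p \<noteq> 0"
  obtains as where "p = smult (lead_coeff p) (\<Prod>a\<leftarrow>as. [:- a, 1:])" "set as = {a. poly p a = 0}"
proof -
  obtain A where A: "p = smult (lead_coeff p) (\<Prod>a\<in>#A. [:- a, 1:])"
    using alg_closed_imp_factorization[OF assms] by blast
  obtain as where as: "A = mset as" using ex_mset by metis
  have eq: "(\<Prod>a\<in>#A. [:- a, 1:]) = (\<Prod>a\<leftarrow>as. [:- a, 1:])"
    unfolding as by (metis mset_map prod_mset_prod_list)
  have "poly (\<Prod>a\<leftarrow>as. [:- a, 1:]) x = (\<Prod>a\<leftarrow>as. x - a)" for x by (induct as) (auto simp: algebra_simps)
  then have "poly p x = lead_coeff p * (\<Prod>a\<leftarrow>as. x - a)" for x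
    using A eq by (metis poly_smult)
  then have "set as = {a. poly p a = 0}" using assms by (auto simp: prod_list_zero_iff)
  then show ?thesis using A eq that by simp
qed

text \<open>After division by the leading coefficient, the polynomial becomes a product of shifts
  \<open>T a\<close>. The degrees are its distinct roots, at most \<open>n\<close> in number, which
  is how \<open>n\<close> becomes the argument of \<open>higman\<close>.\<close>

lemma (in derivation_space) word_vanishes:
  fixes p :: "'F poly" and n :: nat
  assumes inf: "infinite (UNIV :: 'l set)" "infinite (UNIV :: 'b set)" and p: "p \<noteq> 0" "degree p \<le> n"
    and as: "p = smult (lead_coeff p) (\<Prod>a\<leftarrow>as. [:- a, 1:])" "set as = {a. poly p a = 0}"
    and kill: "\<And>x. x \<in> G \<Longrightarrow> poly_act p x = 0"
    and free: "\<And>\<alpha> \<beta>. poly p \<alpha> = 0 \<Longrightarrow> poly p \<beta> = 0 \<Longrightarrow> \<exists>k::nat. poly p (\<alpha> + of_nat k * \<beta>) \<noteq> 0"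
    and x: "x0 \<in> G" and xs: "set xs \<subseteq> G" "length xs = higman TYPE('l) TYPE('b) n"
  shows "foldl br x0 xs = 0"
proof -
  have "lead_coeff p \<cdot> foldr T as x = 0" if "x \<in> G" for x
    using kill[OF that] poly_act_prod[OF that, of as] as(1) poly_act_smult by metis
  then have T0: "foldr T as x = 0" if "x \<in> G" for x using that p by simp
  have "graded_bracket br G E {a. poly p a = 0}"
    using p as T0 free by (intro graded_bracket_eigenspaces[of _ as]) (auto simp: poly_roots_finite)
  then show ?thesis
    using x xs p card_poly_roots_bound[OF p(1)] by (intro graded_bracket.word_vanishes[OF _ inf, of br G E _ n]) auto
qed

section \<open>Extension of scalars\<close>

lemma add_pow_ring_of_type_algebra:
  "add_pow (ring_of_type_algebra :: 'f::field ring) (k::nat) x = of_nat k * x"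
  by (induct k) (auto simp: add_pow_def nat_pow_def ring_of_type_algebra_def algebra_simps)

locale lie_algebra_derivation = lie_algebra "ring_of_type_algebra :: 'k::field ring" \<gg>
  for \<gg> :: "('k::field, 'g) module" (structure) +
  fixes D :: "'g \<Rightarrow> 'g"
  assumes lie_der: "lie_derivation ring_of_type_algebra \<gg> D"
begin

lemma D_closed: "x \<in> carrier \<gg> \<Longrightarrow> D x \<in> carrier \<gg>"
  and D_add: "x \<in> carrier \<gg> \<Longrightarrow> y \<in> carrier \<gg> \<Longrightarrow> D (x \<oplus> y) = D x \<oplus> D y"
  and D_smult: "x \<in> carrier \<gg> \<Longrightarrow> D (a \<odot> x) = a \<odot> D x"
  and D_bracket: "x \<in> carrier \<gg> \<Longrightarrow> y \<in> carrier \<gg> \<Longrightarrow> D (x \<otimes> y) = (D x \<otimes> y) \<oplus> (x \<otimes> D y)"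
  using lie_der by (auto simp: lie_derivation_def module_hom_def ring_of_type_algebra_def)

lemma smult_mem: "x \<in> carrier \<gg> \<Longrightarrow> a \<odot> x \<in> carrier \<gg>"
  using smult_closed[of a x] by (simp add: ring_of_type_algebra_def)

lemma smult_bracket_left: "x \<in> carrier \<gg> \<Longrightarrow> y \<in> carrier \<gg> \<Longrightarrow> (a \<odot> x) \<otimes> y = a \<odot> (x \<otimes> y)"
  and smult_bracket_right: "x \<in> carrier \<gg> \<Longrightarrow> y \<in> carrier \<gg> \<Longrightarrow> x \<otimes> (a \<odot> y) = a \<odot> (x \<otimes> y)"
  using bracket_smult_left[of a x y] bracket_smult_right[of a x y] by (auto simp: ring_of_type_algebra_def)

text \<open>The scalar extension of \<open>\<gg>\<close> to the algebraic closure is realised inside its double dual: as the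
  span of the evaluations at elements of \<open>\<gg>\<close> on the \<open>K\<close>-linear maps from \<open>\<gg>\<close> to the closure.\<close>

definition Phi :: "('g \<Rightarrow> 'k alg_closure) set" where
  "Phi = {f. (\<forall>x\<in>carrier \<gg>. \<forall>y\<in>carrier \<gg>. f (x \<oplus> y) = f x + f y) \<and>
    (\<forall>a. \<forall>x\<in>carrier \<gg>. f (a \<odot> x) = to_ac a * f x)}"

text \<open>The value zero outside \<open>Phi\<close> turns identities in the scalar extension into
  equalities of functions.\<close>

definition ev :: "'g \<Rightarrow> ('g \<Rightarrow> 'k alg_closure) \<Rightarrow> 'k alg_closure" where
  "ev x = (\<lambda>f. if f \<in> Phi then f x else 0)"

definition sc :: "'k alg_closure \<Rightarrow> (('g \<Rightarrow> 'k alg_closure) \<Rightarrow> 'k alg_closure) \<Rightarrow> ('g \<Rightarrow> 'k alg_closure) \<Rightarrow> 'k alg_closure" where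
  "sc c u = (\<lambda>f. c * u f)"

inductive_set ghat :: "(('g \<Rightarrow> 'k alg_closure) \<Rightarrow> 'k alg_closure) set" where
  zero: "0 \<in> ghat"
| step: "u \<in> ghat \<Longrightarrow> x \<in> carrier \<gg> \<Longrightarrow> sc c (ev x) + u \<in> ghat"

text \<open>The Arens product of functionals induced by the bracket. It needs no presentation of
  \<open>u\<close> and \<open>v\<close> as linear combinations of evaluations, so no
  well-definedness has to be checked.\<close>

definition brk :: "(('g \<Rightarrow> 'k alg_closure) \<Rightarrow> 'k alg_closure) \<Rightarrow> (('g \<Rightarrow> 'k alg_closure) \<Rightarrow> 'k alg_closure) \<Rightarrow>
    ('g \<Rightarrow> 'k alg_closure) \<Rightarrow> 'k alg_closure" where
  "brk u v = (\<lambda>f. if f \<in> Phi then v (\<lambda>y. u (\<lambda>x. f (x \<otimes> y))) else 0)"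

definition del :: "(('g \<Rightarrow> 'k alg_closure) \<Rightarrow> 'k alg_closure) \<Rightarrow> ('g \<Rightarrow> 'k alg_closure) \<Rightarrow> 'k alg_closure" where
  "del u = (\<lambda>f. if f \<in> Phi then u (\<lambda>x. f (D x)) else 0)"

lemma Phi_add: "f \<in> Phi \<Longrightarrow> x \<in> carrier \<gg> \<Longrightarrow> y \<in> carrier \<gg> \<Longrightarrow> f (x \<oplus> y) = f x + f y"
  and Phi_smult: "f \<in> Phi \<Longrightarrow> x \<in> carrier \<gg> \<Longrightarrow> f (a \<odot> x) = to_ac a * f x"
  by (auto simp: Phi_def)

lemma Phi_cong:
  assumes "\<And>x. x \<in> carrier \<gg> \<Longrightarrow> f x = f' x" shows "f \<in> Phi \<longleftrightarrow> f' \<in> Phi"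
proof -
  have "f' \<in> Phi" if "\<And>x. x \<in> carrier \<gg> \<Longrightarrow> f x = f' x" "f \<in> Phi" for f f'
    unfolding Phi_def
    using that(1)[symmetric] Phi_add[OF that(2)] Phi_smult[OF that(2)] smult_mem by simp
  then show ?thesis using assms by metis
qed

lemma Phi_left: "f \<in> Phi \<Longrightarrow> y \<in> carrier \<gg> \<Longrightarrow> (\<lambda>x. f (x \<otimes> y)) \<in> Phi"
  unfolding Phi_def
  by (auto simp: bracket_add_left smult_bracket_left bracket_closed)

lemma Phi_D: "f \<in> Phi \<Longrightarrow> (\<lambda>x. f (D x)) \<in> Phi"
  unfolding Phi_def by (auto simp: D_add D_smult D_closed)

lemma Phi_lin: "f \<in> Phi \<Longrightarrow> f' \<in> Phi \<Longrightarrow> (\<lambda>x. a * f x + b * f' x) \<in> Phi"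
  unfolding Phi_def by (auto simp: algebra_simps)

text \<open>Members of \<open>Phi\<close> are constrained only on the carrier, and the extension
  does not see their values elsewhere.\<close>

lemma ghat_cong:
  assumes "u \<in> ghat" "\<And>x. x \<in> carrier \<gg> \<Longrightarrow> f x = f' x" shows "u f = u f'"
  using assms(1) by induct (use assms(2) Phi_cong[of f f'] in \<open>auto simp: sc_def ev_def\<close>)

lemma ghat_lin:
  assumes "u \<in> ghat" "f \<in> Phi" "f' \<in> Phi"
  shows "u (\<lambda>x. a * f x + b * f' x) = a * u f + b * u f'"
  using assms(1)
  by induct (use assms(2,3) Phi_lin in \<open>auto simp: sc_def ev_def algebra_simps\<close>)

lemma ghat_sum_at: 
  assumes "u \<in> ghat" "f \<in> Phi" "f' \<in> Phi" shows "u (\<lambda>x. f x + f' x) = u f + u f'"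
  using ghat_lin[OF assms, of 1 1] by simp

lemma ghat_scale_at: 
  assumes "u \<in> ghat" "f \<in> Phi" shows "u (\<lambda>x. a * f x) = a * u f"
  using ghat_lin[OF assms(1,2,2), of a 0] by simp

text \<open>The inner functional in \<open>brk\<close> is again linear, so the outer one may be
  evaluated at it.\<close>

lemma ghat_Phi:
  assumes u: "u \<in> ghat" and f: "f \<in> Phi" shows "(\<lambda>y. u (\<lambda>x. f (x \<otimes> y))) \<in> Phi"
proof -
  have "u (\<lambda>x. f (x \<otimes> (y \<oplus> y'))) = u (\<lambda>x. f (x \<otimes> y)) + u (\<lambda>x. f (x \<otimes> y'))"
    if "y \<in> carrier \<gg>" "y' \<in> carrier \<gg>" for y y'
  proof -
    have "u (\<lambda>x. f (x \<otimes> (y \<oplus> y'))) = u (\<lambda>x. f (x \<otimes> y) + f (x \<otimes> y'))"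
      using that Phi_add[OF f] by (intro ghat_cong[OF u]) (simp add: bracket_add_right bracket_closed)
    then show ?thesis using ghat_sum_at[OF u] Phi_left[OF f] that by simp
  qed
  moreover have "u (\<lambda>x. f (x \<otimes> (a \<odot> y))) = to_ac a * u (\<lambda>x. f (x \<otimes> y))"
    if "y \<in> carrier \<gg>" for y a
  proof -
    have "u (\<lambda>x. f (x \<otimes> (a \<odot> y))) = u (\<lambda>x. to_ac a * f (x \<otimes> y))"
      using that Phi_smult[OF f] by (intro ghat_cong[OF u]) (simp add: smult_bracket_right bracket_closed)
    then show ?thesis using ghat_scale_at[OF u] Phi_left[OF f] that by simp
  qed
  ultimately show ?thesis by (simp add: Phi_def)
qed

section \<open>The extension as a Lie algebra with a derivation\<close>

lemma sc_vector_space: "vector_space sc"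
  by unfold_locales (auto simp: sc_def algebra_simps)

lemma ev_mem: "x \<in> carrier \<gg> \<Longrightarrow> ev x \<in> ghat"
proof -
  assume "x \<in> carrier \<gg>"
  then have "sc 1 (ev x) + 0 \<in> ghat" using ghat.zero ghat.step by blast
  moreover have "sc 1 (ev x) + 0 = ev x" by (auto simp: sc_def)
  ultimately show ?thesis by simp
qed

lemma ev_add: "x \<in> carrier \<gg> \<Longrightarrow> y \<in> carrier \<gg> \<Longrightarrow> ev (x \<oplus> y) = ev x + ev y"
  by (auto simp: ev_def Phi_add)

lemma ev_zero: "ev \<zero> = 0"
  using ev_add[of \<zero> \<zero>] by simp

lemma brk_ev:
  assumes "x \<in> carrier \<gg>" "y \<in> carrier \<gg>" shows "brk (ev x) (ev y) = ev (x \<otimes> y)"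
proof
  fix f
  show "brk (ev x) (ev y) f = ev (x \<otimes> y) f"
    using ghat_Phi[OF ev_mem[OF assms(1)], of f] Phi_left[of f y] assms by (auto simp: brk_def ev_def)
qed

lemma brk_add_left: "u \<in> ghat \<Longrightarrow> u' \<in> ghat \<Longrightarrow> v \<in> ghat \<Longrightarrow> brk (u + u') v = brk u v + brk u' v"
  using ghat_sum_at ghat_Phi by (fastforce simp: brk_def)

lemma brk_add_right: "brk u (v + v') = brk u v + brk u v'"
  by (auto simp: brk_def)

lemma brk_scale_left: "u \<in> ghat \<Longrightarrow> v \<in> ghat \<Longrightarrow> brk (sc c u) v = sc c (brk u v)"
  using ghat_scale_at ghat_Phi by (fastforce simp: brk_def sc_def)

lemma brk_scale_right: "brk u (sc c v) = sc c (brk u v)"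
  by (auto simp: brk_def sc_def)

lemma sc_zero: "sc c 0 = 0" and sc_add: "sc c (u + v) = sc c u + sc c v" and sc_sc: "sc c (sc d u) = sc (c * d) u"
  and sc_minus: "sc c (- u) = - sc c u"
  by (auto simp: sc_def algebra_simps)

lemma brk_zero_right: "brk u 0 = 0"
  by (auto simp: brk_def)

lemma del_add: "del (u + v) = del u + del v" and del_sc: "del (sc c u) = sc c (del u)" and del_zero: "del 0 = 0"
  by (auto simp: del_def sc_def)

lemma del_ev: "x \<in> carrier \<gg> \<Longrightarrow> del (ev x) = ev (D x)"
  using Phi_D by (auto simp: del_def ev_def)

text \<open>Induction over function-valued terms leaves eta-expanded instances, which these rules would unfold.\<close>

declare plus_fun_apply [simp del] zero_fun_apply [simp del] uminus_apply [simp del] minus_apply [simp del]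

lemma ghat_add: "u \<in> ghat \<Longrightarrow> v \<in> ghat \<Longrightarrow> u + v \<in> ghat"
  by (induct rule: ghat.induct) (auto simp: add.assoc intro: ghat.step)

lemma ghat_scale: "u \<in> ghat \<Longrightarrow> sc c u \<in> ghat"
proof (induct rule: ghat.induct)
  case zero
  then show ?case using ghat.zero by (simp add: sc_zero)
next
  case (step u x c')
  then show ?case using ghat.step by (simp add: sc_add sc_sc)
qed

text \<open>Reduces multilinear identities to scalar multiples of evaluations.\<close>

lemma ghat_induct [consumes 1, case_names zero scaled_ev add]:
  assumes "u \<in> ghat" "P 0" "\<And>c x. x \<in> carrier \<gg> \<Longrightarrow> P (sc c (ev x))"
    "\<And>u v. u \<in> ghat \<Longrightarrow> v \<in> ghat \<Longrightarrow> P u \<Longrightarrow> P v \<Longrightarrow> P (u + v)"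
  shows "P u"
  using assms(1) by induct (use assms(2-) ghat_scale ev_mem in auto)

lemma brk_zero_left: "v \<in> ghat \<Longrightarrow> brk 0 v = 0"
  using brk_add_left[of 0 0 v] ghat.zero by simp

lemma brk_closed: "u \<in> ghat \<Longrightarrow> v \<in> ghat \<Longrightarrow> brk u v \<in> ghat"
proof (induct u rule: ghat_induct)
  case (scaled_ev c x)
  from \<open>v \<in> ghat\<close> show ?case
    by (induct rule: ghat_induct)
      (use scaled_ev ghat.zero ghat_add ghat_scale ev_mem bracket_closed in
        \<open>auto simp: brk_zero_right brk_scale_right brk_scale_left brk_add_right brk_ev\<close>)
qed (auto simp: brk_zero_left brk_add_left ghat.zero ghat_add)

text \<open>Precedes \<open>brk_self\<close>, which is quadratic: expanding the bracket of
  \<open>u + v\<close> with itself leaves two mixed terms that must cancel.\<close>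

lemma brk_antisym: "u \<in> ghat \<Longrightarrow> v \<in> ghat \<Longrightarrow> brk u v = - brk v u"
proof (induct u rule: ghat_induct)
  case zero
  then show ?case by (simp add: brk_zero_left brk_zero_right)
next
  case (scaled_ev c x)
  have x: "sc c (ev x) \<in> ghat" using scaled_ev ev_mem ghat_scale by blast
  from \<open>v \<in> ghat\<close> show ?case
  proof (induct rule: ghat_induct)
    case zero
    then show ?case using x by (simp add: brk_zero_left brk_zero_right)
  next
    case (scaled_ev d y)
    have "ev (x \<otimes> y) + ev (y \<otimes> x) = ev (x \<otimes> y \<oplus> y \<otimes> x)"
      using scaled_ev \<open>x \<in> carrier \<gg>\<close> bracket_closed by (simp add: ev_add)
    also have "x \<otimes> y \<oplus> y \<otimes> x = \<zero>"
      using bracket_antisym[of x y] scaled_ev \<open>x \<in> carrier \<gg>\<close> bracket_closed l_neg by simp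
    finally have "ev (x \<otimes> y) = - ev (y \<otimes> x)" using ev_zero by (simp add: eq_neg_iff_add_eq_0)
    then show ?case
      using scaled_ev \<open>x \<in> carrier \<gg>\<close> ev_mem ghat_scale
      by (simp add: brk_scale_right brk_scale_left brk_ev sc_sc sc_minus mult.commute)
  next
    case (add u v)
    then show ?case using x by (simp add: brk_add_left brk_add_right)
  qed
next
  case (add u v)
  then show ?case by (simp add: brk_add_left brk_add_right)
qed

lemma brk_self: "u \<in> ghat \<Longrightarrow> brk u u = 0"
proof (induct rule: ghat_induct)
  case (scaled_ev c x)
  then show ?case
    by (simp add: brk_scale_right brk_scale_left brk_ev ev_mem ghat_scale bracket_self ev_zero sc_zero)
next
  case (add u v)
  then show ?case using brk_antisym[of u v] by (simp add: brk_add_left brk_add_right ghat_add)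
qed (simp add: brk_zero_right)

lemma brk_jacobi:
  assumes "u \<in> ghat" "v \<in> ghat" "w \<in> ghat"
  shows "brk u (brk v w) + brk v (brk w u) + brk w (brk u v) = 0"
  using assms
proof (induct u rule: ghat_induct)
  case zero
  then show ?case by (simp add: brk_zero_left brk_zero_right brk_closed)
next
  case (scaled_ev c x)
  have x: "sc c (ev x) \<in> ghat" using scaled_ev ev_mem ghat_scale by blast
  from \<open>v \<in> ghat\<close> show ?case
  proof (induct v rule: ghat_induct)
    case zero
    then show ?case using x \<open>w \<in> ghat\<close> by (simp add: brk_zero_left brk_zero_right brk_closed)
  next
    case (scaled_ev d y)
    have y: "sc d (ev y) \<in> ghat" using scaled_ev ev_mem ghat_scale by blast
    from \<open>w \<in> ghat\<close> show ?case
    proof (induct w rule: ghat_induct)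
      case zero
      then show ?case using x y by (simp add: brk_zero_left brk_zero_right brk_closed)
    next
      case (scaled_ev e z)
      note xyz = \<open>x \<in> carrier \<gg>\<close> \<open>y \<in> carrier \<gg>\<close> \<open>z \<in> carrier \<gg>\<close>
      have "ev (x \<otimes> (y \<otimes> z)) + ev (y \<otimes> (z \<otimes> x)) + ev (z \<otimes> (x \<otimes> y)) = 0"
        using ev_zero jacobi[OF xyz] xyz bracket_closed by (simp flip: ev_add)
      then have "sc (c * d * e) (ev (x \<otimes> (y \<otimes> z))) + sc (c * d * e) (ev (y \<otimes> (z \<otimes> x))) + sc (c * d * e) (ev (z \<otimes> (x \<otimes> y))) = 0"
        by (simp flip: sc_add add: sc_zero)
      then show ?case
        using xyz bracket_closed ev_mem ghat_scale
        by (simp add: brk_scale_right brk_scale_left brk_ev sc_sc mult_ac)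
    next
      case (add w w')
      then have "brk (sc c (ev x)) (brk (sc d (ev y)) w) + brk (sc d (ev y)) (brk w (sc c (ev x))) + brk w (brk (sc c (ev x)) (sc d (ev y))) +
        (brk (sc c (ev x)) (brk (sc d (ev y)) w') + brk (sc d (ev y)) (brk w' (sc c (ev x))) + brk w' (brk (sc c (ev x)) (sc d (ev y)))) = 0" by simp
      then show ?case using x y add(1,2) by (simp add: brk_add_left brk_add_right brk_closed add_ac)
    qed
  next
    case (add v v')
    then have "brk (sc c (ev x)) (brk v w) + brk v (brk w (sc c (ev x))) + brk w (brk (sc c (ev x)) v) +
      (brk (sc c (ev x)) (brk v' w) + brk v' (brk w (sc c (ev x))) + brk w (brk (sc c (ev x)) v')) = 0" by simp
    then show ?case using x add(1,2) \<open>w \<in> ghat\<close> by (simp add: brk_add_left brk_add_right brk_closed add_ac)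
  qed
next
  case (add u u')
  then have "brk u (brk v w) + brk v (brk w u) + brk w (brk u v) +
    (brk u' (brk v w) + brk v (brk w u') + brk w (brk u' v)) = 0" by simp
  then show ?case using add(1,2,5,6) by (simp add: brk_add_left brk_add_right brk_closed add_ac)
qed

lemma del_closed: "u \<in> ghat \<Longrightarrow> del u \<in> ghat"
  by (induct rule: ghat_induct)
    (auto simp: del_add del_sc del_zero del_ev ghat.zero ghat_add ghat_scale ev_mem D_closed)

lemma del_brk:
  assumes "u \<in> ghat" "v \<in> ghat" shows "del (brk u v) = brk (del u) v + brk u (del v)"
  using assms
proof (induct u rule: ghat_induct)
  case zero
  then show ?case by (simp add: brk_zero_left del_zero del_closed)
next
  case (scaled_ev c x)
  have x: "sc c (ev x) \<in> ghat" using scaled_ev ev_mem ghat_scale by blast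
  from \<open>v \<in> ghat\<close> show ?case
  proof (induct v rule: ghat_induct)
    case zero
    then show ?case by (simp add: brk_zero_right del_zero)
  next
    case (scaled_ev d y)
    note xy = \<open>x \<in> carrier \<gg>\<close> \<open>y \<in> carrier \<gg>\<close>
    have "del (ev (x \<otimes> y)) = ev (D x \<otimes> y) + ev (x \<otimes> D y)"
      using xy bracket_closed D_closed by (simp add: del_ev D_bracket ev_add)
    then show ?case using xy ev_mem ghat_scale D_closed
      by (simp add: brk_scale_right brk_scale_left brk_ev del_sc del_ev sc_add)
  next
    case (add v v')
    then show ?case using x del_closed by (simp add: brk_add_right del_add add_ac)
  qed
next
  case (add u u')
  then show ?case using del_closed by (simp add: brk_add_left del_add add_ac)
qed

sublocale ext: derivation_space sc ghat del brk
  by (intro derivation_space.intro sc_vector_space derivation_space_axioms.intro)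
    (auto intro: ghat.zero ghat_add ghat_scale del_closed brk_closed brk_add_left brk_scale_left brk_self brk_jacobi del_brk
      simp: del_add del_sc brk_add_right brk_scale_right)

section \<open>Descent from the extension\<close>

lemma Phi_zero: "f \<in> Phi \<Longrightarrow> f \<zero> = 0"
proof -
  assume "f \<in> Phi"
  then have "f \<zero> + f \<zero> = f \<zero> + 0" using Phi_add[of f \<zero> \<zero>] by simp
  then show ?thesis by (rule add_left_imp_eq)
qed

lemma Phi_finsum:
  assumes f: "f \<in> Phi" and "finite I" "x \<in> I \<rightarrow> carrier \<gg>"
  shows "f (\<Oplus>i\<in>I. x i) = (\<Sum>i\<in>I. f (x i))"
  using assms(2,3)
proof (induct I)
  case (insert i I)
  then have "x \<in> I \<rightarrow> carrier \<gg>" "x i \<in> carrier \<gg>" by auto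
  then show ?case using insert by (simp add: Phi_add[OF f])
qed (simp add: Phi_zero[OF f])

lemma Dpow_closed: "x \<in> carrier \<gg> \<Longrightarrow> (D ^^ i) x \<in> carrier \<gg>"
  by (induct i) (auto simp: D_closed)

lemma delpow_ev: "x \<in> carrier \<gg> \<Longrightarrow> (del ^^ i) (ev x) = ev ((D ^^ i) x)"
  by (induct i) (auto simp: del_ev Dpow_closed)

text \<open>At a functional \<open>f\<close> in \<open>Phi\<close> the left side is \<open>f\<close>
  applied to the value of the polynomial in \<open>D\<close> at \<open>x\<close>, which is
  zero.\<close>

lemma poly_act_ev:
  assumes r: "poly_annihilates r \<gg> D" and x: "x \<in> carrier \<gg>"
  shows "ext.poly_act (map_poly to_ac r) (ev x) = 0"
proof
  fix f
  have sum_at: "(\<Sum>i\<le>N. F i) f = (\<Sum>i\<le>N. F i f)" for N :: nat and F :: "nat \<Rightarrow> ('g \<Rightarrow> 'k alg_closure) \<Rightarrow> 'k alg_closure"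
    by (induct N) (auto simp: plus_fun_apply)
  have "ext.poly_act (map_poly to_ac r) (ev x) = (\<Sum>i\<le>Polynomial.degree r. sc (poly.coeff (map_poly to_ac r) i) ((del ^^ i) (ev x)))"
    by (intro ext.poly_act_sum) (simp add: degree_map_poly)
  also have "\<dots> = (\<Sum>i\<le>Polynomial.degree r. sc (to_ac (poly.coeff r i)) (ev ((D ^^ i) x)))"
    using x by (simp add: delpow_ev coeff_map_poly)
  finally have "ext.poly_act (map_poly to_ac r) (ev x) f = (\<Sum>i\<le>Polynomial.degree r. sc (to_ac (poly.coeff r i)) (ev ((D ^^ i) x)) f)"
    by (simp only: sum_at)
  also have "\<dots> = 0"
  proof (cases "f \<in> Phi")
    case True
    have "(\<Sum>i\<le>Polynomial.degree r. sc (to_ac (poly.coeff r i)) (ev ((D ^^ i) x)) f) = (\<Sum>i\<le>Polynomial.degree r. f (poly.coeff r i \<odot> (D ^^ i) x))"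
      using True x by (simp add: sc_def ev_def Phi_smult Dpow_closed)
    also have "\<dots> = f (\<Oplus>i\<in>{..degree r}. poly.coeff r i \<odot> (D ^^ i) x)"
      using x by (intro Phi_finsum[OF True, symmetric]) (auto intro: smult_mem Dpow_closed)
    also have "\<dots> = 0" using r x Phi_zero[OF True] by (simp add: poly_annihilates_def)
    finally show ?thesis .
  qed (simp add: sc_def ev_def)
  finally show "ext.poly_act (map_poly to_ac r) (ev x) f = 0 f" by (simp add: zero_fun_apply)
qed

lemma poly_act_ghat:
  assumes "poly_annihilates r \<gg> D" "u \<in> ghat" shows "ext.poly_act (map_poly to_ac r) u = 0"
  using assms(2)
proof (induct rule: ghat_induct)
  case zero
  then show ?case using ext.poly_act_scale[OF ghat.zero, of _ 0] by (simp add: sc_zero)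
next
  case (scaled_ev c x)
  then show ?case using poly_act_ev[OF assms(1)] by (simp add: ext.poly_act_scale ev_mem sc_zero)
next
  case (add u v)
  then show ?case by (simp add: ext.poly_act_add)
qed

text \<open>Coordinates with respect to a finite basis, composed with the embedding into the
  closure, belong to \<open>Phi\<close>. The lemma makes \<open>ev\<close> injective, so a word that
  vanishes in the extension vanishes in \<gg>.\<close>

lemma Phi_separates:
  assumes fin: "fin_dim" and w: "w \<in> carrier \<gg>" "w \<noteq> \<zero>" shows "\<exists>f\<in>Phi. f w \<noteq> 0"
proof -
  obtain B where B: "finite B" "basis B" using finite_basis_exists[OF fin] by blast
  then have BC: "B \<subseteq> carrier \<gg>" by (simp add: basis_def)
  have K [simp]: "carrier (ring_of_type_algebra :: 'k ring) = UNIV" "a \<oplus>\<^bsub>(ring_of_type_algebra :: 'k ring)\<^esub> b = a + b"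
    "a \<otimes>\<^bsub>(ring_of_type_algebra :: 'k ring)\<^esub> b = a * b" for a b :: 'k
    by (auto simp: ring_of_type_algebra_def)
  have ex1: "\<exists>!a. a \<in> B \<rightarrow>\<^sub>E UNIV \<and> lincomb a B = v" if "v \<in> carrier \<gg>" for v
    using basis_criterion[OF B(1) BC] B(2) that by simp
  define coord where "coord v = (THE a. a \<in> B \<rightarrow>\<^sub>E UNIV \<and> lincomb a B = v)" for v
  have coord: "coord v \<in> B \<rightarrow>\<^sub>E UNIV" "lincomb (coord v) B = v" if "v \<in> carrier \<gg>" for v
    using theI'[OF ex1[OF that]] by (auto simp: coord_def)
  have unique: "a b = coord v b" if "lincomb a B = v" "v \<in> carrier \<gg>" "b \<in> B" for a v b
  proof -
    \<comment> \<open>Coordinates are unique among functions that are undefined off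
      \<open>B\<close>, hence the restriction.\<close>
    have "lincomb (restrict a B) B = lincomb a B" using BC by (intro lincomb_cong) auto
    then have "restrict a B = coord v" using ex1[OF that(2)] coord[OF that(2)] that(1) by auto
    then show ?thesis using that(3) by (metis restrict_apply)
  qed
  define f where "f b = (\<lambda>v. to_ac (coord v b))" for b
  have "f b \<in> Phi" if b: "b \<in> B" for b
    unfolding Phi_def
  proof (intro CollectI conjI ballI allI)
    fix x y assume xy: "x \<in> carrier \<gg>" "y \<in> carrier \<gg>"
    have "lincomb (\<lambda>v. coord x v + coord y v) B = x \<oplus> y"
      using lincomb_sum[OF B(1) BC, of "coord x" "coord y"] coord xy by simp
    then show "f b (x \<oplus> y) = f b x + f b y" using unique[of _ "x \<oplus> y", OF _ _ b] xy by (simp add: f_def flip: to_ac_add)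
  next
    fix a x assume x: "x \<in> carrier \<gg>"
    have "lincomb (\<lambda>v. a * coord x v) B = a \<odot> x"
      using lincomb_smult[OF BC, of "coord x" a] coord x by simp
    then show "f b (a \<odot> x) = to_ac a * f b x" using unique[of _ "a \<odot> x", OF _ _ b] x smult_mem by (simp add: f_def flip: to_ac_mult)
  qed
  moreover have "\<exists>b\<in>B. f b w \<noteq> 0"
  proof (rule ccontr)
    assume "\<not> ?thesis"
    then have z: "coord w b = 0" if "b \<in> B" for b using that by (auto simp: f_def)
    have "w = lincomb (coord w) B" using coord w by simp
    also have "\<dots> = lincomb (\<lambda>_. \<zero>\<^bsub>(ring_of_type_algebra :: 'k ring)\<^esub>) B"
      using z BC by (intro lincomb_cong) (auto simp: ring_of_type_algebra_def)
    also have "\<dots> = \<zero>"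
      unfolding lincomb_def using BC by (intro M.add.finprod_one_eqI) (auto simp: smult_l_null)
    finally show False using w by simp
  qed
  ultimately show ?thesis by blast
qed

lemma lower_central_higman:
  fixes r :: "'k poly"
  assumes inf: "infinite (UNIV :: 'l set)" "infinite (UNIV :: 'b set)"
    and fin: "fin_dim" and r: "r \<noteq> 0" "Polynomial.degree r \<le> n" "poly_annihilates r \<gg> D"
    and free: "arith_free ring_of_type_algebra {\<alpha>. poly (map_poly to_ac r) \<alpha> = 0}"
  shows "lower_central \<gg> (higman TYPE('l) TYPE('b) n) = {\<zero>}"
proof (rule lower_central_zero_if_words_vanish, rule ccontr)
  fix x xs
  assume x: "x \<in> carrier \<gg>" "set xs \<subseteq> carrier \<gg>" "length xs = higman TYPE('l) TYPE('b) n"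
  let ?p = "map_poly to_ac r"
  have p: "?p \<noteq> 0" "Polynomial.degree ?p \<le> n" using r by (auto simp: map_poly_eq_0_iff degree_map_poly)
  obtain as where as: "?p = smult (lead_coeff ?p) (\<Prod>a\<leftarrow>as. [:- a, 1:])" "set as = {a. poly ?p a = 0}"
    using roots_product[OF p(1)] .
  have "\<exists>k::nat. poly ?p (\<alpha> + of_nat k * \<beta>) \<noteq> 0" if "poly ?p \<alpha> = 0" "poly ?p \<beta> = 0" for \<alpha> \<beta>
    using free that unfolding arith_free_def add_pow_ring_of_type_algebra by (auto simp: ring_of_type_algebra_def)
  moreover have "set (map ev xs) \<subseteq> ghat" "length (map ev xs) = higman TYPE('l) TYPE('b) n" using x ev_mem by auto
  ultimately have "foldl brk (ev x) (map ev xs) = 0"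
    using ext.word_vanishes[OF inf p as] poly_act_ghat[OF r(3)] x ev_mem by blast
  moreover have "foldl brk (ev x) (map ev xs) = ev (foldl (\<otimes>) x xs) \<and> foldl (\<otimes>) x xs \<in> carrier \<gg>"
    using x(1,2) by (induct xs arbitrary: x) (auto simp: brk_ev bracket_closed)
  ultimately have w: "ev (foldl (\<otimes>) x xs) = 0" "foldl (\<otimes>) x xs \<in> carrier \<gg>" by auto
  assume "foldl (\<otimes>) x xs \<noteq> \<zero>"
  then obtain f where "f \<in> Phi" "f (foldl (\<otimes>) x xs) \<noteq> 0" using Phi_separates[OF fin w(2)] by blast
  then show False using fun_cong[OF w(1), of f] by (simp add: ev_def zero_fun_apply)
qed

end

section \<open>Non-nilpotent Lie algebras\<close>

text \<open>\<open>(j + q - 1) mod q\<close> is the cyclic predecessor of \<open>j\<close>; adding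
  \<open>q\<close> keeps the natural subtraction from truncating at \<open>j = 0\<close>.\<close>

definition cyclic_bracket :: "nat \<Rightarrow> nat \<Rightarrow> (nat \<Rightarrow> 'f::field) \<Rightarrow> (nat \<Rightarrow> 'f) \<Rightarrow> nat \<Rightarrow> 'f" where
  "cyclic_bracket q n u v = (\<lambda>j. if j < q
     then u ((j + q - 1) mod q) * v n - v ((j + q - 1) mod q) * u n else 0)"

text \<open>Coordinates \<open>j < q\<close> belong to basis vectors \<open>y\<^sub>j\<close> and coordinate \<open>n\<close> to a basis vector \<open>x\<close>, where
  \<open>[y\<^sub>j, x]\<close> is the cyclic successor of \<open>y\<^sub>j\<close>; the remaining basis vectors are central.\<close>

definition cyclic_lie :: "nat \<Rightarrow> nat \<Rightarrow> ('f::field, nat \<Rightarrow> 'f) module" where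
  "cyclic_lie q n = \<lparr>carrier = {u. \<forall>i>n. u i = 0}, monoid.mult = cyclic_bracket q n, one = (\<lambda>_. 0),
     ring.zero = (\<lambda>_. 0), add = (\<lambda>u v i. u i + v i), module.smult = (\<lambda>c u i. c * u i)\<rparr>"

lemma cyclic_lie_simps [simp]:
  "carrier (cyclic_lie q n) = {u. \<forall>i>n. u i = 0}"
  "x \<otimes>\<^bsub>cyclic_lie q n\<^esub> y = cyclic_bracket q n x y"
  "\<zero>\<^bsub>cyclic_lie q n\<^esub> = (\<lambda>_. 0)"
  "x \<oplus>\<^bsub>cyclic_lie q n\<^esub> y = (\<lambda>i. x i + y i)"
  "c \<odot>\<^bsub>cyclic_lie q n\<^esub> x = (\<lambda>i. c * x i)"
  by (auto simp: cyclic_lie_def)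

lemma ring_of_type_algebra_simps [simp]:
  "carrier (ring_of_type_algebra :: 'f::field ring) = UNIV"
  "x \<otimes>\<^bsub>(ring_of_type_algebra :: 'f::field ring)\<^esub> y = x * y"
  "x \<oplus>\<^bsub>(ring_of_type_algebra :: 'f::field ring)\<^esub> y = x + y"
  "\<zero>\<^bsub>(ring_of_type_algebra :: 'f::field ring)\<^esub> = 0"
  "\<one>\<^bsub>(ring_of_type_algebra :: 'f::field ring)\<^esub> = 1"
  by (auto simp: ring_of_type_algebra_def)

lemma cyclic_lie_abelian_group: "abelian_group (cyclic_lie q n :: ('f::field, nat \<Rightarrow> 'f) module)"
proof (rule abelian_groupI)
  fix x :: "nat \<Rightarrow> 'f" assume "x \<in> carrier (cyclic_lie q n)"
  then show "\<exists>y\<in>carrier (cyclic_lie q n). y \<oplus>\<^bsub>cyclic_lie q n\<^esub> x = \<zero>\<^bsub>cyclic_lie q n\<^esub>"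
    by (intro bexI[of _ "\<lambda>i. - x i"]) auto
qed (auto simp: add_ac)

lemma cyclic_lie_vectorspace:
  "vectorspace ring_of_type_algebra (cyclic_lie q n :: ('f::field, nat \<Rightarrow> 'f) module)"
  by (intro vectorspace.intro Module.module.intro module_axioms.intro cring_from_type_algebra
      field_from_type_algebra cyclic_lie_abelian_group) (auto simp: algebra_simps)

text \<open>As \<open>q \<le> n\<close>, every bracket has coordinate \<open>n\<close> equal to
  zero. A double bracket thus involves only coordinate \<open>n\<close> of its outer factor, and the
  terms of the Jacobi sum cancel cyclically.\<close>

lemma cyclic_lie_algebra:
  assumes "1 \<le> q" "q \<le> n"
  shows "lie_algebra ring_of_type_algebra (cyclic_lie q n :: ('f::field, nat \<Rightarrow> 'f) module)"
proof (intro lie_algebra.intro cyclic_lie_vectorspace lie_ring.intro cyclic_lie_abelian_group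
      lie_ring_axioms.intro lie_algebra_axioms.intro)
  fix u v w :: "nat \<Rightarrow> 'f"
  show "u \<otimes>\<^bsub>cyclic_lie q n\<^esub> (v \<otimes>\<^bsub>cyclic_lie q n\<^esub> w) \<oplus>\<^bsub>cyclic_lie q n\<^esub>
      v \<otimes>\<^bsub>cyclic_lie q n\<^esub> (w \<otimes>\<^bsub>cyclic_lie q n\<^esub> u) \<oplus>\<^bsub>cyclic_lie q n\<^esub>
      w \<otimes>\<^bsub>cyclic_lie q n\<^esub> (u \<otimes>\<^bsub>cyclic_lie q n\<^esub> v) = \<zero>\<^bsub>cyclic_lie q n\<^esub>"
    using assms by (auto simp: cyclic_bracket_def algebra_simps)
qed (use assms in \<open>auto simp: cyclic_bracket_def algebra_simps\<close>)

lemma cyclic_lie_finsum: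
  assumes "finite I" "\<And>i. i \<in> I \<Longrightarrow> x i \<in> carrier (cyclic_lie q n :: ('f::field, nat \<Rightarrow> 'f) module)"
  shows "(\<Oplus>\<^bsub>cyclic_lie q n\<^esub>i\<in>I. x i) = (\<lambda>j. \<Sum>i\<in>I. x i j)"
proof -
  interpret abelian_group "cyclic_lie q n :: ('f::field, nat \<Rightarrow> 'f) module" by (rule cyclic_lie_abelian_group)
  show ?thesis
    using assms
  proof (induct I)
    case (insert i I)
    then have "x \<in> I \<rightarrow> carrier (cyclic_lie q n)" "x i \<in> carrier (cyclic_lie q n)" by auto
    then show ?case using insert by simp
  qed simp
qed

definition unit_fun :: "nat \<Rightarrow> nat \<Rightarrow> 'f::field" where "unit_fun i = (\<lambda>j. if j = i then 1 else 0)"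

lemma unit_fun_eq_iff: "unit_fun i = (unit_fun j :: nat \<Rightarrow> 'f::field) \<longleftrightarrow> i = j"
  by (auto simp: unit_fun_def fun_eq_iff)

lemma cyclic_lie_basis:
  fixes q n :: nat
  defines "B \<equiv> unit_fun ` {..n} :: (nat \<Rightarrow> 'f::field) set"
  shows "vectorspace.basis ring_of_type_algebra (cyclic_lie q n :: ('f, nat \<Rightarrow> 'f) module) B"
proof -
  interpret vectorspace ring_of_type_algebra "cyclic_lie q n :: ('f, nat \<Rightarrow> 'f) module"
    by (rule cyclic_lie_vectorspace)
  have B: "finite B" "B \<subseteq> carrier (cyclic_lie q n)" by (auto simp: B_def unit_fun_def)
  have inj: "inj_on (unit_fun :: nat \<Rightarrow> nat \<Rightarrow> 'f) {..n}" by (auto simp: inj_on_def unit_fun_eq_iff)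
  have lc: "lincomb a B = (\<lambda>j. if j \<le> n then a (unit_fun j) else 0)" for a :: "(nat \<Rightarrow> 'f) \<Rightarrow> 'f"
  proof -
    have "lincomb a B = (\<lambda>j. \<Sum>b\<in>B. a b * b j)"
      unfolding lincomb_def using B by (subst cyclic_lie_finsum) auto
    also have "\<dots> = (\<lambda>j. \<Sum>i\<le>n. a (unit_fun i) * unit_fun i j)"
      unfolding B_def by (simp add: sum.reindex[OF inj])
    also have "\<dots> = (\<lambda>j. if j \<le> n then a (unit_fun j) else 0)"
    proof
      fix j
      have "(\<Sum>i\<le>n. a (unit_fun i) * unit_fun i j) = (\<Sum>i\<le>n. if i = j then a (unit_fun i) else 0)"
        by (intro sum.cong) (auto simp: unit_fun_def)
      then show "(\<Sum>i\<le>n. a (unit_fun i) * unit_fun i j) = (if j \<le> n then a (unit_fun j) else 0)" by simp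
    qed
    finally show ?thesis .
  qed
  show ?thesis
    unfolding basis_criterion[OF B]
  proof (intro allI impI)
    fix v :: "nat \<Rightarrow> 'f" assume v: "v \<in> carrier (cyclic_lie q n)"
    define a where "a = restrict (\<lambda>b. v (the_inv_into {..n} unit_fun b)) B"
    have a: "a (unit_fun j) = v j" if "j \<le> n" for j
      using that the_inv_into_f_f[OF inj, of j] by (simp add: a_def B_def)
    show "\<exists>!a. a \<in> B \<rightarrow>\<^sub>E carrier ring_of_type_algebra \<and> lincomb a B = v"
    proof (rule ex1I[of _ a])
      show "a \<in> B \<rightarrow>\<^sub>E carrier ring_of_type_algebra \<and> lincomb a B = v"
        using a v by (auto simp: lc a_def)
      fix b assume b: "b \<in> B \<rightarrow>\<^sub>E carrier ring_of_type_algebra \<and> lincomb b B = v"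
      then have "b (unit_fun j) = v j" if "j \<le> n" for j using fun_cong[OF lc[of b], of j] b that by simp
      then show "b = a"
        using b a by (intro PiE_ext[of b B "\<lambda>_. UNIV" a]) (auto simp: a_def B_def)
    qed
  qed
qed

lemma cyclic_lie_dim:
  "vectorspace.fin_dim ring_of_type_algebra (cyclic_lie q n :: ('f::field, nat \<Rightarrow> 'f) module)"
  "vectorspace.dim ring_of_type_algebra (cyclic_lie q n :: ('f::field, nat \<Rightarrow> 'f) module) = n + 1"
proof -
  interpret vectorspace ring_of_type_algebra "cyclic_lie q n :: ('f, nat \<Rightarrow> 'f) module"
    by (rule cyclic_lie_vectorspace)
  let ?B = "unit_fun ` {..n} :: (nat \<Rightarrow> 'f) set"
  have B: "basis ?B" by (rule cyclic_lie_basis)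
  then show "fin_dim" unfolding fin_dim_def by (intro exI[of _ ?B]) (simp add: basis_def)
  have "card ?B = n + 1" by (subst card_image) (auto simp: inj_on_def unit_fun_eq_iff)
  then show "dim = n + 1" using dim_basis[of ?B] B by simp
qed

text \<open>Repeated bracketing with the acting vector runs round the cycle, so every lower central
  term contains a unit vector.\<close>

lemma cyclic_lie_not_nilpotent:
  assumes q: "1 \<le> q" "q \<le> n"
  shows "\<not> lie_nilpotent (cyclic_lie q n :: ('f::field, nat \<Rightarrow> 'f) module)"
proof -
  have step: "cyclic_bracket q n (unit_fun j) (unit_fun n) = (unit_fun (Suc j mod q) :: nat \<Rightarrow> 'f)" if j: "j < q" for j
  proof
    fix k
    have "(k + q - 1) mod q = j \<longleftrightarrow> k = Suc j mod q" if k: "k < q"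
    proof (cases "k = 0")
      case True
      then show ?thesis using j q by (auto simp: mod_Suc)
    next
      case False
      then have "(k + q - 1) mod q = (k - 1 + q) mod q" by simp
      also have "\<dots> = k - 1" using k by simp
      finally show ?thesis using False k j by (auto simp: mod_Suc)
    qed
    moreover have "Suc j mod q < q" using q by simp
    ultimately show "cyclic_bracket q n (unit_fun j) (unit_fun n) k = (unit_fun (Suc j mod q) k :: 'f)"
      using q j by (auto simp: cyclic_bracket_def unit_fun_def)
  qed
  have mem: "unit_fun (i mod q) \<in> lower_central (cyclic_lie q n :: ('f, nat \<Rightarrow> 'f) module) i" for i
  proof (induct i)
    case 0
    then show ?case by (simp add: unit_fun_def)
  next
    case (Suc i)
    have "unit_fun (Suc i mod q) = unit_fun (i mod q) \<otimes>\<^bsub>cyclic_lie q n\<^esub> (unit_fun n :: nat \<Rightarrow> 'f)"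
      using step[of "i mod q"] q by (simp add: mod_Suc_eq)
    moreover have "(unit_fun n :: nat \<Rightarrow> 'f) \<in> carrier (cyclic_lie q n)" by (simp add: unit_fun_def)
    ultimately show ?case using Suc unfolding lower_central.simps by (intro generate.incl) blast
  qed
  show ?thesis
  proof
    assume "lie_nilpotent (cyclic_lie q n :: ('f, nat \<Rightarrow> 'f) module)"
    then obtain c where "lower_central (cyclic_lie q n :: ('f, nat \<Rightarrow> 'f) module) c = {\<lambda>_. 0}"
      by (auto simp: lie_nilpotent_def)
    then have "(unit_fun (c mod q) :: nat \<Rightarrow> 'f) = (\<lambda>_. 0)" using mem[of c] by simp
    from fun_cong[OF this, of "c mod q"] show False by (simp add: unit_fun_def)
  qed
qed

text \<open>A diagonal map is a derivation once weights add up along the nonzero brackets of basis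
  vectors; the hypothesis at \<open>j = q - 1\<close> is the one that closes the cycle.\<close>

lemma cyclic_lie_derivation:
  fixes ev :: "nat \<Rightarrow> 'f::field"
  assumes "1 \<le> q" "q \<le> n" and ev: "\<And>j. j < q \<Longrightarrow> ev (Suc j mod q) = ev j + ev n"
  shows "lie_derivation ring_of_type_algebra (cyclic_lie q n) (\<lambda>u j. ev j * u j)"
proof -
  have pred: "ev j = ev ((j + q - 1) mod q) + ev n" if "j < q" for j
  proof -
    have "Suc ((j + q - 1) mod q) mod q = (j + q) mod q" using assms(1) by (simp add: mod_Suc_eq)
    also have "\<dots> = j" using that by simp
    finally show ?thesis using ev[of "(j + q - 1) mod q"] assms(1) by simp
  qed
  have "ev j * cyclic_bracket q n u v j =
      cyclic_bracket q n (\<lambda>j. ev j * u j) v j + cyclic_bracket q n u (\<lambda>j. ev j * v j) j" for u v j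
  proof (cases "j < q")
    case True
    show ?thesis
      unfolding cyclic_bracket_def pred[OF True] using True by (simp add: algebra_simps)
  qed (simp add: cyclic_bracket_def)
  then show ?thesis
    unfolding lie_derivation_def module_hom_def by (auto simp: algebra_simps)
qed

lemma cyclic_lie_poly_annihilates:
  fixes ev :: "nat \<Rightarrow> 'f::field"
  assumes "\<And>j. j \<le> n \<Longrightarrow> poly p (ev j) = 0"
  shows "poly_annihilates p (cyclic_lie q n) (\<lambda>u j. ev j * u j)"
  unfolding poly_annihilates_def
proof
  fix u :: "nat \<Rightarrow> 'f" assume u: "u \<in> carrier (cyclic_lie q n)"
  have pow: "((\<lambda>u j. ev j * u j) ^^ i) u = (\<lambda>j. ev j ^ i * u j)" for i by (induct i) auto
  have "(\<Oplus>\<^bsub>cyclic_lie q n\<^esub>i\<in>{..degree p}. coeff p i \<odot>\<^bsub>cyclic_lie q n\<^esub> ((\<lambda>u j. ev j * u j) ^^ i) u)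
      = (\<lambda>j. \<Sum>i\<le>degree p. coeff p i * (ev j ^ i * u j))"
    unfolding pow using u by (subst cyclic_lie_finsum) auto
  also have "\<dots> = (\<lambda>j. poly p (ev j) * u j)" by (simp add: poly_altdef sum_distrib_right mult.assoc)
  also have "\<dots> = (\<lambda>_. 0)" using u assms by (auto simp: fun_eq_iff) (metis linorder_le_less_linear)
  finally show "(\<Oplus>\<^bsub>cyclic_lie q n\<^esub>i\<in>{..degree p}. coeff p i \<odot>\<^bsub>cyclic_lie q n\<^esub> ((\<lambda>u j. ev j * u j) ^^ i) u)
      = \<zero>\<^bsub>cyclic_lie q n\<^esub>" by simp
qed

lemma non_nilpotent_lie_algebra_exists:
  fixes p :: "'f::field poly"
  assumes p: "p \<noteq> 0" "degree p \<le> n" and nfree: "\<not> arith_free ring_of_type_algebra {\<alpha>. poly p \<alpha> = 0}"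
  shows "\<exists>(\<gg> :: ('f, nat \<Rightarrow> 'f) module) D. lie_algebra ring_of_type_algebra \<gg> \<and>
    vectorspace.fin_dim ring_of_type_algebra \<gg> \<and> vectorspace.dim ring_of_type_algebra \<gg> = n + 1 \<and>
    \<not> lie_nilpotent \<gg> \<and> lie_derivation ring_of_type_algebra \<gg> D \<and> poly_annihilates p \<gg> D"
proof -
  let ?S = "{\<alpha>. poly p \<alpha> = 0}"
  have S: "finite ?S" "card ?S \<le> n" using p card_poly_roots_bound[OF p(1)] by (auto simp: poly_roots_finite)
  obtain \<alpha> \<beta> where ab: "\<alpha> \<in> ?S" "\<beta> \<in> ?S" "\<And>k::nat. \<alpha> + of_nat k * \<beta> \<in> ?S"
    using nfree unfolding arith_free_def add_pow_ring_of_type_algebra by auto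
  have "\<not> inj_on (\<lambda>k::nat. \<alpha> + of_nat k * \<beta>) {..n}"
  proof
    assume "inj_on (\<lambda>k::nat. \<alpha> + of_nat k * \<beta>) {..n}"
    then have "card {..n} \<le> card ?S" using S(1) ab(3) by (intro card_inj_on_le) auto
    then show False using S(2) by simp
  qed
  then obtain i j where ij: "i < j" "j \<le> n" "\<alpha> + of_nat i * \<beta> = \<alpha> + of_nat j * \<beta>"
    unfolding inj_on_def by (metis atMost_iff nat_neq_iff)
  \<comment> \<open>The string takes at most \<open>n\<close> values, so two of its first
    \<open>n + 1\<close> terms agree, and the distance of their indices annihilates \<beta>. The
    bound \<open>q \<le> n\<close> leaves coordinate \<open>n\<close> for the acting vector.\<close>
  define q where "q = j - i"
  have q: "1 \<le> q" "q \<le> n" "of_nat q * \<beta> = 0"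
    using ij by (auto simp: q_def of_nat_diff algebra_simps)
  \<comment> \<open>The acting vector and the central vectors that fill up the dimension all get
    weight \<beta>, so every weight is a root.\<close>
  define ev where "ev j = (if j < q then \<alpha> + of_nat j * \<beta> else \<beta>)" for j
  have "ev (Suc j mod q) = ev j + ev n" if j: "j < q" for j
  proof (cases "Suc j = q")
    case True
    \<comment> \<open>At the end of the cycle the weight is back at \<alpha>, because
      \<open>of_nat q * \<beta> = 0\<close>.\<close>
    then have "\<alpha> + of_nat j * \<beta> + \<beta> = \<alpha> + of_nat q * \<beta>" by (auto simp: algebra_simps)
    then show ?thesis using True q j by (simp add: ev_def)
  next
    case False
    then show ?thesis using q j by (simp add: ev_def algebra_simps)
  qed
  then have "lie_derivation ring_of_type_algebra (cyclic_lie q n) (\<lambda>u j. ev j * u j)"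
    using q by (intro cyclic_lie_derivation)
  moreover have "poly_annihilates p (cyclic_lie q n) (\<lambda>u j. ev j * u j)"
    using ab by (intro cyclic_lie_poly_annihilates) (auto simp: ev_def)
  ultimately show ?thesis
    using cyclic_lie_algebra[OF q(1,2)] cyclic_lie_dim cyclic_lie_not_nilpotent[OF q(1,2)] by blast
qed

theorem mainTheorem1:
  fixes r :: "'k::field poly" and n :: nat and S :: "'k alg_closure set"
  assumes "infinite (UNIV :: 'l set)" and "infinite (UNIV :: 'b set)"
    and "r \<noteq> 0" and "degree r = n"
    and "S = {\<alpha>. poly (map_poly to_ac r) \<alpha> = 0}"
  shows
    "(arith_free ring_of_type_algebra S \<longrightarrow>
       (\<forall>(\<gg> :: ('k, 'g) module) D.
          lie_algebra ring_of_type_algebra \<gg> \<and>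
          vectorspace.fin_dim ring_of_type_algebra \<gg> \<and>
          lie_derivation ring_of_type_algebra \<gg> D \<and>
          poly_annihilates r \<gg> D
          \<longrightarrow> lie_nilpotent \<gg> \<and> nilpotency_class \<gg> \<le> higman TYPE('l) TYPE('b) n))
     \<and>
     (\<not> arith_free ring_of_type_algebra S \<longrightarrow>
       (\<exists>(\<gg> :: ('k alg_closure, nat \<Rightarrow> 'k alg_closure) module) D.
          lie_algebra ring_of_type_algebra \<gg> \<and>
          vectorspace.fin_dim ring_of_type_algebra \<gg> \<and>
          vectorspace.dim ring_of_type_algebra \<gg> = n + 1 \<and>
          \<not> lie_nilpotent \<gg> \<and>
          lie_derivation ring_of_type_algebra \<gg> D \<and>
          poly_annihilates (map_poly to_ac r) \<gg> D))"
proof (rule conjI)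
  show "arith_free ring_of_type_algebra S \<longrightarrow>
       (\<forall>(\<gg> :: ('k, 'g) module) D.
          lie_algebra ring_of_type_algebra \<gg> \<and>
          vectorspace.fin_dim ring_of_type_algebra \<gg> \<and>
          lie_derivation ring_of_type_algebra \<gg> D \<and>
          poly_annihilates r \<gg> D
          \<longrightarrow> lie_nilpotent \<gg> \<and> nilpotency_class \<gg> \<le> higman TYPE('l) TYPE('b) n)"
  proof (intro allI impI, elim conjE)
    fix \<gg> :: "('k, 'g) module" and D
    assume free: "arith_free ring_of_type_algebra S" and \<gg>: "lie_algebra ring_of_type_algebra \<gg>"
      "vectorspace.fin_dim ring_of_type_algebra \<gg>" "lie_derivation ring_of_type_algebra \<gg> D" "poly_annihilates r \<gg> D"
    have "lie_algebra_derivation \<gg> D"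
      using \<gg> by (intro lie_algebra_derivation.intro lie_algebra_derivation_axioms.intro)
    then have "lower_central \<gg> (higman TYPE('l) TYPE('b) n) = {\<zero>\<^bsub>\<gg>\<^esub>}"
      using lie_algebra_derivation.lower_central_higman[of \<gg> D r n] assms \<gg> free by simp
    then show "lie_nilpotent \<gg> \<and> nilpotency_class \<gg> \<le> higman TYPE('l) TYPE('b) n"
      unfolding lie_nilpotent_def nilpotency_class_def by (intro conjI exI Least_le)
  qed
  have "map_poly to_ac r \<noteq> 0" "degree (map_poly to_ac r) \<le> n"
    using assms by (auto simp: map_poly_eq_0_iff degree_map_poly)
  then show "\<not> arith_free ring_of_type_algebra S \<longrightarrow>
       (\<exists>(\<gg> :: ('k alg_closure, nat \<Rightarrow> 'k alg_closure) module) D.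
          lie_algebra ring_of_type_algebra \<gg> \<and>
          vectorspace.fin_dim ring_of_type_algebra \<gg> \<and>
          vectorspace.dim ring_of_type_algebra \<gg> = n + 1 \<and>
          \<not> lie_nilpotent \<gg> \<and>
          lie_derivation ring_of_type_algebra \<gg> D \<and>
          poly_annihilates (map_poly to_ac r) \<gg> D)"
    unfolding assms(5) using non_nilpotent_lie_algebra_exists by blast
qed

end
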